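(* Let $d\ge 2$ and let $\omega=(\omega_x)_{x\in\mathbb{Z}^d}$ be i.i.d. real weights such that (i) there exist $\nu>1$ and $c>0$ with $\mathbb{P}(\omega_x<-t)<e^{-ct^\nu}$ for all $t>0$; and (ii) $\Lambda(t)=\log\mathbb{E}[e^{t\omega_x}]$ is finite in some open interval about $0$ and $\mu<\sup_{t\ge 0}\Lambda'(t)$, where $\mu$ is the time constant. Write $$\Gamma_n^{\ge}=\{\gamma\in\Gamma_n:\ \mathbb{P}(\gamma\in\Gamma_n^* )\ge\mathbb{P}(\gamma^{\ulcorner}\in\Gamma_n^* )\}.$$ For any $\epsilon>0$, it holds for all $n$ large enough that $$|\Gamma_n^{\ge}|\le e^{\epsilon n}\qquad\text{and}\qquad\frac{|\Gamma_n^{\ge}|}{|\Gamma_n|}\le d^{-dn(1-\epsilon)}.$$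
   Context: Directed last passage percolation on $\mathbb{Z}^d$: a directed path is a finite sequence of vertices whose successive increments lie in $\{e_1,\dots,e_d\}$. $\Gamma_n$ is the set of directed paths from $0$ to $(n,\dots,n)\in\mathbb{Z}^d$. The passage time of a path is $L(\gamma)=\sum_{x\in\gamma}\omega_x$ (endpoints included), $L_n=\max_{\gamma\in\Gamma_n}L(\gamma)$, and $\Gamma_n^*=\{\gamma\in\Gamma_n: L(\gamma)=L_n\}$ is the set of geodesics. The time constant $\mu$ is the almost sure limit $\mu=\lim_{n\to\infty}L_n/(dn)$. The supremum of $\Lambda'$ is over $t\ge 0$ where $\Lambda$ is finite and differentiable. $\gamma^{\ulcorner}\in\Gamma_n$ is the corner path made of straight segments $(0,\dots,0)\to(0,\dots,0,n)\to(0,\dots,0,n,n)\to\cdots\to(n,\dots,n)$. *)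

theory Defs
  imports "HOL-Probability.Probability"
begin

text \<open>Vertices of \<open>\<int>\<^sup>d\<close> are vectors of type \<^typ>\<open>int ^ 'd\<close> with \<open>d = CARD('d)\<close>; the unit vectors
  are \<^term>\<open>axis i 1\<close>. The linear order on \<open>'d\<close>, required only where coordinates are enumerated,
  plays the role of the order of \<open>{1, \<dots>, d}\<close>. A path is the list of its vertices.\<close>

definition directed_path :: "(int ^ 'd::finite) list \<Rightarrow> bool" where
  "directed_path \<gamma> \<longleftrightarrow>
     \<gamma> \<noteq> [] \<and> (\<forall>k. Suc k < length \<gamma> \<longrightarrow> (\<exists>i. \<gamma> ! Suc k - \<gamma> ! k = axis i 1))"

definition diag_paths :: "nat \<Rightarrow> (int ^ 'd::finite) list set" where
  "diag_paths n = {\<gamma>. directed_path \<gamma> \<and> hd \<gamma> = 0 \<and> last \<gamma> = (\<chi> i. int n)}"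

text \<open>The vertices of a directed path are distinct, so the list sum below counts each vertex once.\<close>

definition passage_time :: "(int ^ 'd::finite \<Rightarrow> real) \<Rightarrow> (int ^ 'd) list \<Rightarrow> real" where
  "passage_time w \<gamma> = (\<Sum>x\<leftarrow>\<gamma>. w x)"

definition last_passage_time :: "(int ^ 'd::finite \<Rightarrow> real) \<Rightarrow> nat \<Rightarrow> real" where
  "last_passage_time w n = Max (passage_time w ` diag_paths n)"

definition geodesics :: "(int ^ 'd::finite \<Rightarrow> real) \<Rightarrow> nat \<Rightarrow> (int ^ 'd) list set" where
  "geodesics w n = {\<gamma> \<in> diag_paths n. passage_time w \<gamma> = last_passage_time w n}"

definition is_time_constant ::
    "'a measure \<Rightarrow> (int ^ 'd::finite \<Rightarrow> 'a \<Rightarrow> real) \<Rightarrow> real \<Rightarrow> bool" where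
  "is_time_constant M \<omega> \<mu> \<longleftrightarrow>
     (AE s in M. (\<lambda>n. last_passage_time (\<lambda>x. \<omega> x s) n / (real CARD('d) * real n))
        \<longlonglongrightarrow> \<mu>)"

definition geodesic_prob ::
    "'a measure \<Rightarrow> (int ^ 'd::finite \<Rightarrow> 'a \<Rightarrow> real) \<Rightarrow> nat \<Rightarrow> (int ^ 'd) list \<Rightarrow> real" where
  "geodesic_prob M \<omega> n \<gamma> = \<P>(s in M. \<gamma> \<in> geodesics (\<lambda>x. \<omega> x s) n)"

definition path_of_steps :: "'d::finite list \<Rightarrow> (int ^ 'd) list" where
  "path_of_steps js = map (\<lambda>k. \<Sum>j\<leftarrow>take k js. axis j 1) [0..<Suc (length js)]"

text \<open>\<open>n\<close> steps in the direction of the last (largest) coordinate, then \<open>n\<close> in that of the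
  last but one, and so on.\<close>

definition corner_path :: "nat \<Rightarrow> (int ^ 'd::{finite,linorder}) list" where
  "corner_path n = path_of_steps (concat (map (replicate n) (rev (sorted_list_of_set UNIV))))"

definition likely_paths ::
    "'a measure \<Rightarrow> (int ^ 'd::{finite,linorder} \<Rightarrow> 'a \<Rightarrow> real) \<Rightarrow> nat \<Rightarrow> (int ^ 'd::{finite,linorder}) list set" where
  "likely_paths M \<omega> n =
     {\<gamma> \<in> diag_paths n. geodesic_prob M \<omega> n \<gamma> \<ge> geodesic_prob M \<omega> n (corner_path n)}"

text \<open>The logarithmic moment generating function takes values in \<open>(-\<infinity>, \<infinity>]\<close>. It is represented by
  its set of finiteness together with a real-valued function that is meaningful only on that set.\<close>

definition log_mgf_finite :: "'a measure \<Rightarrow> ('a \<Rightarrow> real) \<Rightarrow> real set" where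
  "log_mgf_finite M X = {t. integrable M (\<lambda>s. exp (t * X s))}"

definition log_mgf :: "'a measure \<Rightarrow> ('a \<Rightarrow> real) \<Rightarrow> real \<Rightarrow> real" where
  "log_mgf M X t = ln (\<integral>s. exp (t * X s) \<partial>M)"

text \<open>The supremum may be \<open>\<infinity>\<close>. Restricting to interior points of the set of finiteness keeps
  \<^const>\<open>deriv\<close> from seeing values of \<^const>\<open>log_mgf\<close> outside that set.\<close>

definition sup_log_mgf_deriv :: "'a measure \<Rightarrow> ('a \<Rightarrow> real) \<Rightarrow> ereal" where
  "sup_log_mgf_deriv M X =
     (SUP t \<in> {t. t \<ge> 0 \<and> t \<in> interior (log_mgf_finite M X) \<and> log_mgf M X differentiable at t}.
        ereal (deriv (log_mgf M X) t))"

end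

theory Submission
  imports Defs
begin

text \<open>A path that turns \<open>K\<close> times pays twice for being a geodesic: its total weight must be about
  \<open>\<mu> d n\<close>, and at each turn the vertex on the other side of the corner must not be heavier. The lower
  tail of \<open>L\<^sub>n\<close> is superexponentially small (many disjoint diagonal strips would all have to fail), so a
  Chernoff bound with tilt \<open>t\<close> gives the upper bound
  \<open>exp (- d n (t \<mu> - \<Lambda> t) + o(n)) (1 - \<kappa>)\<^sup>K\<close>, with \<open>\<kappa> > 0\<close> because the tilted law is not degenerate.
  The corner path attains the first factor. Tilt its weights to a mean slightly above some \<open>\<rho> > \<mu>\<close>; with
  positive probability all their partial sums away from the corners stay above slope \<open>\<rho>\<close>. An
  excursion from the corner path has to straddle a corner, and by symmetry and superadditivity the
  passage time over a displacement of length \<open>k\<close> in any direction exceeds \<open>\<rho> k\<close> only with small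
  probability. Grouping the excursions into \<open>O((ln n)\<^sup>2)\<close> cells by the logarithms of the distances of
  their ends from the corner, the Harris inequality shows that none of them beats the corner path
  with probability at least \<open>exp (- o(n))\<close>. Hence every likely path has \<open>o(n)\<close> turns, and there are only
  \<open>exp (o(n))\<close> such paths.\<close>

section \<open>Independent weights\<close>

text \<open>The lower bound for the corner path may be exponentially small, so the event that
  \<open>L_n\<close> falls below \<open>(\<mu> - \<delta>) d n\<close> must be negligible against
  \<open>exp (- K n)\<close> for every \<open>K\<close>. Condition (i) with \<open>\<nu> > 1\<close>
  provides this, because the strips are joined to the two endpoints through boundedly many vertices.
  The tilt that suits the corner path depends on \<open>\<delta>\<close>, while
  \<open>\<delta>\<close> has to be small against the loss \<open>\<kappa>\<close> per turn; hence
  \<open>\<kappa>\<close> is needed uniformly over all tilts in a compact interval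
  \<open>[0, t1]\<close>, where \<open>\<Lambda>'(t1) > \<mu>\<close> comes from (ii). For the lower
  bound a union bound over excursions is hopeless, since short ones beat slope \<open>\<rho>\<close>
  with a probability that is not small, and Harris applied to each of the order of
  \<open>n^2\<close> pairs of endpoints would cost too much; a cell of comparable excursions costs
  only one constant factor. The sum over an excursion omits its endpoints, so that these events live
  off the corner path and are independent of the tilted weights on it.\<close>

type_synonym 'd weights = "(int, 'd) vec \<Rightarrow> real"

text \<open>Agreement on \<open>J\<close> replaces measurability with respect to the sigma-algebra
  generated by the coordinates in \<open>J\<close>. It is checked without any measure theory, and
  joined with measurability on the whole product it suffices for independence.\<close>

definition depends_on :: "'i set \<Rightarrow> (('i \<Rightarrow> real) \<Rightarrow> 'b) \<Rightarrow> bool" where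
  "depends_on J F \<longleftrightarrow> (\<forall>v w. (\<forall>x\<in>J. v x = w x) \<longrightarrow> F v = F w)"

lemma depends_onI: "(\<And>v w. (\<And>x. x \<in> J \<Longrightarrow> v x = w x) \<Longrightarrow> F v = F w) \<Longrightarrow> depends_on J F"
  unfolding depends_on_def by blast

lemma depends_onD: "depends_on J F \<Longrightarrow> (\<And>x. x \<in> J \<Longrightarrow> v x = w x) \<Longrightarrow> F v = F w"
  unfolding depends_on_def by blast

text \<open>The single-site law is a parameter because the locale is interpreted a second time with
  the exponentially tilted law.\<close>

locale iid_weights =
  fixes D :: "real measure"
  assumes prob_D: "prob_space D" and sets_D [measurable_cong]: "sets D = sets borel"
begin

text \<open>The index type is left polymorphic: the same symbol serves the lattice and, with
  \<open>nat\<close> as index, the weights read along the corner path.\<close>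

definition Q :: "('i \<Rightarrow> real) measure" where
  "Q = Pi\<^sub>M UNIV (\<lambda>_. D)"

abbreviation Pr :: "(('i \<Rightarrow> real) \<Rightarrow> bool) \<Rightarrow> real" where
  "Pr A \<equiv> measure Q (Collect A)"

lemma space_D: "space D = UNIV"
  using sets_eq_imp_space_eq[OF sets_D] by simp

lemma prob_Q: "prob_space Q"
  unfolding Q_def by (intro prob_space_PiM prob_D)

lemma space_Q [simp]: "space Q = UNIV"
  by (simp add: Q_def space_PiM space_D)

lemma coord_measurable [measurable]: "(\<lambda>w. w x) \<in> borel_measurable Q"
proof -
  have "(\<lambda>w. w x) \<in> Q \<rightarrow>\<^sub>M D"
    unfolding Q_def by (rule measurable_component_singleton) simp
  thus ?thesis using measurable_cong_sets[OF refl sets_D] by blast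
qed

lemma measurable_into_Q:
  assumes "\<And>x. (\<lambda>s. f s x) \<in> borel_measurable N"
  shows "f \<in> N \<rightarrow>\<^sub>M Q"
proof -
  have "(\<lambda>s. f s x) \<in> N \<rightarrow>\<^sub>M D" for x
    using assms[of x] measurable_cong_sets[OF refl sets_D] by blast
  thus ?thesis unfolding Q_def
    by (intro measurable_PiM_single') (auto simp: space_PiM space_D)
qed

lemma sets_Q_Collect: "Measurable.pred Q A \<Longrightarrow> Collect A \<in> sets Q"
  by (simp add: pred_def)

lemma distr_coord: "distr Q D (\<lambda>w. w x) = D"
  unfolding Q_def by (rule distr_PiM_component[OF prob_D]) simp

lemma integral_coord:
  assumes "f \<in> borel_measurable borel"
  shows "(\<integral>w. f (w x) \<partial>Q) = (\<integral>y. f y \<partial>D :: real)"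
proof -
  have "(\<integral>y. f y \<partial>D) = (\<integral>y. f y \<partial>distr Q D (\<lambda>w. w x))" by (simp add: distr_coord)
  also have "\<dots> = (\<integral>w. f (w x) \<partial>Q)"
    by (rule integral_distr) (use assms sets_D in \<open>auto cong: measurable_cong_sets\<close>)
  finally show ?thesis ..
qed

lemma integrable_coord:
  assumes "f \<in> borel_measurable borel"
  shows "integrable Q (\<lambda>w. f (w x)) \<longleftrightarrow> integrable D (f :: real \<Rightarrow> real)"
proof -
  have "integrable D f \<longleftrightarrow> integrable (distr Q D (\<lambda>w. w x)) f" by (simp add: distr_coord)
  also have "\<dots> \<longleftrightarrow> integrable Q (\<lambda>w. f (w x))"
    by (rule integrable_distr_eq) (use assms sets_D in \<open>auto cong: measurable_cong_sets\<close>)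
  finally show ?thesis ..
qed

lemma Pr_coord:
  assumes [measurable]: "Measurable.pred borel A"
  shows "Pr (\<lambda>w. A (w x)) = measure D (Collect A)"
proof -
  have "measure D (Collect A) = measure (distr Q D (\<lambda>w. w x)) (Collect A)" by (simp add: distr_coord)
  also have "\<dots> = measure Q ((\<lambda>w. w x) -` Collect A \<inter> space Q)"
  proof (rule measure_distr)
    show "(\<lambda>w. w x) \<in> Q \<rightarrow>\<^sub>M D" using sets_D by (simp cong: measurable_cong_sets)
    show "Collect A \<in> sets D" using assms by (simp add: sets_D pred_def)
  qed
  finally show ?thesis by (simp add: vimage_def)
qed

lemma indep_vars_coord: "prob_space.indep_vars Q (\<lambda>_. D) (\<lambda>x w. w x) (UNIV :: 'i set)"
proof -
  interpret Q: prob_space "Q :: ('i \<Rightarrow> real) measure" by (rule prob_Q)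
  have [measurable]: "(\<lambda>w. w x) \<in> Q \<rightarrow>\<^sub>M D" for x :: 'i
    using sets_D by (simp cong: measurable_cong_sets)
  show ?thesis
    by (subst Q.indep_vars_iff_distr_eq_PiM)
       (simp_all add: distr_coord restrict_UNIV, simp add: Q_def[symmetric] distr_id2)
qed

lemma measurable_extend:
  "(\<lambda>v x. if x \<in> K then v x else 0) \<in> Pi\<^sub>M K (\<lambda>_. D) \<rightarrow>\<^sub>M Q"
proof (rule measurable_into_Q)
  fix x
  show "(\<lambda>v. if x \<in> K then v x else 0) \<in> borel_measurable (Pi\<^sub>M K (\<lambda>_. D))"
    using measurable_component_singleton[of x K "\<lambda>_. D"] sets_D
    by (cases "x \<in> K") (simp_all cong: measurable_cong_sets)
qed

text \<open>Restrictions of the configuration to disjoint blocks are independent, and a function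
  that only looks at \<open>K l\<close> factors through such a restriction: extend it by 0 outside
  the block. The value 0 is arbitrary.\<close>

lemma indep_vars_depends_on:
  fixes F :: "'l \<Rightarrow> ('i \<Rightarrow> real) \<Rightarrow> 'b"
  assumes disj: "disjoint_family_on K L"
    and dep: "\<And>l. l \<in> L \<Longrightarrow> depends_on (K l) (F l)"
    and meas: "\<And>l. l \<in> L \<Longrightarrow> F l \<in> Q \<rightarrow>\<^sub>M N l"
  shows "prob_space.indep_vars Q N F L"
proof -
  interpret Q: prob_space "Q :: ('i \<Rightarrow> real) measure" by (rule prob_Q)
  define Y where "Y l v = F l (\<lambda>x. if x \<in> K l then v x else 0)" for l v
  have "Q.indep_vars (\<lambda>j. Pi\<^sub>M (K j) (\<lambda>_. D)) (\<lambda>j \<omega>. restrict (\<lambda>i. \<omega> i) (K j)) L"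
    by (rule Q.indep_vars_restrict[OF indep_vars_coord]) (use disj in auto)
  then have "Q.indep_vars N (\<lambda>l w. Y l (restrict (\<lambda>i. w i) (K l))) L"
  proof (rule Q.indep_vars_compose2)
    fix l assume "l \<in> L"
    show "Y l \<in> Pi\<^sub>M (K l) (\<lambda>_. D) \<rightarrow>\<^sub>M N l"
      unfolding Y_def using measurable_compose[OF measurable_extend meas[OF \<open>l \<in> L\<close>]] by simp
  qed
  also have "Q.indep_vars N (\<lambda>l w. Y l (restrict (\<lambda>i. w i) (K l))) L \<longleftrightarrow> Q.indep_vars N F L"
  proof (rule Q.indep_vars_cong)
    fix l assume "l \<in> L"
    show "(\<lambda>w. Y l (restrict (\<lambda>i. w i) (K l))) = F l"
      unfolding Y_def by (intro ext depends_onD[OF dep[OF \<open>l \<in> L\<close>]]) auto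
  qed auto
  finally show ?thesis .
qed

lemma expectation_prod:
  fixes F :: "'l \<Rightarrow> ('i \<Rightarrow> real) \<Rightarrow> real"
  assumes "finite L" "disjoint_family_on K L"
    and "\<And>l. l \<in> L \<Longrightarrow> depends_on (K l) (F l)"
    and "\<And>l. l \<in> L \<Longrightarrow> integrable Q (F l)"
  shows "integrable Q (\<lambda>w. \<Prod>l\<in>L. F l w)"
    and "(\<integral>w. (\<Prod>l\<in>L. F l w) \<partial>Q) = (\<Prod>l\<in>L. \<integral>w. F l w \<partial>Q)"
proof -
  interpret Q: prob_space "Q :: ('i \<Rightarrow> real) measure" by (rule prob_Q)
  have "Q.indep_vars (\<lambda>_. borel) F L"
    by (rule indep_vars_depends_on[OF assms(2,3)]) (use assms(4) in auto)
  from Q.indep_vars_lebesgue_integral[OF assms(1) this assms(4)]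
    Q.indep_vars_integrable[OF assms(1) this assms(4)]
  show "integrable Q (\<lambda>w. \<Prod>l\<in>L. F l w)" "(\<integral>w. (\<Prod>l\<in>L. F l w) \<partial>Q) = (\<Prod>l\<in>L. \<integral>w. F l w \<partial>Q)"
    by auto
qed

lemma Pr_conj_indep:
  fixes A B :: "('i \<Rightarrow> real) \<Rightarrow> bool"
  assumes "I \<inter> J = {}" "depends_on I A" "depends_on J B"
    and [measurable]: "Measurable.pred Q A" "Measurable.pred Q B"
  shows "Pr (\<lambda>w. A w \<and> B w) = Pr A * Pr B"
proof -
  interpret Q: prob_space "Q :: ('i \<Rightarrow> real) measure" by (rule prob_Q)
  define F where "F b = (if b then A else B)" for b
  have "Q.indep_vars (\<lambda>_. count_space UNIV) F UNIV"
    by (rule indep_vars_depends_on[where K = "\<lambda>b. if b then I else J"])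
      (use assms in \<open>auto simp: disjoint_family_on_def F_def split: if_splits\<close>)
  from Q.indep_varsD_finite[OF this, of "\<lambda>_. {True}"]
  have "Q.prob (\<Inter>b. F b -` {True} \<inter> space Q) = (\<Prod>b\<in>UNIV. Q.prob (F b -` {True} \<inter> space Q))"
    by simp
  moreover have "(\<Inter>b. F b -` {True} \<inter> space Q) = {w. A w \<and> B w}"
    by (simp add: INT_bool_eq F_def vimage_def Collect_conj_eq)
  moreover have "(\<Prod>b\<in>UNIV. Q.prob (F b -` {True} \<inter> space Q)) = Pr A * Pr B"
    by (simp add: UNIV_bool F_def vimage_def mult.commute)
  ultimately show ?thesis by simp
qed

text \<open>Both sides equal the probability of the same event under the product over
  \<open>J\<close> alone. Injectivity is asked on \<open>J\<close> only; the parametrisation of the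
  corner path by \<open>nat\<close> is injective just up to its length.\<close>

lemma Pr_reindex:
  fixes f :: "'i \<Rightarrow> 'j"
  assumes inj: "inj_on f J" and dep: "depends_on J A" and meas: "Measurable.pred Q A"
  shows "Pr (\<lambda>w. A (\<lambda>x. w (f x))) = Pr A"
proof -
  have *: "Pr (\<lambda>w. A (\<lambda>x. w (g x))) = measure (Pi\<^sub>M J (\<lambda>_. D))
      {v \<in> space (Pi\<^sub>M J (\<lambda>_. D)). A (\<lambda>x. if x \<in> J then v x else 0)}" (is "_ = measure ?N ?S")
    if g: "inj_on g J" for g :: "'i \<Rightarrow> 'k"
  proof -
    have S: "?S \<in> sets ?N"
      using measurable_compose[OF measurable_extend meas] by (simp add: pred_def)
    have d: "distr Q ?N (\<lambda>w. \<lambda>n\<in>J. w (g n)) = ?N"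
      unfolding Q_def using distr_PiM_reindex[of UNIV "\<lambda>_. D" g J] prob_D g by auto
    have "measure ?N ?S = measure (distr Q ?N (\<lambda>w. \<lambda>n\<in>J. w (g n))) ?S" by (simp add: d)
    also have "\<dots> = measure Q ((\<lambda>w. \<lambda>n\<in>J. w (g n)) -` ?S \<inter> space Q)"
    proof (rule measure_distr[OF _ S])
      have "(\<lambda>w. w (g x)) \<in> Q \<rightarrow>\<^sub>M D" for x using sets_D by (simp cong: measurable_cong_sets)
      thus "(\<lambda>w. \<lambda>n\<in>J. w (g n)) \<in> Q \<rightarrow>\<^sub>M ?N" by (intro measurable_restrict)
    qed
    also have "(\<lambda>w. \<lambda>n\<in>J. w (g n)) -` ?S \<inter> space Q = {w. A (\<lambda>x. w (g x))}"
    proof -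
      have "A (\<lambda>x. if x \<in> J then restrict (\<lambda>n. w (g n)) J x else 0) = A (\<lambda>x. w (g x))" for w
        by (rule depends_onD[OF dep]) auto
      thus ?thesis by (auto simp: space_PiM space_D)
    qed
    finally show ?thesis ..
  qed
  show ?thesis using *[OF inj] *[of "\<lambda>x. x"] by simp
qed

lemma distr_reindex:
  fixes f :: "'i \<Rightarrow> 'j"
  assumes "inj f"
  shows "distr Q Q (\<lambda>w x. w (f x)) = Q"
proof -
  have "distr Q Q (\<lambda>w. \<lambda>n\<in>UNIV. w (f n)) = Q"
    unfolding Q_def by (rule distr_PiM_reindex) (use assms prob_D in auto)
  thus ?thesis by (simp only: restrict_UNIV)
qed

lemma integral_reindex:
  fixes f :: "'i \<Rightarrow> 'j" and F :: "('i \<Rightarrow> real) \<Rightarrow> real"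
  assumes "inj f" "F \<in> borel_measurable Q"
  shows "(\<integral>w. F (\<lambda>x. w (f x)) \<partial>Q) = (\<integral>w. F w \<partial>Q)"
    and "integrable Q (\<lambda>w. F (\<lambda>x. w (f x))) \<longleftrightarrow> integrable Q F"
proof -
  have m: "(\<lambda>w x. w (f x)) \<in> Q \<rightarrow>\<^sub>M Q" by (rule measurable_into_Q) simp
  show "(\<integral>w. F (\<lambda>x. w (f x)) \<partial>Q) = (\<integral>w. F w \<partial>Q)"
    using integral_distr[OF m assms(2)] distr_reindex[OF assms(1)] by simp
  show "integrable Q (\<lambda>w. F (\<lambda>x. w (f x))) \<longleftrightarrow> integrable Q F"
    using integrable_distr_eq[OF m assms(2)] distr_reindex[OF assms(1)] by simp
qed

end

text \<open>Chebyshev's association inequality: with \<open>c\<close> the mean of \<open>g\<close> and \<open>a\<close> a threshold value of \<open>f\<close>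
  on \<open>{g \<le> c}\<close>, the product \<open>(f - a) (g - c)\<close> is pointwise nonnegative.\<close>

lemma integral_mono_mult_ge:
  fixes D :: "real measure" and f g :: "real \<Rightarrow> real"
  assumes "prob_space D" and sets_D: "sets D = sets borel"
    and [measurable]: "f \<in> borel_measurable borel" "g \<in> borel_measurable borel"
    and "mono f" "mono g" and bd: "\<And>x. \<bar>f x\<bar> \<le> 1" "\<And>x. \<bar>g x\<bar> \<le> 1"
  shows "(\<integral>x. f x \<partial>D) * (\<integral>x. g x \<partial>D) \<le> (\<integral>x. f x * g x \<partial>D)"
proof -
  interpret prob_space D by fact
  note [measurable_cong] = sets_D
  define c where "c = (\<integral>x. g x \<partial>D)"
  \<comment> \<open>The lower bound -1 of \<open>f\<close> keeps \<open>S\<close> nonempty, so that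
    \<open>Sup\<close> is meaningful in every case.\<close>
  define S where "S = insert (-1) (f ` {y. g y \<le> c})"
  define a where "a = Sup S"
  have bdd: "bdd_above S" using bd(1) abs_le_D1 unfolding S_def by (intro bdd_aboveI[of _ 1]) fastforce
  have pos: "0 \<le> (f x - a) * (g x - c)" for x
  proof (cases "g x \<le> c")
    case True
    hence "f x \<le> a" unfolding a_def using bdd by (intro cSup_upper) (auto simp: S_def)
    thus ?thesis using True by (intro mult_nonpos_nonpos) auto
  next
    case False
    have "s \<le> f x" if s: "s \<in> S" for s
    proof -
      consider "s = -1" | y where "s = f y" "g y \<le> c" using s unfolding S_def by blast
      thus ?thesis
      proof cases
        case 1 thus ?thesis using bd(1)[of x] by (simp add: abs_le_iff)
      next
        case 2
        hence "y \<le> x" using False \<open>mono g\<close> by (meson le_cases monoD order_trans)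
        thus ?thesis using \<open>mono f\<close> 2 by (simp add: monoD)
      qed
    qed
    hence "a \<le> f x" unfolding a_def by (intro cSup_least) (auto simp: S_def)
    thus ?thesis using False by simp
  qed
  have int: "integrable D f" "integrable D g"
    using bd by (auto intro!: integrable_const_bound[of _ 1])
  have intfg: "integrable D (\<lambda>x. f x * g x)"
    using bd by (intro integrable_const_bound[of _ 1]) (auto simp: abs_mult intro!: mult_le_one)
  have "0 \<le> (\<integral>x. (f x - a) * (g x - c) \<partial>D)" using pos by simp
  also have "(\<integral>x. (f x - a) * (g x - c) \<partial>D) = (\<integral>x. f x * g x - c * f x - a * g x + a * c \<partial>D)"
    by (intro Bochner_Integration.integral_cong) (auto simp: algebra_simps)
  also have "\<dots> = (\<integral>x. f x * g x \<partial>D) - c * (\<integral>x. f x \<partial>D) - a * c + a * c"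
    using int intfg by (simp add: c_def prob_space)
  finally show ?thesis by (simp add: c_def mult.commute)
qed

section \<open>The Harris inequality for monotone functions of finitely many weights, and
  exponential tilting\<close>

context iid_weights
begin

lemma measurable_fun_upd_Q:
  fixes x :: 'i
  shows "(\<lambda>(y, w). w(x := y)) \<in> D \<Otimes>\<^sub>M Q \<rightarrow>\<^sub>M Q"
proof (rule measurable_into_Q)
  fix z
  have "(\<lambda>p. fst p) \<in> borel_measurable (D \<Otimes>\<^sub>M (Q :: ('i \<Rightarrow> real) measure))"
    by (simp cong: measurable_cong_sets add: sets_D[symmetric])
  thus "(\<lambda>p. (case p of (y, w) \<Rightarrow> w(x := y)) z) \<in> borel_measurable (D \<Otimes>\<^sub>M (Q :: ('i \<Rightarrow> real) measure))"
    by (cases "z = x") (simp_all add: case_prod_beta)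
qed

lemma distr_resample: "distr (D \<Otimes>\<^sub>M Q) Q (\<lambda>(y, w). w(x := y)) = Q"
  using distr_pair_PiM_eq_PiM[of UNIV "\<lambda>_. D" x] prob_D by (simp add: Q_def)

lemma nn_integral_resample:
  fixes F :: "('i \<Rightarrow> real) \<Rightarrow> ennreal"
  assumes [measurable]: "F \<in> borel_measurable Q"
  shows "(\<integral>\<^sup>+w. F w \<partial>Q) = (\<integral>\<^sup>+w. (\<integral>\<^sup>+y. F (w(x := y)) \<partial>D) \<partial>Q)"
proof -
  interpret D: prob_space D by (rule prob_D)
  interpret Q: prob_space "Q :: ('i \<Rightarrow> real) measure" by (rule prob_Q)
  interpret P: pair_sigma_finite D "Q :: ('i \<Rightarrow> real) measure" ..
  have m: "(\<lambda>p. F (case p of (y, w) \<Rightarrow> w(x := y))) \<in> borel_measurable (D \<Otimes>\<^sub>M Q)"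
    using measurable_compose[OF measurable_fun_upd_Q assms] .
  have "(\<integral>\<^sup>+w. F w \<partial>Q) = (\<integral>\<^sup>+w. F w \<partial>distr (D \<Otimes>\<^sub>M Q) Q (\<lambda>(y, w). w(x := y)))"
    by (simp add: distr_resample)
  also have "\<dots> = (\<integral>\<^sup>+p. F (case p of (y, w) \<Rightarrow> w(x := y)) \<partial>(D \<Otimes>\<^sub>M Q))"
    by (rule nn_integral_distr[OF measurable_fun_upd_Q]) simp
  also have "\<dots> = (\<integral>\<^sup>+w. (\<integral>\<^sup>+y. F (w(x := y)) \<partial>D) \<partial>Q)"
    using P.nn_integral_snd[of "\<lambda>(y, w). F (w(x := y))"] m by (simp add: case_prod_unfold)
  finally show ?thesis .
qed

lemma integral_resample:
  fixes F :: "('i \<Rightarrow> real) \<Rightarrow> real"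
  assumes [measurable]: "F \<in> borel_measurable Q" and bd: "\<And>w. \<bar>F w\<bar> \<le> B"
  shows "(\<integral>w. F w \<partial>Q) = (\<integral>w. (\<integral>y. F (w(x := y)) \<partial>D) \<partial>Q)"
    and "(\<lambda>w. \<integral>y. F (w(x := y)) \<partial>D) \<in> borel_measurable Q"
proof -
  interpret D: prob_space D by (rule prob_D)
  interpret Q: prob_space "Q :: ('i \<Rightarrow> real) measure" by (rule prob_Q)
  interpret P: pair_prob_space D "Q :: ('i \<Rightarrow> real) measure" ..
  have m: "(\<lambda>p. F (case p of (y, w) \<Rightarrow> w(x := y))) \<in> borel_measurable (D \<Otimes>\<^sub>M Q)"
    using measurable_compose[OF measurable_fun_upd_Q assms(1)] .
  have i: "integrable (D \<Otimes>\<^sub>M Q) (\<lambda>(y, w). F (w(x := y)))"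
    using m bd by (intro P.integrable_const_bound[of _ B]) (auto simp: case_prod_beta)
  have "(\<integral>w. F w \<partial>Q) = (\<integral>w. F w \<partial>distr (D \<Otimes>\<^sub>M Q) Q (\<lambda>(y, w). w(x := y)))"
    by (simp add: distr_resample)
  also have "\<dots> = (\<integral>p. F (case p of (y, w) \<Rightarrow> w(x := y)) \<partial>(D \<Otimes>\<^sub>M Q))"
    by (rule integral_distr[OF measurable_fun_upd_Q]) simp
  also have "\<dots> = (\<integral>w. (\<integral>y. F (w(x := y)) \<partial>D) \<partial>Q)"
    using P.integral_snd[OF i] by (simp add: case_prod_unfold)
  finally show "(\<integral>w. F w \<partial>Q) = (\<integral>w. (\<integral>y. F (w(x := y)) \<partial>D) \<partial>Q)" .
  have "(\<lambda>p. F ((snd p)(x := fst p))) \<in> borel_measurable (D \<Otimes>\<^sub>M Q)" using m by (simp add: case_prod_beta)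
  from measurable_compose[OF measurable_pair_swap'[of Q D] this]
  have "(\<lambda>(w, y). F (w(x := y))) \<in> borel_measurable (Q \<Otimes>\<^sub>M D)" by (simp add: case_prod_unfold)
  thus "(\<lambda>w. \<integral>y. F (w(x := y)) \<partial>D) \<in> borel_measurable Q"
    by (rule D.borel_measurable_lebesgue_integral)
qed

text \<open>Induction on the coordinates. With all other weights frozen, Chebyshev's inequality
  handles coordinate \<open>x\<close>; averaging over \<open>x\<close> keeps \<open>f\<close> and
  \<open>g\<close> monotone, bounded by 1 and dependent on \<open>J\<close> only, so the induction
  hypothesis applies to the averages.\<close>

theorem Harris_mono:
  fixes f g :: "('i \<Rightarrow> real) \<Rightarrow> real"
  assumes "finite J" "depends_on J f" "depends_on J g"
    and "f \<in> borel_measurable Q" "g \<in> borel_measurable Q" "mono f" "mono g"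
    and "\<And>w. \<bar>f w\<bar> \<le> 1" "\<And>w. \<bar>g w\<bar> \<le> 1"
  shows "(\<integral>w. f w \<partial>Q) * (\<integral>w. g w \<partial>Q) \<le> (\<integral>w. f w * g w \<partial>Q)"
  using assms
proof (induction J arbitrary: f g rule: finite_induct)
  case empty
  interpret Q: prob_space "Q :: ('i \<Rightarrow> real) measure" by (rule prob_Q)
  obtain a b where "f = (\<lambda>_. a)" "g = (\<lambda>_. b)"
    using depends_onD[OF empty.prems(1)] depends_onD[OF empty.prems(2)] by (metis empty_iff ext)
  thus ?case using Q.prob_space by simp
next
  case (insert x J)
  interpret D: prob_space D by (rule prob_D)
  interpret Q: prob_space "Q :: ('i \<Rightarrow> real) measure" by (rule prob_Q)
  note [measurable] = insert.prems(3,4)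
  have upd: "(\<lambda>y. h (w(x := y))) \<in> borel_measurable borel"
    if "h \<in> borel_measurable Q" for h :: "('i \<Rightarrow> real) \<Rightarrow> real" and w
  proof (rule measurable_compose[OF _ that])
    show "(\<lambda>y. w(x := y)) \<in> borel \<rightarrow>\<^sub>M Q"
    proof (rule measurable_into_Q)
      fix z show "(\<lambda>y. (w(x := y)) z) \<in> borel_measurable borel" by (cases "z = x") simp_all
    qed
  qed
  define E where "E h w = (\<integral>y. h (w(x := y)) \<partial>D)" for h :: "('i \<Rightarrow> real) \<Rightarrow> real" and w
  have updD: "(\<lambda>y. h (w(x := y))) \<in> borel_measurable D"
    if "h \<in> borel_measurable Q" for h :: "('i \<Rightarrow> real) \<Rightarrow> real" and w
    using upd[OF that] sets_D by (simp cong: measurable_cong_sets)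
  have int: "integrable D (\<lambda>y. h (w(x := y)))"
    if "h \<in> borel_measurable Q" "\<And>w. \<bar>h w\<bar> \<le> 1" for h :: "('i \<Rightarrow> real) \<Rightarrow> real" and w
    using updD[OF that(1)] that(2) by (intro D.integrable_const_bound[of _ 1]) auto
  have E: "depends_on J (E h)" "E h \<in> borel_measurable Q" "mono (E h)" "\<bar>E h w\<bar> \<le> 1"
    if h: "depends_on (insert x J) h" "h \<in> borel_measurable Q" "mono h" "\<And>w. \<bar>h w\<bar> \<le> 1" for h w
  proof -
    show "depends_on J (E h)"
    proof (rule depends_onI)
      fix v w :: "'i \<Rightarrow> real" assume "\<And>z. z \<in> J \<Longrightarrow> v z = w z"
      hence "h (v(x := y)) = h (w(x := y))" for y by (intro depends_onD[OF h(1)]) auto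
      thus "E h v = E h w" by (simp add: E_def)
    qed
    show "E h \<in> borel_measurable Q" unfolding E_def by (rule integral_resample(2)[OF h(2,4)])
    show "mono (E h)" unfolding E_def
      by (intro monoI integral_mono int h monoD[OF h(3)]) (auto simp: le_fun_def)
    have "\<bar>E h w\<bar> \<le> (\<integral>y. 1 \<partial>D)" unfolding E_def
      by (rule order_trans[OF integral_abs_bound]) (intro integral_mono integrable_abs int h, auto)
    thus "\<bar>E h w\<bar> \<le> 1" by (simp add: D.prob_space)
  qed
  have bdfg: "\<bar>f w * g w\<bar> \<le> 1" for w
    using insert.prems(7,8) by (auto simp: abs_mult intro!: mult_le_one)
  have "(\<integral>w. f w \<partial>Q) * (\<integral>w. g w \<partial>Q) = (\<integral>w. E f w \<partial>Q) * (\<integral>w. E g w \<partial>Q)"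
    unfolding E_def by (subst (1 2) integral_resample(1)[of _ 1 x]) (use insert.prems in auto)
  also have "\<dots> \<le> (\<integral>w. E f w * E g w \<partial>Q)"
    by (rule insert.IH) (use E insert.prems in auto)
  also have "\<dots> \<le> (\<integral>w. E (\<lambda>w. f w * g w) w \<partial>Q)"
  proof (rule integral_mono)
    show "integrable Q (\<lambda>w. E f w * E g w)"
      by (rule Q.integrable_const_bound[of _ 1])
        (use E(2,4) insert.prems in \<open>auto simp: abs_mult intro!: mult_le_one\<close>)
    show "integrable Q (E (\<lambda>w. f w * g w))"
    proof (rule Q.integrable_const_bound[of _ 1])
      show "E (\<lambda>w. f w * g w) \<in> borel_measurable Q"
        unfolding E_def by (rule integral_resample(2)[OF _ bdfg]) simp
      have "\<bar>E (\<lambda>w. f w * g w) w\<bar> \<le> (\<integral>y. 1 \<partial>D)" for w unfolding E_def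
        by (rule order_trans[OF integral_abs_bound])
          (intro integral_mono integrable_abs int, use bdfg in auto)
      thus "AE w in Q. norm (E (\<lambda>w. f w * g w) w) \<le> 1" by (simp add: D.prob_space)
    qed
    fix w
    have "mono (\<lambda>y. f (w(x := y)))" "mono (\<lambda>y. g (w(x := y)))"
      by (auto intro!: monoI monoD[OF insert.prems(5)] monoD[OF insert.prems(6)] simp: le_fun_def)
    thus "E f w * E g w \<le> E (\<lambda>w. f w * g w) w"
      unfolding E_def using integral_mono_mult_ge[OF prob_D sets_D upd upd] insert.prems by auto
  qed
  also have "\<dots> = (\<integral>w. f w * g w \<partial>Q)"
    unfolding E_def by (rule integral_resample(1)[symmetric, OF _ bdfg]) simp
  finally show ?case .
qed

lemma integral_of_bool: "Measurable.pred Q A \<Longrightarrow> (\<integral>w. of_bool (A w) \<partial>Q) = Pr A"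
proof -
  assume [measurable]: "Measurable.pred Q A"
  have "(\<integral>w. of_bool (A w) \<partial>Q) = (\<integral>w. indicator (Collect A) w \<partial>Q :: real)"
    by (intro Bochner_Integration.integral_cong) (auto simp: indicator_def)
  thus ?thesis using sets_Q_Collect by simp
qed

lemma Pr_True [simp]: "measure (Q :: ('i \<Rightarrow> real) measure) UNIV = 1"
  using prob_space.prob_space[OF prob_Q] by (metis space_Q)

text \<open>The relation \<open>r\<close> is the pointwise order or its converse, so one lemma
  serves increasing and decreasing events. For decreasing events the negated indicators are
  monotone, and the sign cancels in the products because \<open>s * s = 1\<close>.\<close>

lemma Harris_conj:
  fixes A B :: "('i \<Rightarrow> real) \<Rightarrow> bool"
  assumes "r = (\<le>) \<or> r = (\<ge>)" and "finite J" "depends_on J A" "depends_on J B"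
    and [measurable]: "Measurable.pred Q A" "Measurable.pred Q B"
    and inc: "\<And>v w. r v w \<Longrightarrow> A v \<Longrightarrow> A w" "\<And>v w. r v w \<Longrightarrow> B v \<Longrightarrow> B w"
  shows "Pr A * Pr B \<le> Pr (\<lambda>w. A w \<and> B w)"
proof -
  define s :: real where "s = (if r = (\<le>) then 1 else - 1)"
  have s: "s * s = 1" "\<bar>s\<bar> = 1" by (auto simp: s_def)
  have m: "mono (\<lambda>w. s * of_bool (C w))" if "\<And>v w. r v w \<Longrightarrow> C v \<Longrightarrow> C w" for C :: "('i \<Rightarrow> real) \<Rightarrow> bool"
    using assms(1) that by (auto simp: s_def mono_def of_bool_def)
  have d: "depends_on J (\<lambda>w. s * of_bool (C w))" if "depends_on J C" for C :: "('i \<Rightarrow> real) \<Rightarrow> bool"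
  proof (rule depends_onI)
    fix v w :: "'i \<Rightarrow> real" assume "\<And>x. x \<in> J \<Longrightarrow> v x = w x"
    hence "C v = C w" by (rule depends_onD[OF that])
    thus "s * of_bool (C v) = s * of_bool (C w)" by simp
  qed
  have "(\<integral>w. s * of_bool (A w) \<partial>Q) * (\<integral>w. s * of_bool (B w) \<partial>Q)
      \<le> (\<integral>w. (s * of_bool (A w)) * (s * of_bool (B w)) \<partial>Q :: real)"
    by (rule Harris_mono[OF assms(2) d[OF assms(3)] d[OF assms(4)] _ _ m[OF inc(1)] m[OF inc(2)]])
      (use s in \<open>auto simp: abs_mult of_bool_def\<close>)
  also have "(\<lambda>w. (s * of_bool (A w)) * (s * of_bool (B w))) = (\<lambda>w. of_bool (A w \<and> B w))"
    using s(1) by (auto simp: of_bool_def)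
  finally have "(s * s) * (Pr A * Pr B) \<le> Pr (\<lambda>w. A w \<and> B w)"
    by (simp add: integral_of_bool mult_ac)
  thus ?thesis by (simp add: s)
qed

lemma Harris_Ball:
  assumes "r = (\<le>) \<or> r = (\<ge>)" and "finite L" "finite J" "\<And>l. l \<in> L \<Longrightarrow> depends_on J (A l)"
    and "\<And>l. l \<in> L \<Longrightarrow> Measurable.pred Q (A l)"
    and "\<And>l v w. l \<in> L \<Longrightarrow> r v w \<Longrightarrow> A l v \<Longrightarrow> A l w"
    and "\<And>l. l \<in> L \<Longrightarrow> p \<le> Pr (A l)" "0 \<le> p"
  shows "p ^ card L \<le> Pr (\<lambda>w. \<forall>l\<in>L. A l w)"
  using assms(2,4-7)
proof (induction L rule: finite_induct)
  case empty
  then show ?case by simp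
next
  case (insert l L)
  have "p ^ card (insert l L) = p * p ^ card L" using insert by simp
  also have "\<dots> \<le> Pr (A l) * Pr (\<lambda>w. \<forall>l\<in>L. A l w)"
    using insert assms(8) by (intro mult_mono) auto
  also have "\<dots> \<le> Pr (\<lambda>w. A l w \<and> (\<forall>l\<in>L. A l w))"
  proof (rule Harris_conj[OF assms(1,3)])
    show "depends_on J (\<lambda>w. \<forall>l\<in>L. A l w)"
      using insert.prems(1) unfolding depends_on_def by (metis insertCI)
    show "Measurable.pred Q (\<lambda>w. \<forall>l\<in>L. A l w)"
      using insert by (intro pred_intros_finite) auto
  qed (use insert.prems in blast)+
  finally show ?case by simp
qed

text \<open>Change of measure by replacing one coordinate at a time. \<open>F\<close> has to depend
  on a finite \<open>K\<close>: in general the two infinite product laws are not absolutely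
  continuous with respect to each other. Working in \<open>ennreal\<close> avoids integrability
  conditions.\<close>

lemma nn_integral_tilt:
  fixes F :: "('i \<Rightarrow> real) \<Rightarrow> ennreal"
  assumes D': "iid_weights D'" "D' = density D (\<lambda>x. ennreal (h x))"
    and [measurable]: "h \<in> borel_measurable borel" and "finite K"
    and "depends_on K F" "F \<in> borel_measurable Q"
  shows "(\<integral>\<^sup>+w. F w \<partial>iid_weights.Q D') = (\<integral>\<^sup>+w. F w * (\<Prod>x\<in>K. ennreal (h (w x))) \<partial>Q)"
  using assms(4-6)
proof (induction K arbitrary: F rule: finite_induct)
  case empty
  interpret T: iid_weights D' by fact
  obtain a where "F = (\<lambda>_. a)"
    using depends_onD[OF empty.prems(1)] by (metis empty_iff ext)
  moreover have "emeasure (Q :: ('i \<Rightarrow> real) measure) UNIV = 1" "emeasure (T.Q :: ('i \<Rightarrow> real) measure) UNIV = 1"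
    using prob_space.emeasure_space_1[OF prob_Q] prob_space.emeasure_space_1[OF T.prob_Q] by simp_all
  ultimately show ?case by simp
next
  case (insert x K)
  interpret T: iid_weights D' by fact
  note [measurable] = insert.prems(2)
  have eqQ: "sets T.Q = sets (Q :: ('i \<Rightarrow> real) measure)"
    unfolding Q_def T.Q_def by (intro sets_PiM_cong) (simp_all add: sets_D T.sets_D)
  have FT: "F \<in> borel_measurable T.Q"
    using insert.prems(2) by (simp only: measurable_cong_sets[OF eqQ refl])
  define E where "E w = (\<integral>\<^sup>+y. F (w(x := y)) \<partial>D')" for w
  have upd: "(\<lambda>(w, y). G (w(x := y))) \<in> borel_measurable (Q \<Otimes>\<^sub>M D'')"
    if "G \<in> borel_measurable Q" "sets D'' = sets borel" for G :: "('i \<Rightarrow> real) \<Rightarrow> ennreal" and D''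
  proof -
    have "(\<lambda>p. (fst p)(x := snd p)) \<in> Q \<Otimes>\<^sub>M D'' \<rightarrow>\<^sub>M Q"
    proof (rule measurable_into_Q)
      fix z
      have "(\<lambda>y. y) \<in> borel_measurable D''" unfolding measurable_cong_sets[OF that(2) refl] by simp
      hence "(\<lambda>p. snd p) \<in> borel_measurable (Q \<Otimes>\<^sub>M D'')" by (rule measurable_compose[OF measurable_snd])
      thus "(\<lambda>p. ((fst p)(x := snd p)) z) \<in> borel_measurable (Q \<Otimes>\<^sub>M D'')"
        by (cases "z = x") simp_all
    qed
    from measurable_compose[OF this that(1)] show ?thesis by (simp add: case_prod_beta)
  qed
  have updD: "(\<lambda>y. G (w(x := y))) \<in> borel_measurable D"
    if "G \<in> borel_measurable Q" for G :: "('i \<Rightarrow> real) \<Rightarrow> ennreal" and w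
    using measurable_compose[OF measurable_Pair1' upd[OF that sets_D], of w] by simp
  interpret T': prob_space D' by (rule T.prob_D)
  have "h \<in> borel_measurable D" using assms(3) by (simp only: measurable_cong_sets[OF sets_D refl])
  from measurable_compose[OF this measurable_ennreal]
  have hD: "(\<lambda>y. ennreal (h y)) \<in> borel_measurable D" .
  have "(\<integral>\<^sup>+w. F w \<partial>T.Q) = (\<integral>\<^sup>+w. E w \<partial>T.Q)"
    unfolding E_def by (rule T.nn_integral_resample[OF FT])
  also have "\<dots> = (\<integral>\<^sup>+w. E w * (\<Prod>x\<in>K. ennreal (h (w x))) \<partial>Q)"
  proof (rule insert.IH)
    show "depends_on K E"
    proof (rule depends_onI)
      fix v w :: "'i \<Rightarrow> real" assume "\<And>z. z \<in> K \<Longrightarrow> v z = w z"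
      hence "F (v(x := y)) = F (w(x := y))" for y by (intro depends_onD[OF insert.prems(1)]) auto
      thus "E v = E w" by (simp add: E_def)
    qed
    show "E \<in> borel_measurable Q"
      unfolding E_def by (rule T'.borel_measurable_nn_integral[OF upd[OF insert.prems(2) T.sets_D]])
  qed
  also have "\<dots> = (\<integral>\<^sup>+w. (\<integral>\<^sup>+y. F (w(x := y)) * (\<Prod>z\<in>insert x K. ennreal (h ((w(x := y)) z))) \<partial>D) \<partial>Q)"
  proof (rule nn_integral_cong)
    fix w
    have "E w = (\<integral>\<^sup>+y. ennreal (h y) * F (w(x := y)) \<partial>D)"
      unfolding E_def assms(2)
      by (rule nn_integral_density[OF _ updD[OF insert.prems(2)]]) (rule hD)
    also have "\<dots> * (\<Prod>x\<in>K. ennreal (h (w x)))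
        = (\<integral>\<^sup>+y. ennreal (h y) * F (w(x := y)) * (\<Prod>x\<in>K. ennreal (h (w x))) \<partial>D)"
    proof (rule nn_integral_multc[symmetric])
      show "(\<lambda>y. ennreal (h y) * F (w(x := y))) \<in> borel_measurable D"
        using hD updD[OF insert.prems(2)] by (rule borel_measurable_times_ennreal)
    qed
    also have "\<dots> = (\<integral>\<^sup>+y. F (w(x := y)) * (\<Prod>z\<in>insert x K. ennreal (h ((w(x := y)) z))) \<partial>D)"
    proof (rule nn_integral_cong)
      fix y
      have "(\<Prod>z\<in>K. ennreal (h ((w(x := y)) z))) = (\<Prod>z\<in>K. ennreal (h (w z)))"
        by (rule prod.cong) (use insert.hyps in auto)
      thus "ennreal (h y) * F (w(x := y)) * (\<Prod>x\<in>K. ennreal (h (w x)))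
          = F (w(x := y)) * (\<Prod>z\<in>insert x K. ennreal (h ((w(x := y)) z)))"
        using insert.hyps by (simp add: mult_ac)
    qed
    finally show "E w * (\<Prod>x\<in>K. ennreal (h (w x)))
        = (\<integral>\<^sup>+y. F (w(x := y)) * (\<Prod>z\<in>insert x K. ennreal (h ((w(x := y)) z))) \<partial>D)" .
  qed
  also have "\<dots> = (\<integral>\<^sup>+w. F w * (\<Prod>x\<in>insert x K. ennreal (h (w x))) \<partial>Q)"
    by (rule nn_integral_resample[symmetric]) simp
  finally show ?case .
qed

text \<open>On \<open>A\<close> the density of the tilted law is at most
  \<open>exp (t * C) / \<phi> ^ card K\<close>, as the total weight in \<open>K\<close> is capped by
  \<open>C\<close>. Hence what is typical under the tilt has a computable cost under the original
  law.\<close>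

lemma Pr_tilt_ge:
  fixes A :: "('i \<Rightarrow> real) \<Rightarrow> bool"
  assumes D': "iid_weights D'" "D' = density D (\<lambda>x. ennreal (exp (t * x) / \<phi>))"
    and "finite K" "depends_on K A" and [measurable]: "Measurable.pred Q A"
    and C: "\<And>w. A w \<Longrightarrow> (\<Sum>x\<in>K. w x) \<le> C" and "t \<ge> 0" "\<phi> > 0"
  shows "Pr A \<ge> \<phi> ^ card K * exp (- (t * C)) * measure (iid_weights.Q D') (Collect A)"
proof -
  interpret T: iid_weights D' by fact
  interpret Q: prob_space "Q :: ('i \<Rightarrow> real) measure" by (rule prob_Q)
  interpret TQ: prob_space "T.Q :: ('i \<Rightarrow> real) measure" by (rule T.prob_Q)
  have eqQ: "sets T.Q = sets (Q :: ('i \<Rightarrow> real) measure)"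
    unfolding Q_def T.Q_def by (intro sets_PiM_cong) (simp_all add: sets_D T.sets_D)
  have A: "Collect A \<in> sets Q" by (rule sets_Q_Collect) simp
  have "Collect A \<in> sets T.Q" using A eqQ by blast
  hence "ennreal (measure T.Q (Collect A)) = (\<integral>\<^sup>+w. indicator (Collect A) w \<partial>T.Q)"
    by (simp add: TQ.emeasure_eq_measure)
  also have "\<dots> = (\<integral>\<^sup>+w. indicator (Collect A) w * (\<Prod>x\<in>K. ennreal (exp (t * w x) / \<phi>)) \<partial>Q)"
  proof (rule nn_integral_tilt[OF D' _ assms(3)])
    show "depends_on K (indicator (Collect A) :: ('i \<Rightarrow> real) \<Rightarrow> ennreal)"
    proof (rule depends_onI)
      fix v w :: "'i \<Rightarrow> real" assume "\<And>x. x \<in> K \<Longrightarrow> v x = w x"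
      hence "A v = A w" by (rule depends_onD[OF assms(4)])
      thus "indicator (Collect A) v = (indicator (Collect A) w :: ennreal)" by (simp add: indicator_def)
    qed
  qed (use A in auto)
  also have "\<dots> \<le> (\<integral>\<^sup>+w. ennreal (exp (t * C) / \<phi> ^ card K) * indicator (Collect A) w \<partial>Q)"
  proof (rule nn_integral_mono)
    fix w
    have "(\<Prod>x\<in>K. ennreal (exp (t * w x) / \<phi>)) = ennreal (exp (t * (\<Sum>x\<in>K. w x)) / \<phi> ^ card K)"
      using assms(3) \<open>\<phi> > 0\<close> by (simp add: prod_ennreal prod_dividef exp_sum sum_distrib_left)
    moreover have "exp (t * (\<Sum>x\<in>K. w x)) / \<phi> ^ card K \<le> exp (t * C) / \<phi> ^ card K" if "A w"
      using C[OF that] \<open>t \<ge> 0\<close> \<open>\<phi> > 0\<close> by (intro divide_right_mono) (auto intro: mult_left_mono)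
    ultimately show "indicator (Collect A) w * (\<Prod>x\<in>K. ennreal (exp (t * w x) / \<phi>))
        \<le> ennreal (exp (t * C) / \<phi> ^ card K) * indicator (Collect A) w"
      by (auto simp: indicator_def intro: ennreal_leI)
  qed
  also have "\<dots> = ennreal (exp (t * C) / \<phi> ^ card K * Pr A)"
    using A \<open>\<phi> > 0\<close> by (simp add: nn_integral_cmult_indicator Q.emeasure_eq_measure ennreal_mult[symmetric])
  finally have "measure T.Q (Collect A) \<le> exp (t * C) / \<phi> ^ card K * Pr A"
    using \<open>\<phi> > 0\<close> by (simp add: ennreal_le_iff)
  hence "\<phi> ^ card K * exp (- (t * C)) * measure T.Q (Collect A)
      \<le> \<phi> ^ card K * exp (- (t * C)) * (exp (t * C) / \<phi> ^ card K * Pr A)"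
    using \<open>\<phi> > 0\<close> by (intro mult_left_mono) auto
  also have "\<dots> = Pr A" using \<open>\<phi> > 0\<close> by (simp add: field_simps exp_minus)
  finally show ?thesis .
qed

end

section \<open>Paths as lists of steps\<close>

definition pos :: "'d::finite list \<Rightarrow> int ^ 'd" where
  "pos js = (\<Sum>j\<leftarrow>js. axis j 1)"

lemma pos_Nil [simp]: "pos [] = 0" and pos_Cons [simp]: "pos (j # js) = axis j 1 + pos js"
  and pos_append [simp]: "pos (js @ ks) = pos js + pos ks"
  by (simp_all add: pos_def)

lemma pos_nth: "pos js $ i = int (count_list js i)"
  by (induction js) (auto simp: axis_def)

text \<open>Each step raises this by one, so it plays the role of time: a directed path meets a
  level at most once, and pieces of paths in disjoint ranges of levels use disjoint weights.\<close>

definition level :: "int ^ 'd::finite \<Rightarrow> int" where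
  "level x = (\<Sum>i\<in>UNIV. x $ i)"

lemma level_add [simp]: "level (x + y) = level x + level y"
  and level_diff [simp]: "level (x - y) = level x - level y"
  and level_axis [simp]: "level (axis j 1) = 1"
  and level_0 [simp]: "level 0 = 0"
  by (simp_all add: level_def sum.distrib sum_subtractf axis_def)

lemma level_const [simp]: "level (\<chi> i::'d. int n) = int (CARD('d::finite) * n)"
  by (simp add: level_def)

lemma level_pos [simp]: "level (pos js) = int (length js)"
  by (induction js) auto

text \<open>The starting vertex is left out and the final one is counted, which makes the sum
  additive under concatenation. The price is that \<open>w 0\<close> is treated separately.\<close>

primrec walk_sum :: "(int ^ 'd::finite \<Rightarrow> real) \<Rightarrow> int ^ 'd \<Rightarrow> 'd list \<Rightarrow> real" where
  "walk_sum w u [] = 0"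
| "walk_sum w u (j # js) = w (u + axis j 1) + walk_sum w (u + axis j 1) js"

lemma walk_sum_append: "walk_sum w u (js @ ks) = walk_sum w u js + walk_sum w (u + pos js) ks"
  by (induction js arbitrary: u) (auto simp: add_ac)

lemma walk_sum_eq_sum: "walk_sum w u js = (\<Sum>k<length js. w (u + pos (take (Suc k) js)))"
  by (induction js arbitrary: u) (simp_all del: sum.lessThan_Suc add: sum.lessThan_Suc_shift add_ac)

lemma walk_sum_shift: "walk_sum w (u + v) js = walk_sum (\<lambda>x. w (x + v)) u js"
proof (induction js arbitrary: u)
  case (Cons j js)
  have *: "u + v + axis j 1 = u + axis j 1 + v" by (simp add: add_ac)
  show ?case unfolding walk_sum.simps * Cons.IH ..
qed simp

lemma walk_sum_const_diff:
  "walk_sum (\<lambda>x. w x - c) u js = walk_sum w u js - c * real (length js)"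
  by (induction js arbitrary: u) (auto simp: algebra_simps)

text \<open>The inverse is what makes the unit vector in direction \<open>j\<close> go to that in
  direction \<open>\<pi> j\<close>.\<close>

definition permute :: "('d::finite \<Rightarrow> 'd) \<Rightarrow> int ^ 'd \<Rightarrow> int ^ 'd" where
  "permute \<pi> x = (\<chi> i. x $ inv \<pi> i)"

lemma permute_add: "permute \<pi> (x + y) = permute \<pi> x + permute \<pi> y"
  by (simp add: permute_def vec_eq_iff)

lemma permute_axis: "bij \<pi> \<Longrightarrow> permute \<pi> (axis j 1) = axis (\<pi> j) 1"
  by (auto simp: permute_def vec_eq_iff axis_def bij_is_inj inv_f_f bij_is_surj surj_f_inv_f)

lemma pos_map: "bij \<pi> \<Longrightarrow> pos (map \<pi> js) = permute \<pi> (pos js)"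
  by (induction js) (simp_all add: permute_add permute_axis, simp add: permute_def vec_eq_iff)

lemma walk_sum_map:
  "bij \<pi> \<Longrightarrow> walk_sum w (permute \<pi> u) (map \<pi> js) = walk_sum (\<lambda>x. w (permute \<pi> x)) u js"
  by (induction js arbitrary: u) (simp_all add: permute_axis[symmetric] permute_add[symmetric])

lemma inj_permute: "bij \<pi> \<Longrightarrow> inj (permute \<pi>)"
  by (rule injI) (simp add: permute_def vec_eq_iff, metis bij_is_inj inv_f_f)

definition steps_to :: "int ^ 'd::finite \<Rightarrow> 'd list set" where
  "steps_to a = {js. pos js = a}"

lemma length_steps_to: "js \<in> steps_to a \<Longrightarrow> int (length js) = level a"
  by (auto simp: steps_to_def)

lemma finite_steps_to [simp]: "finite (steps_to a)"
proof (rule finite_subset)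
  show "steps_to a \<subseteq> {js. set js \<subseteq> UNIV \<and> length js = nat (level a)}"
    using length_steps_to by fastforce
  show "finite {js. set js \<subseteq> (UNIV :: 'a set) \<and> length js = nat (level a)}"
    by (rule finite_lists_length_eq) simp
qed

lemma steps_to_nonempty: "(\<And>i. 0 \<le> a $ i) \<Longrightarrow> \<exists>js. pos js = a"
proof (induction "nat (level a)" arbitrary: a)
  case 0
  have "level a = 0" using 0 by (metis level_def nat_0_iff sum_nonneg order_antisym)
  hence "a = 0" using 0(2) by (simp add: level_def vec_eq_iff sum_nonneg_eq_0_iff)
  thus ?case by (intro exI[of _ "[]"]) simp
next
  case (Suc k)
  have "\<exists>i. a $ i \<noteq> 0" using Suc(2) by (auto simp: level_def intro: ccontr)
  then obtain i where i: "a $ i > 0" using Suc(3) by (metis order_le_less)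
  have "\<exists>js. pos js = a - axis i 1"
  proof (rule Suc(1))
    show "k = nat (level (a - axis i 1))" using Suc(2) by simp
    show "0 \<le> (a - axis i 1) $ j" for j using Suc(3)[of j] i by (auto simp: axis_def)
  qed
  then obtain js where "pos js = a - axis i 1" by blast
  thus ?case by (intro exI[of _ "i # js"]) simp
qed

lemma diag_steps_nonempty: "\<exists>js. pos js = (\<chi> i. int n)"
  by (rule steps_to_nonempty) simp

lemma length_path_of_steps [simp]: "length (path_of_steps js) = Suc (length js)"
  by (simp add: path_of_steps_def del: upt_Suc)

lemma nth_path_of_steps: "k \<le> length js \<Longrightarrow> path_of_steps js ! k = pos (take k js)"
  unfolding path_of_steps_def pos_def by (subst nth_map) (auto simp del: upt_Suc)

lemma pos_take_Suc: "k < length js \<Longrightarrow> pos (take (Suc k) js) = pos (take k js) + axis (js ! k) 1"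
  by (simp add: take_Suc_conv_app_nth)

text \<open>Bridge from vertex lists to step lists, in terms of which the estimates are phrased; the
  steps are read off the increments of the path.\<close>

lemma diag_paths_eq: "diag_paths n = path_of_steps ` steps_to (\<chi> i::'d::finite. int n)"
proof (intro set_eqI iffI)
  fix \<gamma> :: "(int ^ 'd) list"
  assume \<gamma>: "\<gamma> \<in> diag_paths n"
  hence ne: "\<gamma> \<noteq> []" and 0: "\<gamma> ! 0 = 0" and l: "\<gamma> ! (length \<gamma> - 1) = (\<chi> i. int n)"
    and step: "\<And>k. Suc k < length \<gamma> \<Longrightarrow> \<exists>i. \<gamma> ! Suc k - \<gamma> ! k = axis i 1"
    by (auto simp: diag_paths_def directed_path_def hd_conv_nth last_conv_nth)
  define js where "js = map (\<lambda>k. SOME i. \<gamma> ! Suc k - \<gamma> ! k = axis i 1) [0..<length \<gamma> - 1]"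
  have len: "length js = length \<gamma> - 1" by (simp add: js_def)
  have js: "\<gamma> ! Suc k = \<gamma> ! k + axis (js ! k) 1" if "Suc k < length \<gamma>" for k
    using someI_ex[OF step[OF that]] that by (simp add: js_def algebra_simps)
  have nth: "\<gamma> ! k = pos (take k js)" if "k < length \<gamma>" for k
    using that by (induction k) (auto simp: 0 js len pos_take_Suc)
  have "\<gamma> = path_of_steps js"
    using ne by (intro nth_equalityI) (auto simp: len nth nth_path_of_steps)
  moreover have "pos js = (\<chi> i. int n)" using l nth[of "length \<gamma> - 1"] ne len by simp
  ultimately show "\<gamma> \<in> path_of_steps ` steps_to (\<chi> i. int n)" by (auto simp: steps_to_def)
next
  fix \<gamma> :: "(int ^ 'd) list"
  assume "\<gamma> \<in> path_of_steps ` steps_to (\<chi> i. int n)"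
  then obtain js where \<gamma>: "\<gamma> = path_of_steps js" and js: "pos js = (\<chi> i. int n)"
    by (auto simp: steps_to_def)
  have ne: "\<gamma> \<noteq> []" using length_path_of_steps[of js] \<gamma> by (metis list.size(3) nat.distinct(1))
  have "directed_path \<gamma>" unfolding directed_path_def
    using ne by (auto simp: \<gamma> nth_path_of_steps pos_take_Suc)
  moreover have "hd \<gamma> = 0" using ne by (simp add: \<gamma> hd_conv_nth nth_path_of_steps)
  moreover have "last \<gamma> = (\<chi> i. int n)" using ne js by (simp add: \<gamma> last_conv_nth nth_path_of_steps)
  ultimately show "\<gamma> \<in> diag_paths n" by (simp add: diag_paths_def)
qed

lemma inj_path_of_steps: "inj path_of_steps"
proof (rule injI)
  fix js ks :: "'d::finite list" assume eq: "path_of_steps js = path_of_steps ks"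
  hence len: "length js = length ks" using length_path_of_steps by (metis Suc_inject)
  show "js = ks"
  proof (rule nth_equalityI[OF len])
    fix k assume k: "k < length js"
    have "pos (take (Suc k) js) = pos (take (Suc k) ks)" "pos (take k js) = pos (take k ks)"
      using k len eq by (metis nth_path_of_steps Suc_leI less_imp_le)+
    hence "axis (js ! k) (1::int) = axis (ks ! k) 1" using k len by (simp add: pos_take_Suc)
    thus "js ! k = ks ! k" by (simp add: axis_eq_axis)
  qed
qed

lemma passage_time_eq: "passage_time w (path_of_steps js) = w 0 + walk_sum w 0 js"
proof -
  have "passage_time w (path_of_steps js) = (\<Sum>k\<leftarrow>[0..<Suc (length js)]. w (pos (take k js)))"
    by (simp add: passage_time_def path_of_steps_def pos_def comp_def del: upt_Suc)
  also have "\<dots> = (\<Sum>k<Suc (length js). w (pos (take k js)))"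
    by (subst interv_sum_list_conv_sum_set_nat) (simp only: set_upt atLeast0LessThan)
  also have "\<dots> = w 0 + walk_sum w 0 js"
    unfolding walk_sum_eq_sum sum.lessThan_Suc_shift by simp
  finally show ?thesis .
qed

lemma last_passage_time_ge:
  "pos js = (\<chi> i. int n) \<Longrightarrow> w 0 + walk_sum w 0 js \<le> last_passage_time w n"
  unfolding last_passage_time_def diag_paths_eq
  by (rule Max_ge, intro finite_imageI finite_steps_to) (auto simp: steps_to_def passage_time_eq[symmetric])

lemma last_passage_time_ex:
  "\<exists>js. pos js = (\<chi> i. int n) \<and> last_passage_time w n = w 0 + walk_sum w 0 js"
proof -
  have "last_passage_time w n \<in> passage_time w ` path_of_steps ` steps_to (\<chi> i. int n)"
    unfolding last_passage_time_def diag_paths_eq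
    by (rule Max_in, intro finite_imageI finite_steps_to) (use diag_steps_nonempty in \<open>auto simp: steps_to_def\<close>)
  thus ?thesis by (auto simp: steps_to_def passage_time_eq)
qed

text \<open>All competitors share the weight at the origin, so it cancels from the
  comparison.\<close>

lemma geodesic_iff:
  assumes "pos js = (\<chi> i. int n)"
  shows "path_of_steps js \<in> geodesics w n \<longleftrightarrow>
    (\<forall>ks. pos ks = (\<chi> i. int n) \<longrightarrow> walk_sum w 0 ks \<le> walk_sum w 0 js)"
proof -
  have "path_of_steps js \<in> diag_paths n" using assms by (auto simp: diag_paths_eq steps_to_def)
  thus ?thesis
    using last_passage_time_ge[of js n w] last_passage_time_ge[of _ n w] last_passage_time_ex[of n w] assms
    by (fastforce simp: geodesics_def passage_time_eq)
qed

section \<open>Passage times in arbitrary directions\<close>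

lemma depends_on_UNIV [simp]: "depends_on UNIV F"
  unfolding depends_on_def by (metis UNIV_I ext)

lemma walk_sum_depends_on:
  "depends_on {x. level u < level x \<and> level x \<le> level u + int (length js)} (\<lambda>w. walk_sum w u js)"
proof (rule depends_onI)
  fix v w :: "int ^ 'a \<Rightarrow> real"
  assume "\<And>x. x \<in> {x. level u < level x \<and> level x \<le> level u + int (length js)} \<Longrightarrow> v x = w x"
  thus "walk_sum v u js = walk_sum w u js"
    by (auto simp: walk_sum_eq_sum intro!: sum.cong)
qed

text \<open>Take the \<open>d\<close> cyclic shifts of an enumeration of the coordinates: over all
  shifts, each position sees every coordinate of \<open>a\<close> exactly once.\<close>

lemma ex_cyclic_permutations:
  "\<exists>\<pi> :: nat \<Rightarrow> 'd::finite \<Rightarrow> 'd. (\<forall>j. bij (\<pi> j)) \<and>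
     (\<forall>a. (\<Sum>j<CARD('d). permute (\<pi> j) a) = (\<chi> i. level a))"
proof -
  define d where "d = CARD('d)"
  have d: "d > 0" by (simp add: d_def)
  obtain e :: "'d \<Rightarrow> nat" where e: "bij_betw e UNIV {0..<d}"
    using ex_bij_betw_finite_nat[of "UNIV :: 'd set"] by (auto simp: d_def)
  define \<sigma> where "\<sigma> j i = inv_into UNIV e ((e i + j) mod d)" for j i
  have e\<sigma>: "e (\<sigma> j i) = (e i + j) mod d" for i j
    unfolding \<sigma>_def using e d by (intro f_inv_into_f) (auto simp: bij_betw_def)
  have lt: "e i < d" for i using e by (auto simp: bij_betw_def)
  have modeq: "x = y" if m: "(x + z) mod d = (y + z) mod d" "x < d" "y < d" for x y z
  proof -
    obtain q r where "x + z + d * q = y + z + d * r" using m(1) unfolding nat_mod_eq_iff by blast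
    hence "x + d * q = y + d * r" by simp
    hence "x mod d = y mod d" unfolding nat_mod_eq_iff by blast
    thus ?thesis using m by simp
  qed
  have bij: "bij (\<sigma> j)" for j
  proof -
    have "inj (\<sigma> j)"
    proof (rule injI)
      fix i i' assume "\<sigma> j i = \<sigma> j i'"
      hence "(e i + j) mod d = (e i' + j) mod d" using e\<sigma> by metis
      hence "e i = e i'" using modeq lt by blast
      thus "i = i'" using e by (metis bij_betw_def inj_def)
    qed
    thus ?thesis by (simp add: finite_UNIV_inj_surj bij_def)
  qed
  have sum: "(\<Sum>j<d. a $ \<sigma> j i) = level a" for a :: "int ^ 'd" and i
  proof -
    have inj: "inj_on (\<lambda>j. \<sigma> j i) {..<d}"
    proof (rule inj_onI)
      fix j j' assume j: "j \<in> {..<d}" "j' \<in> {..<d}" "\<sigma> j i = \<sigma> j' i"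
      hence "(j + e i) mod d = (j' + e i) mod d" using e\<sigma> by (metis add.commute)
      thus "j = j'" using modeq[of j "e i" j'] j(1,2) by simp
    qed
    hence "card ((\<lambda>j. \<sigma> j i) ` {..<d}) = CARD('d)" by (simp add: card_image d_def)
    hence "(\<lambda>j. \<sigma> j i) ` {..<d} = UNIV" by (intro card_subset_eq) auto
    hence "level a = (\<Sum>k\<in>(\<lambda>j. \<sigma> j i) ` {..<d}. a $ k)" by (simp add: level_def)
    also have "\<dots> = (\<Sum>j<d. a $ \<sigma> j i)" by (rule sum.reindex_cong[OF inj]) auto
    finally show ?thesis ..
  qed
  \<comment> \<open>\<open>permute\<close> applies the inverse permutation to the index, hence the
    witness \<open>inv (\<sigma> j)\<close>.\<close>
  show ?thesis
    by (rule exI[of _ "\<lambda>j. inv (\<sigma> j)"])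
      (auto simp: bij bij_imp_bij_inv permute_def inv_inv_eq vec_eq_iff sum d_def[symmetric])
qed

context iid_weights
begin

lemma walk_sum_measurable [measurable]: "(\<lambda>w. walk_sum w u js) \<in> borel_measurable Q"
  by (induction js arbitrary: u) simp_all

text \<open>Upper tail of the passage time over the displacement \<open>a\<close>, starting weight
  omitted. It is 0 when no directed path has this displacement.\<close>

definition hit :: "int ^ 'd::finite \<Rightarrow> real \<Rightarrow> real" where
  "hit a c = Pr (\<lambda>w. \<exists>js. pos js = a \<and> c < walk_sum w 0 js)"

lemma pred_ex_steps [measurable]:
  assumes "\<And>js. Measurable.pred Q (P js)"
  shows "Measurable.pred Q (\<lambda>w. \<exists>js. pos js = a \<and> P js w)"
proof -
  have "Measurable.pred Q (\<lambda>w. \<exists>js\<in>steps_to a. P js w)"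
    using assms by (intro pred_intros_finite) auto
  thus ?thesis by (simp add: steps_to_def)
qed

lemma pred_all_steps [measurable]:
  assumes "\<And>js. Measurable.pred Q (P js)"
  shows "Measurable.pred Q (\<lambda>w. \<forall>js. pos js = a \<longrightarrow> P js w)"
proof -
  have "Measurable.pred Q (\<lambda>w. \<forall>js\<in>steps_to a. P js w)"
    using assms by (intro pred_intros_finite) auto
  thus ?thesis by (simp add: steps_to_def)
qed

lemma pred_geodesic: "Measurable.pred Q (\<lambda>w. \<forall>ks. pos ks = a \<longrightarrow> walk_sum w 0 ks \<le> walk_sum w 0 js)"
proof -
  have "Measurable.pred Q (\<lambda>w. walk_sum w 0 ks \<le> walk_sum w 0 js)" for ks
    using borel_measurable_le[OF walk_sum_measurable[of 0 ks] walk_sum_measurable[of 0 js]] by (simp add: pred_def)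
  thus ?thesis by measurable
qed

lemma hit_nonneg [simp]: "0 \<le> hit a c"
  by (simp add: hit_def)

lemma hit_shift: "Pr (\<lambda>w. \<exists>js. pos js = a \<and> c < walk_sum w u js) = hit a c"
proof -
  have "Pr (\<lambda>w. \<exists>js. pos js = a \<and> c < walk_sum (\<lambda>x. w (x + u)) 0 js) = hit a c"
    unfolding hit_def
    by (rule Pr_reindex[where J = UNIV and A = "\<lambda>w. \<exists>js. pos js = a \<and> c < walk_sum w 0 js"])
      auto
  thus ?thesis using walk_sum_shift[of _ 0 u] by simp
qed

lemma hit_permute:
  assumes "bij \<pi>" shows "hit (permute \<pi> a) c = hit a c"
proof -
  have inv: "permute (inv \<pi>) (permute \<pi> x) = x" for x
    using assms by (simp add: permute_def vec_eq_iff inv_inv_eq bij_is_inj inv_f_f)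
  have "(\<exists>js. pos js = permute \<pi> a \<and> c < walk_sum w 0 js)
      \<longleftrightarrow> (\<exists>js. pos js = a \<and> c < walk_sum (\<lambda>x. w (permute \<pi> x)) 0 js)" for w
  proof -
    have 0: "permute \<pi> 0 = 0" by (simp add: permute_def vec_eq_iff)
    have "(\<exists>js. pos js = permute \<pi> a \<and> c < walk_sum w 0 js)
        \<longleftrightarrow> (\<exists>js. pos (map \<pi> js) = permute \<pi> a \<and> c < walk_sum w 0 (map \<pi> js))" (is "?l \<longleftrightarrow> ?r")
    proof
      assume ?l
      then obtain js where js: "pos js = permute \<pi> a" "c < walk_sum w 0 js" by blast
      have "map \<pi> (map (inv \<pi>) js) = js" using assms by (simp add: bij_is_surj surj_f_inv_f comp_def)
      thus ?r using js by metis
    qed blast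
    also have "\<dots> \<longleftrightarrow> (\<exists>js. pos js = a \<and> c < walk_sum (\<lambda>x. w (permute \<pi> x)) 0 js)"
      using walk_sum_map[OF assms, of w 0] inv unfolding pos_map[OF assms] 0 by metis
    finally show ?thesis .
  qed
  hence "hit (permute \<pi> a) c = Pr (\<lambda>w. \<exists>js. pos js = a \<and> c < walk_sum (\<lambda>x. w (permute \<pi> x)) 0 js)"
    by (simp add: hit_def)
  also have "\<dots> = hit a c" unfolding hit_def
    by (rule Pr_reindex[where J = UNIV and A = "\<lambda>w. \<exists>js. pos js = a \<and> c < walk_sum w 0 js"])
      (auto intro: inj_permute[OF assms])
  finally show ?thesis .
qed

lemma Pr_mono:
  assumes "\<And>w. A w \<Longrightarrow> B w" "Measurable.pred Q B"
  shows "Pr A \<le> Pr B"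
proof -
  interpret Q: prob_space "Q :: ('a \<Rightarrow> real) measure" by (rule prob_Q)
  show ?thesis by (rule Q.finite_measure_mono) (use assms sets_Q_Collect in auto)
qed

text \<open>Concatenating paths: the two pieces use disjoint sets of levels.\<close>

lemma hit_superadditive: "hit a c * hit b c' \<le> hit (a + b) (c + c')"
proof -
  define A where "A w \<longleftrightarrow> (\<exists>js. pos js = a \<and> c < walk_sum w 0 js)" for w :: "int ^ 'a \<Rightarrow> real"
  define B where "B w \<longleftrightarrow> (\<exists>js. pos js = b \<and> c' < walk_sum w a js)" for w :: "int ^ 'a \<Rightarrow> real"
  have [measurable]: "Measurable.pred Q A" "Measurable.pred Q B" unfolding A_def B_def by measurable
  have dA: "depends_on {x. level x \<le> level a} A"
  proof (rule depends_onI)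
    fix v w :: "int ^ 'a \<Rightarrow> real" assume *: "\<And>x. x \<in> {x. level x \<le> level a} \<Longrightarrow> v x = w x"
    have "walk_sum v 0 js = walk_sum w 0 js" if "pos js = a" for js
      by (rule depends_onD[OF walk_sum_depends_on]) (use that * level_pos[of js] in auto)
    thus "A v = A w" by (auto simp: A_def)
  qed
  have dB: "depends_on {x. level a < level x} B"
  proof (rule depends_onI)
    fix v w :: "int ^ 'a \<Rightarrow> real" assume *: "\<And>x. x \<in> {x. level a < level x} \<Longrightarrow> v x = w x"
    have "walk_sum v a js = walk_sum w a js" for js
      by (rule depends_onD[OF walk_sum_depends_on]) (use * in auto)
    thus "B v = B w" by (auto simp: B_def)
  qed
  have "hit a c * hit b c' = Pr A * Pr B"
    using hit_shift[of b c' a] by (simp add: A_def[abs_def] B_def[abs_def] hit_def)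
  also have "\<dots> = Pr (\<lambda>w. A w \<and> B w)"
    by (rule Pr_conj_indep[symmetric, OF _ dA dB]) auto
  also have "\<dots> \<le> hit (a + b) (c + c')" unfolding hit_def
  proof (rule Pr_mono)
    fix w assume "A w \<and> B w"
    then obtain js ks where "pos js = a" "c < walk_sum w 0 js" "pos ks = b" "c' < walk_sum w a ks"
      by (auto simp: A_def B_def)
    thus "\<exists>js. pos js = a + b \<and> c + c' < walk_sum w 0 js"
      by (intro exI[of _ "js @ ks"]) (auto simp: walk_sum_append)
  qed measurable
  finally show ?thesis .
qed

lemma hit_prod_le: "(\<Prod>j<Suc n. hit (a j) c) \<le> hit (\<Sum>j<Suc n. a j) (real (Suc n) * c)"
proof (induction n)
  case (Suc n)
  have "(\<Prod>j<Suc (Suc n). hit (a j) c) = (\<Prod>j<Suc n. hit (a j) c) * hit (a (Suc n)) c" by simp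
  also have "\<dots> \<le> hit (\<Sum>j<Suc n. a j) (real (Suc n) * c) * hit (a (Suc n)) c"
    by (intro mult_right_mono Suc) simp
  also have "\<dots> \<le> hit ((\<Sum>j<Suc n. a j) + a (Suc n)) (real (Suc n) * c + c)"
    by (rule hit_superadditive)
  finally show ?case by (simp add: algebra_simps)
qed simp

text \<open>The rotated copies of \<open>a\<close> are equally easy to cross by symmetry, and laid
  end to end they add up to a diagonal displacement. Superadditivity then bounds the
  \<open>d\<close>-th power for an arbitrary direction by the diagonal, the only direction about
  which the time constant speaks.\<close>

lemma hit_power_le:
  fixes a :: "int ^ 'd::finite"
  shows "hit a c ^ CARD('d) \<le> hit (\<chi> i::'d. level a) (real CARD('d) * c)"
proof -
  obtain \<pi> :: "nat \<Rightarrow> 'd \<Rightarrow> 'd" where \<pi>: "\<And>j. bij (\<pi> j)"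
    "(\<Sum>j<CARD('d). permute (\<pi> j) a) = (\<chi> i. level a)"
    using ex_cyclic_permutations by metis
  obtain n where n: "CARD('d) = Suc n" using not0_implies_Suc[of "CARD('d)"] by auto
  have "hit a c ^ CARD('d) = (\<Prod>j<Suc n. hit (permute (\<pi> j) a) c)"
    by (simp only: hit_permute[OF \<pi>(1)] n prod_constant card_lessThan)
  also have "\<dots> \<le> hit (\<Sum>j<Suc n. permute (\<pi> j) a) (real (Suc n) * c)" by (rule hit_prod_le)
  finally show ?thesis by (simp only: n[symmetric] \<pi>(2))
qed

text \<open>The bound by the diagonal sees \<open>a\<close> only through its level, so the threshold
  \<open>k0\<close> is the same for all directions. Excursions around a corner can have very
  unbalanced displacements, hence the need for uniformity.\<close>

lemma hit_uniformly_small: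
  assumes lim: "(\<lambda>n. hit (\<chi> i::'d::finite. int n) (c * (real CARD('d) * real n))) \<longlonglongrightarrow> 0" and "\<theta> > 0"
  shows "\<exists>k0. \<forall>(a :: int ^ 'd) k. level a = int k \<longrightarrow> k0 \<le> k \<longrightarrow> hit a (c * real k) \<le> \<theta>"
proof -
  have "\<forall>\<^sub>F n in sequentially. hit (\<chi> i::'d. int n) (c * (real CARD('d) * real n)) < \<theta> ^ CARD('d)"
    using lim \<open>\<theta> > 0\<close> by (intro order_tendstoD(2)) auto
  then obtain k0 where k0: "\<And>n. k0 \<le> n \<Longrightarrow> hit (\<chi> i::'d. int n) (c * (real CARD('d) * real n)) < \<theta> ^ CARD('d)"
    by (auto simp: eventually_sequentially)
  have "hit a (c * real k) \<le> \<theta>" if "level a = int k" "k0 \<le> k" for a :: "int ^ 'd" and k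
  proof (rule ccontr)
    assume "\<not> hit a (c * real k) \<le> \<theta>"
    hence "\<theta> ^ CARD('d) \<le> hit a (c * real k) ^ CARD('d)" using \<open>\<theta> > 0\<close> by (intro power_mono) auto
    also have "\<dots> \<le> hit (\<chi> i::'d. int k) (c * (real CARD('d) * real k))"
      using hit_power_le[of a "c * real k"] that(1) by (simp add: mult_ac)
    finally show False using k0[OF that(2)] by simp
  qed
  thus ?thesis by blast
qed

end

section \<open>Passing from the given probability space to the product of the single-site
  law\<close>

lemma AE_tendsto_imp_prob_tendsto_0:
  fixes X :: "nat \<Rightarrow> 'a \<Rightarrow> real"
  assumes "prob_space M" and [measurable]: "\<And>n. X n \<in> borel_measurable M"
    and "AE s in M. (\<lambda>n. X n s) \<longlonglongrightarrow> c" and "\<delta> > 0"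
  shows "(\<lambda>n. measure M {s \<in> space M. \<delta> \<le> \<bar>X n s - c\<bar>}) \<longlonglongrightarrow> 0"
proof -
  interpret prob_space M by fact
  define S where "S n = {s \<in> space M. \<delta> \<le> \<bar>X n s - c\<bar>}" for n
  have [measurable]: "S n \<in> sets M" for n unfolding S_def by measurable
  have "(\<lambda>n. \<integral>s. indicator (S n) s \<partial>M) \<longlonglongrightarrow> (\<integral>s. (0::real) \<partial>M)"
  proof (rule integral_dominated_convergence[where w = "\<lambda>_. 1"])
    show "AE s in M. (\<lambda>n. indicator (S n) s :: real) \<longlonglongrightarrow> 0"
      using assms(3)
    proof eventually_elim
      fix s assume "(\<lambda>n. X n s) \<longlonglongrightarrow> c"
      hence "\<forall>\<^sub>F n in sequentially. \<bar>X n s - c\<bar> < \<delta>"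
        using \<open>\<delta> > 0\<close> by (auto dest!: tendstoD[of _ _ _ \<delta>] simp: dist_real_def)
      hence "\<forall>\<^sub>F n in sequentially. indicator (S n) s = (0::real)"
        by eventually_elim (auto simp: S_def)
      thus "(\<lambda>n. indicator (S n) s :: real) \<longlonglongrightarrow> 0" by (rule tendsto_eventually)
    qed
  qed (auto simp: indicator_def)
  thus ?thesis unfolding S_def[symmetric] by simp
qed

lemma passage_measurable:
  fixes \<omega> :: "int ^ 'd::finite \<Rightarrow> 'a \<Rightarrow> real"
  assumes "\<And>x. \<omega> x \<in> borel_measurable M"
  shows "(\<lambda>s. last_passage_time (\<lambda>x. \<omega> x s) n) \<in> borel_measurable M"
proof -
  have "finite (diag_paths n :: (int ^ 'd) list set)"
    unfolding diag_paths_eq by simp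
  moreover have "(\<lambda>s. passage_time (\<lambda>x. \<omega> x s) \<gamma>) \<in> borel_measurable M" for \<gamma> :: "(int ^ 'd) list"
    unfolding passage_time_def using assms by (induction \<gamma>) auto
  ultimately show ?thesis unfolding last_passage_time_def image_image
    by (intro borel_measurable_Max) auto
qed

locale canonical_model =
  fixes M :: "'a measure" and \<omega> :: "int ^ 'd::finite \<Rightarrow> 'a \<Rightarrow> real"
  assumes prob_M: "prob_space M"
    and indep: "prob_space.indep_vars M (\<lambda>_. borel) \<omega> UNIV"
    and ident: "\<forall>x. distr M borel (\<omega> x) = distr M borel (\<omega> 0)"
begin

abbreviation "D \<equiv> distr M borel (\<omega> 0)"

lemma \<omega>_measurable [measurable]: "\<omega> x \<in> borel_measurable M"
  using indep unfolding prob_space.indep_vars_def[OF prob_M] by auto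

sublocale iid_weights D
  by (rule iid_weights.intro[OF prob_space.prob_space_distr[OF prob_M \<omega>_measurable] sets_distr])

lemma distr_M: "distr M Q (\<lambda>s x. \<omega> x s) = Q"
proof -
  have "distr M (Pi\<^sub>M UNIV (\<lambda>_. borel)) (\<lambda>s. \<lambda>x\<in>UNIV. \<omega> x s) = Pi\<^sub>M UNIV (\<lambda>x. distr M borel (\<omega> x))"
    using prob_space.indep_vars_iff_distr_eq_PiM[OF prob_M, where I = UNIV and M' = "\<lambda>_. borel" and X = \<omega>] indep by simp
  also have "\<dots> = Q" unfolding Q_def using ident by (metis (no_types))
  finally have "distr M (Pi\<^sub>M UNIV (\<lambda>_. borel)) (\<lambda>s x. \<omega> x s) = Q" by (simp only: restrict_UNIV)
  moreover have "sets (Pi\<^sub>M UNIV (\<lambda>_. borel)) = sets (Q :: (int ^ 'd \<Rightarrow> real) measure)"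
    unfolding Q_def by (intro sets_PiM_cong) auto
  ultimately show ?thesis by (metis distr_cong)
qed

lemma prob_eq_Pr:
  assumes "Measurable.pred Q A"
  shows "measure M {s \<in> space M. A (\<lambda>x. \<omega> x s)} = Pr A"
proof -
  have m: "(\<lambda>s x. \<omega> x s) \<in> M \<rightarrow>\<^sub>M Q" by (rule measurable_into_Q) simp
  have "Pr A = measure (distr M Q (\<lambda>s x. \<omega> x s)) (Collect A)" by (simp add: distr_M)
  also have "\<dots> = measure M ((\<lambda>s x. \<omega> x s) -` Collect A \<inter> space M)"
    by (rule measure_distr[OF m sets_Q_Collect[OF assms]])
  also have "(\<lambda>s x. \<omega> x s) -` Collect A \<inter> space M = {s \<in> space M. A (\<lambda>x. \<omega> x s)}" by auto
  finally show ?thesis ..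
qed

text \<open>The almost sure limit enters the proof only as convergence in probability, in these two
  one-sided forms.\<close>

lemma time_constant_prob:
  assumes "is_time_constant M \<omega> \<mu>"
  shows "\<mu> < c \<Longrightarrow> (\<lambda>n. hit (\<chi> i::'d. int n) (c * (real CARD('d) * real n))) \<longlonglongrightarrow> 0" (is "_ \<Longrightarrow> ?up")
    and "c < \<mu> \<Longrightarrow> (\<lambda>n. Pr (\<lambda>w. \<forall>js. pos js = (\<chi> i::'d. int n) \<longrightarrow>
      walk_sum w 0 js < c * (real CARD('d) * real n))) \<longlonglongrightarrow> 0" (is "_ \<Longrightarrow> ?lo")
proof -
  interpret M: prob_space M by (rule prob_M)
  let ?d = "real CARD('d)"
  \<comment> \<open>\<open>hit\<close> and the walk sums omit the weight at the origin; subtracting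
    it changes the normalised passage time by a term that vanishes in the limit.\<close>
  define X where "X n s = (last_passage_time (\<lambda>x. \<omega> x s) n - \<omega> 0 s) / (?d * real n)" for n s
  have Xm: "X n \<in> borel_measurable M" for n
    unfolding X_def using passage_measurable[of \<omega> M n] by simp
  have "AE s in M. (\<lambda>n. X n s) \<longlonglongrightarrow> \<mu>"
    using assms unfolding is_time_constant_def
  proof eventually_elim
    fix s
    assume "(\<lambda>n. last_passage_time (\<lambda>x. \<omega> x s) n / (?d * real n)) \<longlonglongrightarrow> \<mu>"
    moreover have "(\<lambda>n. \<omega> 0 s / ?d * (1 / real n)) \<longlonglongrightarrow> \<omega> 0 s / ?d * 0"
      by (intro tendsto_mult tendsto_const lim_1_over_n)
    ultimately have "(\<lambda>n. last_passage_time (\<lambda>x. \<omega> x s) n / (?d * real n) - \<omega> 0 s / ?d * (1 / real n))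
        \<longlonglongrightarrow> \<mu> - \<omega> 0 s / ?d * 0"
      by (rule tendsto_diff)
    thus "(\<lambda>n. X n s) \<longlonglongrightarrow> \<mu>" by (simp add: X_def diff_divide_distrib mult.commute)
  qed
  note lim = AE_tendsto_imp_prob_tendsto_0[OF prob_M Xm this]
  {
    assume c: "\<mu> < c"
    have "hit (\<chi> i::'d. int n) (c * (?d * real n)) \<le> M.prob {s \<in> space M. c - \<mu> \<le> \<bar>X n s - \<mu>\<bar>}" if "n > 0" for n
    proof -
      have "hit (\<chi> i::'d. int n) (c * (?d * real n))
          = M.prob {s \<in> space M. \<exists>js. pos js = (\<chi> i::'d. int n) \<and> c * (?d * real n) < walk_sum (\<lambda>x. \<omega> x s) 0 js}"
        unfolding hit_def by (rule prob_eq_Pr[symmetric]) simp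
      also have "\<dots> \<le> M.prob {s \<in> space M. c - \<mu> \<le> \<bar>X n s - \<mu>\<bar>}"
      proof (rule M.finite_measure_mono)
        show "{s \<in> space M. c - \<mu> \<le> \<bar>X n s - \<mu>\<bar>} \<in> sets M" using Xm by measurable
        show "{s \<in> space M. \<exists>js. pos js = (\<chi> i::'d. int n) \<and> c * (?d * real n) < walk_sum (\<lambda>x. \<omega> x s) 0 js}
            \<subseteq> {s \<in> space M. c - \<mu> \<le> \<bar>X n s - \<mu>\<bar>}"
        proof safe
          fix s and js :: "'d list"
          assume js: "pos js = (\<chi> i. int n)" "c * (?d * real n) < walk_sum (\<lambda>x. \<omega> x s) 0 js"
          have "c * (?d * real n) < last_passage_time (\<lambda>x. \<omega> x s) n - \<omega> 0 s"
            using last_passage_time_ge[OF js(1), of "\<lambda>x. \<omega> x s"] js(2) by simp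
          hence "c < X n s" using that by (simp add: X_def pos_less_divide_eq)
          thus "c - \<mu> \<le> \<bar>X n s - \<mu>\<bar>" by simp
        qed
      qed
      finally show ?thesis .
    qed
    thus ?up using c
      by (intro tendsto_sandwich[OF _ _ tendsto_const lim[of "c - \<mu>"]])
        (auto intro!: always_eventually eventually_sequentiallyI[of 1])
  }
  {
    assume c: "c < \<mu>"
    have "Pr (\<lambda>w. \<forall>js. pos js = (\<chi> i::'d. int n) \<longrightarrow> walk_sum w 0 js < c * (?d * real n))
        \<le> M.prob {s \<in> space M. \<mu> - c \<le> \<bar>X n s - \<mu>\<bar>}" if "n > 0" for n
    proof -
      have "Pr (\<lambda>w. \<forall>js. pos js = (\<chi> i::'d. int n) \<longrightarrow> walk_sum w 0 js < c * (?d * real n))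
          = M.prob {s \<in> space M. \<forall>js. pos js = (\<chi> i::'d. int n) \<longrightarrow> walk_sum (\<lambda>x. \<omega> x s) 0 js < c * (?d * real n)}"
        by (rule prob_eq_Pr[symmetric]) simp
      also have "\<dots> \<le> M.prob {s \<in> space M. \<mu> - c \<le> \<bar>X n s - \<mu>\<bar>}"
      proof (rule M.finite_measure_mono)
        show "{s \<in> space M. \<mu> - c \<le> \<bar>X n s - \<mu>\<bar>} \<in> sets M" using Xm by measurable
        show "{s \<in> space M. \<forall>js. pos js = (\<chi> i::'d. int n) \<longrightarrow> walk_sum (\<lambda>x. \<omega> x s) 0 js < c * (?d * real n)}
            \<subseteq> {s \<in> space M. \<mu> - c \<le> \<bar>X n s - \<mu>\<bar>}"
        proof safe
          fix s
          assume *: "\<forall>js. pos js = (\<chi> i::'d. int n) \<longrightarrow> walk_sum (\<lambda>x. \<omega> x s) 0 js < c * (?d * real n)"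
          obtain js :: "'d list" where js: "pos js = (\<chi> i. int n)"
            "last_passage_time (\<lambda>x. \<omega> x s) n = \<omega> 0 s + walk_sum (\<lambda>x. \<omega> x s) 0 js"
            using last_passage_time_ex[of n "\<lambda>x. \<omega> x s"] by blast
          have "last_passage_time (\<lambda>x. \<omega> x s) n - \<omega> 0 s < c * (?d * real n)" using * js by auto
          hence "X n s < c" using that by (simp add: X_def pos_divide_less_eq)
          thus "\<mu> - c \<le> \<bar>X n s - \<mu>\<bar>" by simp
        qed
      qed
      finally show ?thesis .
    qed
    thus ?lo using c
      by (intro tendsto_sandwich[OF _ _ tendsto_const lim[of "\<mu> - c"]])
        (auto intro!: always_eventually eventually_sequentiallyI[of 1])
  }
qed

lemma geodesic_prob_eq:
  assumes "pos js = (\<chi> i. int n)"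
  shows "geodesic_prob M \<omega> n (path_of_steps js) =
    Pr (\<lambda>w. \<forall>ks. pos ks = (\<chi> i. int n) \<longrightarrow> walk_sum w 0 ks \<le> walk_sum w 0 js)"
  unfolding geodesic_prob_def geodesic_iff[OF assms] by (rule prob_eq_Pr[OF pred_geodesic])

end

section \<open>Turns\<close>

definition turns :: "'d list \<Rightarrow> nat set" where
  "turns js = {k. Suc k < length js \<and> js ! k \<noteq> js ! Suc k}"

lemma finite_turns [simp]: "finite (turns js)"
  by (rule finite_subset[of _ "{..<length js}"]) (auto simp: turns_def)

lemma turns_Cons_Cons:
  "turns (a # b # js) = (if a \<noteq> b then {0} else {}) \<union> Suc ` turns (b # js)"
proof (rule set_eqI)
  fix k show "k \<in> turns (a # b # js) \<longleftrightarrow> k \<in> (if a \<noteq> b then {0} else {}) \<union> Suc ` turns (b # js)"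
    by (cases k) (auto simp: turns_def)
qed

lemma card_turns_Cons_Cons: "card (turns (a # b # js)) = of_bool (a \<noteq> b) + card (turns (b # js))"
  unfolding turns_Cons_Cons by (subst card_Un_disjoint) (auto simp: card_image)

lemma turns_short [simp]: "turns [] = {}" "turns [a] = {}"
  by (auto simp: turns_def)

text \<open>Given the previous step, the next one continues straight in one way, with factor 1, and
  turns in \<open>d - 1\<close> ways, with factor \<open>x\<close> each. The prefixed step
  \<open>a\<close> gives the recursion a previous step to start from.\<close>

lemma sum_power_turns:
  fixes x :: real and a :: "'d::finite"
  shows "(\<Sum>js | length js = N. x ^ card (turns (a # js))) = (1 + (real CARD('d) - 1) * x) ^ N"
proof (induction N arbitrary: a)
  case (Suc N)
  have "{js :: 'd list. length js = Suc N} = (\<lambda>(b, js). b # js) ` (UNIV \<times> {js. length js = N})"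
    by (auto simp: length_Suc_conv image_iff)
  hence "(\<Sum>js | length js = Suc N. x ^ card (turns (a # js)))
      = (\<Sum>(b, js)\<in>UNIV \<times> {js. length js = N}. x ^ card (turns (a # b # js)))"
    by (simp add: sum.reindex inj_on_def case_prod_beta prod_eq_iff)
  also have "\<dots> = (\<Sum>b\<in>UNIV. \<Sum>js | length js = N. x ^ of_bool (a \<noteq> b) * x ^ card (turns (b # js)))"
    by (subst sum.cartesian_product[symmetric]) (simp only: card_turns_Cons_Cons power_add)
  also have "\<dots> = (\<Sum>b\<in>UNIV. x ^ of_bool (a \<noteq> b)) * (1 + (real CARD('d) - 1) * x) ^ N"
    by (simp only: sum_distrib_left[symmetric] Suc.IH sum_distrib_right)
  also have "(\<Sum>b\<in>UNIV. x ^ of_bool (a \<noteq> b)) = x ^ of_bool (a \<noteq> a) + (\<Sum>b\<in>UNIV - {a}. x ^ of_bool (a \<noteq> b))"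
    by (rule sum.remove) auto
  also have "(\<Sum>b\<in>UNIV - {a}. x ^ of_bool (a \<noteq> b)) = (\<Sum>b\<in>UNIV - {a}. x)"
    by (rule sum.cong) auto
  also have "x ^ of_bool (a \<noteq> a) + \<dots> = 1 + (real CARD('d) - 1) * x"
    by (simp add: card_Diff_singleton of_nat_diff Suc_leI)
  finally show ?case by simp
qed simp

text \<open>A Chernoff bound for counting: each list with at most \<open>K\<close> turns has weight
  at least \<open>x ^ Suc K\<close> in the generating function. The exponent is \<open>Suc K\<close>
  since the auxiliary first step may create one more turn.\<close>

lemma card_few_turns:
  fixes x :: real
  assumes "0 < x" "x \<le> 1"
  shows "real (card {js :: 'd::finite list. length js = N \<and> card (turns js) \<le> K}) * x ^ Suc K
    \<le> (1 + real CARD('d) * x) ^ N"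
proof -
  obtain a :: 'd where True by blast
  have fin: "finite {js :: 'd list. length js = N}"
    using finite_lists_length_eq[of "UNIV :: 'd set" N] by simp
  have le: "card (turns (a # js)) \<le> Suc (card (turns js))" for js
    by (cases js) (simp_all add: card_turns_Cons_Cons)
  have "real (card {js :: 'd list. length js = N \<and> card (turns js) \<le> K}) * x ^ Suc K
      = (\<Sum>js :: 'd list | length js = N \<and> card (turns js) \<le> K. x ^ Suc K)" by simp
  also have "\<dots> \<le> (\<Sum>js :: 'd list | length js = N \<and> card (turns js) \<le> K. x ^ card (turns (a # js)))"
    by (rule sum_mono, rule power_decreasing) (use assms le in \<open>auto intro: order_trans\<close>)
  also have "\<dots> \<le> (\<Sum>js :: 'd list | length js = N. x ^ card (turns (a # js)))"
    by (rule sum_mono2) (use fin assms in auto)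
  also have "\<dots> = (1 + (real CARD('d) - 1) * x) ^ N" by (rule sum_power_turns)
  also have "\<dots> \<le> (1 + real CARD('d) * x) ^ N"
    using assms by (intro power_mono add_left_mono mult_right_mono add_nonneg_nonneg mult_nonneg_nonneg)
      (auto simp: Suc_leI)
  finally show ?thesis .
qed

section \<open>Counting all diagonal paths\<close>

lemma fact_mult_power_le: "fact m * m ^ k \<le> (fact (m + k) :: nat)"
proof (induction k)
  case (Suc k)
  have "fact m * m ^ Suc k = m * (fact m * m ^ k)" by simp
  also have "\<dots> \<le> Suc (m + k) * fact (m + k)" using Suc by (intro mult_mono) auto
  finally show ?case by simp
qed simp

text \<open>The multinomial coefficient up to a polynomial factor, without Stirling's formula: the
  step from \<open>n\<close> to \<open>n + 1\<close> multiplies \<open>fact (d * n)\<close> by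
  \<open>d\<close> factors that all exceed \<open>d * n\<close>, and the growth of the polynomial
  factor \<open>n ^ d\<close> makes up the difference to \<open>d * (n + 1)\<close>.\<close>

lemma central_multinomial_ge:
  assumes "n \<ge> 1"
  shows "d ^ (d * n) * fact n ^ d \<le> fact (d * n) * (n ^ d * d ^ d :: nat)"
  using assms
proof (induction n rule: dec_induct)
  case (step n)
  have "fact (Suc n) ^ d = Suc n ^ d * (fact n ^ d :: nat)"
    unfolding fact_Suc power_mult_distrib by simp
  hence "d ^ (d * Suc n) * fact (Suc n) ^ d = (d ^ (d * n) * fact n ^ d) * (Suc n ^ d * d ^ d)"
    by (simp add: power_add del: fact_Suc)
  also have "\<dots> \<le> (fact (d * n) * (n ^ d * d ^ d)) * (Suc n ^ d * d ^ d)"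
    by (rule mult_right_mono[OF step.IH]) simp
  also have "\<dots> = (fact (d * n) * (d * n) ^ d) * (Suc n ^ d * d ^ d)"
    by (simp add: power_mult_distrib mult_ac)
  also have "\<dots> \<le> fact (d * n + d) * (Suc n ^ d * d ^ d)"
    by (rule mult_right_mono[OF fact_mult_power_le]) simp
  finally show ?case by (simp add: add.commute)
qed simp

lemma card_diag_steps:
  "fact (CARD('d::finite) * n) = card (steps_to (\<chi> i::'d. int n)) * fact n ^ CARD('d)"
proof (cases "n = 0")
  case True
  have "steps_to (0 :: int ^ 'd) = {[]}"
    using length_steps_to[where 'a = 'd and a = 0] by (auto simp: steps_to_def)
  moreover have "(\<chi> i::'d. int 0) = 0" by (simp add: vec_eq_iff)
  ultimately show ?thesis using True by (simp only:) simp
next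
  case False
  \<comment> \<open>Every direction occurs with multiplicity \<open>n\<close>; it is
    \<open>n > 0\<close> that gives this multiset full support, hence the separate case.\<close>
  define A where "A = (\<Sum>i\<in>(UNIV :: 'd set). replicate_mset n i)"
  have A: "count A i = n" for i by (simp add: A_def count_sum)
  have set: "set_mset A = UNIV" using A False by (metis UNIV_eq_I count_eq_zero_iff)
  have "steps_to (\<chi> i::'d. int n) = permutations_of_multiset A"
    by (auto simp: steps_to_def permutations_of_multiset_def vec_eq_iff pos_nth multiset_eq_iff A
        simp flip: count_mset)
  hence "card (steps_to (\<chi> i::'d. int n)) = fact (size A) div (\<Prod>i\<in>UNIV. fact (count A i))"
    by (simp add: card_permutations_of_multiset set)
  moreover have "(\<Prod>i\<in>UNIV. fact (count A i)) dvd (fact (size A) :: nat)"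
    using card_permutations_of_multiset(2)[of A] by (simp add: set)
  moreover have "size A = CARD('d) * n" by (simp add: A_def size_multiset_sum)
  ultimately show ?thesis by (simp add: A)
qed

lemma card_diag_paths_ge:
  assumes "n \<ge> 1"
  shows "real CARD('d::finite) ^ (CARD('d) * n) \<le>
    real (card (diag_paths n :: (int ^ 'd) list set)) * (real n * real CARD('d)) ^ CARD('d)"
proof -
  let ?d = "CARD('d)" and ?C = "card (steps_to (\<chi> i::'d. int n))"
  have "?d ^ (?d * n) * fact n ^ ?d \<le> fact (?d * n) * (n ^ ?d * ?d ^ ?d :: nat)"
    by (rule central_multinomial_ge[OF assms])
  also have "\<dots> = (?C * (n * ?d) ^ ?d) * fact n ^ ?d"
    unfolding card_diag_steps power_mult_distrib by (simp add: mult_ac)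
  finally have "?d ^ (?d * n) \<le> ?C * (n * ?d) ^ ?d"
    using mult_le_cancel2[of "?d ^ (?d * n)" "fact n ^ ?d"] by simp
  hence "real (?d ^ (?d * n)) \<le> real (?C * (n * ?d) ^ ?d)" by (simp only: of_nat_le_iff)
  moreover have "card (diag_paths n :: (int ^ 'd) list set) = ?C"
    unfolding diag_paths_eq by (rule card_image) (rule inj_on_subset[OF inj_path_of_steps], simp)
  ultimately show ?thesis by simp
qed

definition vertex :: "'d::finite list \<Rightarrow> nat \<Rightarrow> int ^ 'd" where
  "vertex js k = pos (take (Suc k) js)"

text \<open>The opposite corner of the unit square spanned by steps \<open>k\<close> and
  \<open>k + 1\<close>: the vertex visited instead if these two steps are exchanged. It lies on the
  same level as \<open>vertex js k\<close>.\<close>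

definition flipped_vertex :: "'d::finite list \<Rightarrow> nat \<Rightarrow> int ^ 'd" where
  "flipped_vertex js k = pos (take k js) + axis (js ! Suc k) 1"

text \<open>Exchanging the two steps at a turn keeps the endpoints and replaces exactly one
  vertex.\<close>

lemma geodesic_imp_flip_le:
  assumes geo: "\<And>ks. pos ks = pos js \<Longrightarrow> walk_sum w 0 ks \<le> walk_sum w 0 js" and k: "k \<in> turns js"
  shows "w (flipped_vertex js k) \<le> w (vertex js k)"
proof -
  let ?a = "js ! k" and ?b = "js ! Suc k" and ?p = "take k js" and ?r = "drop (Suc (Suc k)) js"
  have lt: "Suc k < length js" using k by (simp add: turns_def)
  have js: "js = ?p @ [?a, ?b] @ ?r"
    using lt by (metis Cons_nth_drop_Suc Suc_lessD append_Cons append_Nil append_take_drop_id)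
  define ks where "ks = ?p @ [?b, ?a] @ ?r"
  have "pos ks = pos (?p @ [?a, ?b] @ ?r)" by (simp add: ks_def)
  hence "pos ks = pos js" using js by metis
  from geo[OF this] have "walk_sum w 0 ks \<le> walk_sum w 0 (?p @ [?a, ?b] @ ?r)" using js by simp
  thus ?thesis
    using lt by (simp add: ks_def walk_sum_append add_ac flipped_vertex_def vertex_def pos_take_Suc)
qed

section \<open>A Chernoff bound in which each turn costs a constant factor\<close>

context iid_weights
begin

definition mgf :: "real \<Rightarrow> real" where
  "mgf t = (\<integral>x. exp (t * x) \<partial>D)"

definition mgf_fin :: "real \<Rightarrow> bool" where
  "mgf_fin t \<longleftrightarrow> integrable D (\<lambda>x. exp (t * x))"

lemma borel_measurable_D: "f \<in> borel_measurable borel \<Longrightarrow> f \<in> borel_measurable D"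
  using measurable_cong_sets[OF sets_D refl] by blast

lemma mgf_fin_coord: "mgf_fin t \<Longrightarrow> integrable Q (\<lambda>w. exp (t * w x))"
  unfolding mgf_fin_def by (subst integrable_coord) auto

lemma mgf_coord: "(\<integral>w. exp (t * w x) \<partial>Q) = mgf t"
  unfolding mgf_def by (rule integral_coord) simp

lemma mgf_pos: "mgf_fin t \<Longrightarrow> 0 < mgf t"
proof -
  assume t: "mgf_fin t"
  interpret prob_space D by (rule prob_D)
  have "(\<integral>x. exp (t * x) \<partial>D) \<noteq> 0"
    using t not_AE_zero_E[of "\<lambda>_. 1 :: real"] emeasure_space_1
    by (subst integral_nonneg_eq_0_iff_AE) (auto simp: mgf_fin_def AE_False)
  moreover have "0 \<le> (\<integral>x. exp (t * x) \<partial>D)" by (rule Bochner_Integration.integral_nonneg) simp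
  ultimately show ?thesis unfolding mgf_def by linarith
qed

lemma Markov_exp:
  assumes "integrable Q F" "\<And>w. A w \<Longrightarrow> 1 \<le> F w" "\<And>w. 0 \<le> F w" and [measurable]: "Measurable.pred Q A"
  shows "Pr A \<le> (\<integral>w. F w \<partial>Q)"
proof -
  interpret Q: prob_space "Q :: ('a \<Rightarrow> real) measure" by (rule prob_Q)
  have "Pr A = (\<integral>w. of_bool (A w) \<partial>Q)" by (rule integral_of_bool[symmetric]) simp
  also have "\<dots> \<le> (\<integral>w. F w \<partial>Q)"
  proof (rule integral_mono)
    show "integrable Q (\<lambda>w. of_bool (A w) :: real)"
      by (rule Q.integrable_const_bound[of _ 1]) auto
    show "of_bool (A w) \<le> F w" for w using assms(2,3) by (cases "A w") auto
  qed (rule assms(1))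
  finally show ?thesis .
qed

lemma pred_le_Q [measurable (raw)]:
  fixes f g :: "('i \<Rightarrow> real) \<Rightarrow> real"
  assumes "f \<in> borel_measurable Q" "g \<in> borel_measurable Q"
  shows "Measurable.pred Q (\<lambda>w. f w \<le> g w)"
  using borel_measurable_le[OF assms] by (simp add: pred_def)

text \<open>Exponential Markov inequality with the indicators of the flip conditions kept under the
  expectation. The factor of index \<open>k\<close> involves only vertices on level
  \<open>k + 1\<close>, so the factors are independent even when turns follow each other
  immediately, and each turn contributes one factor \<open>1 - \<kappa>\<close>.\<close>

lemma Pr_turn_le:
  fixes js :: "'d::finite list"
  assumes t: "mgf_fin t" "0 \<le> t" and \<kappa>: "0 \<le> \<kappa>" "\<kappa> \<le> 1"
    and flip: "\<And>x y :: int ^ 'd. x \<noteq> y \<Longrightarrow>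
      (\<integral>w. exp (t * w x) * of_bool (w y \<le> w x) \<partial>Q) \<le> (1 - \<kappa>) * mgf t"
  shows "Pr (\<lambda>w. c \<le> walk_sum w 0 js \<and> (\<forall>k\<in>turns js. w (flipped_vertex js k) \<le> w (vertex js k)))
    \<le> exp (- t * c) * mgf t ^ length js * (1 - \<kappa>) ^ card (turns js)"
proof -
  interpret Q: prob_space "Q :: (int ^ 'd \<Rightarrow> real) measure" by (rule prob_Q)
  define N where "N = length js"
  define I where "I k w = (k \<in> turns js \<longrightarrow> w (flipped_vertex js k) \<le> w (vertex js k))"
    for k and w :: "int ^ 'd \<Rightarrow> real"
  define F where "F k w = exp (t * w (vertex js k)) * of_bool (I k w)" for k and w :: "int ^ 'd \<Rightarrow> real"
  have lv: "level (vertex js k) = int (Suc k)" if "k < N" for k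
    using that by (simp add: vertex_def N_def)
  have lf: "level (flipped_vertex js k) = int (Suc k)" if "k \<in> turns js" for k
    using that by (simp add: flipped_vertex_def turns_def)
  have neq: "flipped_vertex js k \<noteq> vertex js k" if "k \<in> turns js" for k
    using that by (auto simp: flipped_vertex_def vertex_def turns_def pos_take_Suc axis_eq_axis)
  have [measurable]: "Measurable.pred Q (I k)" for k unfolding I_def by measurable
  have Fm [measurable]: "F k \<in> borel_measurable Q" for k unfolding F_def by measurable
  have Fi: "integrable Q (F k)" for k
    by (rule Bochner_Integration.integrable_bound[OF mgf_fin_coord[OF t(1), of "vertex js k"]])
      (auto simp: F_def)
  have disj: "disjoint_family_on (\<lambda>k. {x :: int ^ 'd. level x = int (Suc k)}) {..<N}"
    by (auto simp: disjoint_family_on_def)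
  have dep: "depends_on {x. level x = int (Suc k)} (F k)" if "k \<in> {..<N}" for k
  proof (rule depends_onI)
    fix v w :: "int ^ 'd \<Rightarrow> real"
    assume *: "\<And>x. x \<in> {x. level x = int (Suc k)} \<Longrightarrow> v x = w x"
    have "v (vertex js k) = w (vertex js k)" using that by (intro *) (simp add: lv)
    moreover have "v (flipped_vertex js k) = w (flipped_vertex js k)" if "k \<in> turns js"
      using that by (intro *) (simp add: lf)
    ultimately show "F k v = F k w" by (auto simp: F_def I_def)
  qed
  note prod = expectation_prod[OF finite_lessThan disj dep Fi]
  have EF: "(\<integral>w. F k w \<partial>Q) \<le> (if k \<in> turns js then (1 - \<kappa>) * mgf t else mgf t)" for k
  proof (cases "k \<in> turns js")
    case True
    show ?thesis using flip[of "vertex js k" "flipped_vertex js k"] neq[OF True] True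
      by (auto simp: F_def I_def)
  next
    case False
    thus ?thesis by (simp add: F_def I_def mgf_coord)
  qed
  have sub: "turns js \<subseteq> {..<N}" by (auto simp: turns_def N_def)
  have "Pr (\<lambda>w. c \<le> walk_sum w 0 js \<and> (\<forall>k\<in>turns js. w (flipped_vertex js k) \<le> w (vertex js k)))
      \<le> (\<integral>w. exp (- t * c) * (\<Prod>k<N. F k w) \<partial>Q)"
  proof (rule Markov_exp)
    show "integrable Q (\<lambda>w. exp (- t * c) * (\<Prod>k<N. F k w))" using prod(1) by simp
    show "0 \<le> exp (- t * c) * (\<Prod>k<N. F k w)" for w
      by (intro mult_nonneg_nonneg prod_nonneg) (auto simp: F_def)
    fix w assume w: "c \<le> walk_sum w 0 js \<and> (\<forall>k\<in>turns js. w (flipped_vertex js k) \<le> w (vertex js k))"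
    hence "(\<Prod>k<N. F k w) = (\<Prod>k<N. exp (t * w (vertex js k)))"
      by (intro prod.cong) (auto simp: F_def I_def)
    also have "\<dots> = exp (t * walk_sum w 0 js)"
      by (simp add: exp_sum walk_sum_eq_sum sum_distrib_left vertex_def N_def)
    also have "exp (- t * c) * \<dots> = exp (t * (walk_sum w 0 js - c))"
      by (simp add: exp_add[symmetric] algebra_simps)
    also have "\<dots> \<ge> 1" using w t(2) by simp
    finally show "1 \<le> exp (- t * c) * (\<Prod>k<N. F k w)" .
  next
    have "Measurable.pred Q (\<lambda>w. \<forall>k\<in>turns js. w (flipped_vertex js k) \<le> w (vertex js k))"
      by (intro pred_intros_finite) auto
    thus "Measurable.pred Q (\<lambda>w. c \<le> walk_sum w 0 js \<and> (\<forall>k\<in>turns js. w (flipped_vertex js k) \<le> w (vertex js k)))"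
      by measurable
  qed
  also have "\<dots> = exp (- t * c) * (\<Prod>k<N. \<integral>w. F k w \<partial>Q)"
    using prod(2) by simp
  also have "(\<Prod>k<N. \<integral>w. F k w \<partial>Q) \<le> (\<Prod>k<N. if k \<in> turns js then (1 - \<kappa>) * mgf t else mgf t)"
    by (intro prod_mono conjI EF Bochner_Integration.integral_nonneg) (auto simp: F_def)
  also have "\<dots> = (\<Prod>k\<in>turns js. (1 - \<kappa>) * mgf t) * (\<Prod>k\<in>{..<N} - turns js. mgf t)"
    by (subst prod.subset_diff[OF sub]) (auto intro!: arg_cong2[where f = "(*)"] prod.cong)
  also have "\<dots> = (1 - \<kappa>) ^ card (turns js) * mgf t ^ (card (turns js) + card ({..<N} - turns js))"
    by (simp add: power_mult_distrib power_add)
  also have "card (turns js) + card ({..<N} - turns js) = N"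
    using card_Diff_subset[OF finite_turns sub] card_mono[OF _ sub] by simp
  finally show ?thesis by (simp add: N_def mult_ac)
qed

text \<open>The indicator vanishes when \<open>w x \<le> \<rho>1\<close> and
  \<open>w y > \<rho>2\<close>, two independent events of positive probability, so a fixed amount of
  the exponential moment is lost. \<open>\<kappa>\<close> is quantified before \<open>t\<close>
  because the tilt is later chosen depending on how small \<open>\<kappa>\<close> is.\<close>

lemma flip_constant:
  assumes t1: "mgf_fin t1" and \<rho>: "\<rho>1 \<le> \<rho>2"
    and pos: "0 < measure D {x. x \<le> \<rho>1}" "0 < measure D {x. \<rho>2 < x}"
  shows "\<exists>\<kappa>>0. \<kappa> \<le> 1 \<and> (\<forall>t. 0 \<le> t \<longrightarrow> t \<le> t1 \<longrightarrow> mgf_fin t \<longrightarrow> (\<forall>(x :: 'i) y. x \<noteq> y \<longrightarrow>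
     (\<integral>w. exp (t * w x) * of_bool (w y \<le> w x) \<partial>Q) \<le> (1 - \<kappa>) * mgf t))"
proof -
  interpret D: prob_space D by (rule prob_D)
  interpret Q: prob_space "Q :: ('i \<Rightarrow> real) measure" by (rule prob_Q)
  \<comment> \<open>\<open>min 1 (exp (t1 * x))\<close> is a lower bound of
    \<open>exp (t * x)\<close> for all \<open>t\<close> in \<open>[0, t1]\<close>; this makes the
    loss \<open>m * p\<close> uniform in \<open>t\<close>.\<close>
  define m where "m = (\<integral>x. min 1 (exp (t1 * x)) * of_bool (x \<le> \<rho>1) \<partial>D)"
  have int: "integrable D (\<lambda>x. min 1 (exp (t1 * x)) * of_bool (x \<le> \<rho>1))"
  proof (rule D.integrable_const_bound[of _ 1])
    show "(\<lambda>x. min 1 (exp (t1 * x)) * of_bool (x \<le> \<rho>1)) \<in> borel_measurable D"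
      by (rule borel_measurable_D) simp
  qed (auto simp: abs_mult)
  have "m \<noteq> 0"
  proof
    assume "m = 0"
    hence "AE x in D. min 1 (exp (t1 * x)) * of_bool (x \<le> \<rho>1) = 0"
      unfolding m_def using int by (subst (asm) integral_nonneg_eq_0_iff_AE) auto
    hence "AE x in D. \<not> x \<le> \<rho>1"
      by eventually_elim (auto simp: min_def split: if_splits)
    hence "D.prob {x. x \<le> \<rho>1} = 0"
      using D.prob_eq_0[of "{x. x \<le> \<rho>1}"] sets_D by simp
    thus False using pos by simp
  qed
  moreover have "m \<ge> 0" unfolding m_def by (intro Bochner_Integration.integral_nonneg) auto
  ultimately have m: "m > 0" by simp
  define p where "p = measure D {x. \<rho>2 < x}"
  \<comment> \<open>The denominator \<open>1 + mgf t1\<close> bounds \<open>mgf t\<close> for every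
    admissible \<open>t\<close> in \<open>[0, t1]\<close>.\<close>
  define \<kappa> where "\<kappa> = min 1 (m * p / (1 + mgf t1))"
  have mgf1: "mgf t1 > 0" by (rule mgf_pos[OF t1])
  have "\<kappa> > 0" using m pos mgf1 by (simp add: \<kappa>_def p_def)
  moreover have "(\<integral>w. exp (t * w x) * of_bool (w y \<le> w x) \<partial>Q) \<le> (1 - \<kappa>) * mgf t"
    if t: "0 \<le> t" "t \<le> t1" "mgf_fin t" and xy: "x \<noteq> y" for t and x y :: 'i
  proof -
    have "mgf t \<le> (\<integral>x. 1 + exp (t1 * x) \<partial>D)" unfolding mgf_def
    proof (rule integral_mono)
      show "exp (t * x) \<le> 1 + exp (t1 * x)" for x :: real
      proof (cases "x \<ge> 0")
        case True
        hence "exp (t * x) \<le> exp (t1 * x)" using t by (simp add: mult_right_mono)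
        thus ?thesis by linarith
      next
        case False
        hence "exp (t * x) \<le> 1" using t by (simp add: mult_nonneg_nonpos)
        thus ?thesis by (simp add: add_increasing2)
      qed
    qed (use t t1 in \<open>auto simp: mgf_fin_def\<close>)
    also have "\<dots> = 1 + mgf t1" using t1 by (simp add: mgf_def mgf_fin_def D.prob_space)
    finally have le: "mgf t \<le> 1 + mgf t1" .
    have intL: "integrable D (\<lambda>x. exp (t * x) * of_bool (x \<le> \<rho>1))"
    proof (rule Bochner_Integration.integrable_bound[OF t(3)[unfolded mgf_fin_def]])
      show "(\<lambda>x. exp (t * x) * of_bool (x \<le> \<rho>1)) \<in> borel_measurable D"
        by (rule borel_measurable_D) simp
    qed auto
    have "m \<le> (\<integral>x. exp (t * x) * of_bool (x \<le> \<rho>1) \<partial>D)" unfolding m_def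
    proof (rule integral_mono[OF int intL])
      fix x :: real
      have "min 1 (exp (t1 * x)) \<le> exp (t * x)"
      proof (cases "x \<ge> 0")
        case True thus ?thesis using t by (simp add: min.coboundedI1)
      next
        case False
        hence "exp (t1 * x) \<le> exp (t * x)" using t by (simp add: mult_right_mono_neg)
        thus ?thesis by (simp add: min.coboundedI2)
      qed
      thus "min 1 (exp (t1 * x)) * of_bool (x \<le> \<rho>1) \<le> exp (t * x) * of_bool (x \<le> \<rho>1)"
        by (intro mult_right_mono) auto
    qed
    also have "\<dots> = (\<integral>w. exp (t * w x) * of_bool (w x \<le> \<rho>1) \<partial>Q)"
      by (rule integral_coord[symmetric]) measurable
    finally have mle: "m \<le> (\<integral>w. exp (t * w x) * of_bool (w x \<le> \<rho>1) \<partial>Q)" .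
    have peq: "p = (\<integral>w. of_bool (\<rho>2 < w y) \<partial>Q)"
    proof -
      have "p = Pr (\<lambda>w. \<rho>2 < w y)" unfolding p_def by (rule Pr_coord[symmetric]) measurable
      thus ?thesis by (simp add: integral_of_bool)
    qed
    define F where "F b w = (if b then exp (t * w x) * of_bool (w x \<le> \<rho>1) else of_bool (\<rho>2 < w y))"
      for b and w :: "'i \<Rightarrow> real"
    have "integrable Q (\<lambda>w. exp (t * w x) * of_bool (w x \<le> \<rho>1))"
      using intL by (subst integrable_coord) auto
    moreover have "integrable Q (\<lambda>w. of_bool (\<rho>2 < w y) :: real)"
      by (rule Q.integrable_const_bound[of _ 1]) auto
    ultimately have Fi: "integrable Q (F b)" for b by (cases b) (simp_all add: F_def[abs_def])
    have "disjoint_family_on (\<lambda>b. if b then {x} else {y}) UNIV"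
      using xy by (auto simp: disjoint_family_on_def)
    moreover have "depends_on (if b then {x} else {y}) (F b)" for b
      by (rule depends_onI) (auto simp: F_def)
    ultimately have pr: "integrable Q (\<lambda>w. \<Prod>b\<in>UNIV. F b w)"
        "(\<integral>w. (\<Prod>b\<in>UNIV. F b w) \<partial>Q) = (\<Prod>b\<in>UNIV. \<integral>w. F b w \<partial>Q)"
      using expectation_prod[of UNIV "\<lambda>b. if b then {x} else {y}" F] Fi by simp_all
    have "\<kappa> * mgf t \<le> (m * p / (1 + mgf t1)) * (1 + mgf t1)"
      using le mgf1 m mgf_pos[OF t(3)] by (intro mult_mono) (auto simp: \<kappa>_def p_def)
    also have "\<dots> = m * p" using mgf1 by simp
    also have "\<dots> \<le> (\<integral>w. exp (t * w x) * of_bool (w x \<le> \<rho>1) \<partial>Q) * (\<integral>w. of_bool (\<rho>2 < w y) \<partial>Q)"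
      using mle m by (simp add: peq mult_right_mono)
    also have "\<dots> = (\<integral>w. (\<Prod>b\<in>UNIV. F b w) \<partial>Q)"
      unfolding pr(2) by (simp add: UNIV_bool F_def[abs_def] mult.commute)
    also have "\<dots> \<le> (\<integral>w. exp (t * w x) - exp (t * w x) * of_bool (w y \<le> w x) \<partial>Q)"
    proof (rule integral_mono[OF pr(1)])
      show "integrable Q (\<lambda>w. exp (t * w x) - exp (t * w x) * of_bool (w y \<le> w x))"
        by (intro Bochner_Integration.integrable_diff mgf_fin_coord[OF t(3)]
            Bochner_Integration.integrable_bound[OF mgf_fin_coord[OF t(3), of x]]) auto
      show "(\<Prod>b\<in>UNIV. F b w) \<le> exp (t * w x) - exp (t * w x) * of_bool (w y \<le> w x)" for w
        using \<rho> by (auto simp: UNIV_bool F_def of_bool_def)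
    qed
    also have "\<dots> = mgf t - (\<integral>w. exp (t * w x) * of_bool (w y \<le> w x) \<partial>Q)"
      by (subst Bochner_Integration.integral_diff)
        (auto intro!: mgf_fin_coord[OF t(3)] Bochner_Integration.integrable_bound[OF mgf_fin_coord[OF t(3), of x]]
          simp: mgf_coord)
    finally show ?thesis by (simp add: algebra_simps)
  qed
  moreover have "\<kappa> \<le> 1" by (simp add: \<kappa>_def)
  ultimately show ?thesis by blast
qed

end

section \<open>The lower tail\<close>

definition diag :: "nat \<Rightarrow> int ^ 'd::finite" where
  "diag n = (\<chi> i. int n)"

lemma diag_nth [simp]: "diag n $ i = int n" by (simp add: diag_def)

lemma diag_add: "diag (m + n) = diag m + diag n"
  by (simp add: diag_def vec_eq_iff)

lemma diag_0 [simp]: "diag 0 = 0"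
  by (simp add: diag_def vec_eq_iff)

lemma level_diag [simp]: "level (diag n :: int ^ 'd::finite) = int (CARD('d) * n)"
  by (simp add: diag_def)

text \<open>The condition on the level removes only the lower corner \<open>u\<close>, whose weight
  a walk from \<open>u\<close> does not count. So the shared corner of two consecutive boxes on a
  strip belongs to just one of them.\<close>

definition box :: "int ^ 'd::finite \<Rightarrow> nat \<Rightarrow> (int ^ 'd) set" where
  "box u m = {x. 1 \<le> level x - level u \<and> (\<forall>i. 0 \<le> (x - u) $ i \<and> (x - u) $ i \<le> int m)}"

definition box_max :: "nat \<Rightarrow> int ^ 'd::finite \<Rightarrow> (int ^ 'd \<Rightarrow> real) \<Rightarrow> real" where
  "box_max m u w = Max (walk_sum w u ` steps_to (diag m))"

lemma steps_to_diag_nonempty: "steps_to (diag n) \<noteq> {}"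
  using diag_steps_nonempty[of n] by (auto simp: steps_to_def diag_def)

lemma box_max_ge: "pos js = diag m \<Longrightarrow> walk_sum w u js \<le> box_max m u w"
  unfolding box_max_def by (rule Max_ge) (auto simp: steps_to_def finite_imageI[OF finite_steps_to, unfolded steps_to_def])

lemma box_max_ex: "\<exists>js. pos js = diag m \<and> box_max m u w = walk_sum w u js"
proof -
  have "box_max m u w \<in> walk_sum w u ` steps_to (diag m)"
    unfolding box_max_def by (rule Max_in) (simp_all add: steps_to_diag_nonempty)
  thus ?thesis by (auto simp: steps_to_def)
qed

lemma count_list_take_le: "count_list (take k js) i \<le> count_list js i"
proof -
  have "count_list js i = count_list (take k js @ drop k js) i" by simp
  thus ?thesis unfolding count_list_append by simp
qed

lemma box_max_depends_on: "depends_on (box u m) (box_max m u)"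
proof (rule depends_onI)
  fix v w :: "int ^ 'a \<Rightarrow> real" assume *: "\<And>x. x \<in> box u m \<Longrightarrow> v x = w x"
  have "walk_sum v u js = walk_sum w u js" if js: "js \<in> steps_to (diag m)" for js
  proof -
    have "v (u + pos (take (Suc k) js)) = w (u + pos (take (Suc k) js))" if "k < length js" for k
    proof (rule *)
      have "pos (take (Suc k) js) $ i \<le> int m" for i
        using count_list_take_le[of "Suc k" js i] js pos_nth[of js i] by (simp add: pos_nth steps_to_def)
      thus "u + pos (take (Suc k) js) \<in> box u m" using that by (simp add: box_def pos_nth)
    qed
    thus ?thesis by (simp add: walk_sum_eq_sum)
  qed
  thus "box_max m u v = box_max m u w" unfolding box_max_def by (metis (no_types, lifting) image_cong)
qed

lemma box_max_shift: "box_max m (u + v) w = box_max m u (\<lambda>x. w (x + v))"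
  unfolding box_max_def walk_sum_shift ..

lemma strip_path:
  "\<exists>js. pos js = diag (J * m) \<and> walk_sum w u js = (\<Sum>j<J. box_max m (u + diag (j * m)) w)"
proof (induction J)
  case 0
  show ?case by (intro exI[of _ "[]"]) simp
next
  case (Suc J)
  then obtain js where js: "pos js = diag (J * m)" "walk_sum w u js = (\<Sum>j<J. box_max m (u + diag (j * m)) w)"
    by blast
  obtain ks where "pos ks = diag m" "box_max m (u + diag (J * m)) w = walk_sum w (u + diag (J * m)) ks"
    using box_max_ex by blast
  thus ?case using js
    by (intro exI[of _ "js @ ks"]) (simp add: walk_sum_append flip: diag_add, simp add: add.commute)
qed

definition strip_corner :: "'d::finite \<Rightarrow> nat \<Rightarrow> nat \<times> nat \<Rightarrow> int ^ 'd" where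
  "strip_corner i0 m = (\<lambda>(r, j). pos (replicate (r * (2 * m + 1)) i0) + diag (j * m))"

lemma int_block_unique:
  fixes x M :: int
  assumes "0 \<le> x - int a * M" "x - int a * M < M" "0 \<le> x - int b * M" "x - int b * M < M"
  shows "a = b"
proof -
  have "x div M = int a" by (rule int_div_pos_eq[of x M _ "x - int a * M"]) (use assms in auto)
  moreover have "x div M = int b" by (rule int_div_pos_eq[of x M _ "x - int b * M"]) (use assms in auto)
  ultimately show ?thesis by simp
qed

text \<open>Strips of width \<open>m\<close> around parallels of the diagonal are disjoint once they are translated by
  multiples of \<open>2 m + 1\<close> in direction \<open>i0\<close>: compare two coordinates. This needs \<open>d \<ge> 2\<close>.\<close>

lemma disjoint_boxes:
  assumes "i0 \<noteq> (i1 :: 'd::finite)"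
  shows "disjoint_family_on (\<lambda>p. box (strip_corner i0 m p) m) L"
proof (unfold disjoint_family_on_def, intro ballI impI)
  fix p p' :: "nat \<times> nat" assume "p \<in> L" "p' \<in> L" and ne: "p \<noteq> p'"
  obtain r j r' j' where p: "p = (r, j)" "p' = (r', j')" by (cases p, cases p')
  show "box (strip_corner i0 m p) m \<inter> box (strip_corner i0 m p') m = {}"
  proof (rule ccontr)
    assume "\<not> ?thesis"
    then obtain x where x: "x \<in> box (strip_corner i0 m p) m" "x \<in> box (strip_corner i0 m p') m" by blast
    have c: "strip_corner i0 m (r, j) $ i0 = int (r * (2 * m + 1)) + int (j * m)"
      "strip_corner i0 m (r, j) $ i1 = int (j * m)"
      "level (strip_corner i0 m (r, j)) = int (r * (2 * m + 1)) + int (j * (CARD('d) * m))" for r j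
    proof -
      have "count_list (replicate n i0) i0 = n" "count_list (replicate n i0) i1 = 0" for n
        using assms by (induction n) auto
      thus "strip_corner i0 m (r, j) $ i0 = int (r * (2 * m + 1)) + int (j * m)"
        "strip_corner i0 m (r, j) $ i1 = int (j * m)"
        unfolding strip_corner_def by (simp_all add: pos_nth)
      show "level (strip_corner i0 m (r, j)) = int (r * (2 * m + 1)) + int (j * (CARD('d) * m))"
        unfolding strip_corner_def by (simp add: mult_ac)
    qed
    have b: "0 \<le> x $ i0 - strip_corner i0 m q $ i0" "x $ i0 - strip_corner i0 m q $ i0 \<le> int m"
      "0 \<le> x $ i1 - strip_corner i0 m q $ i1" "x $ i1 - strip_corner i0 m q $ i1 \<le> int m"
      if "q \<in> {p, p'}" for q
      using x that by (auto simp: box_def)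
    have lv: "1 \<le> level x - level (strip_corner i0 m q)"
      "level x - level (strip_corner i0 m q) \<le> int (CARD('d) * m)" if "q \<in> {p, p'}" for q
    proof -
      have q: "x \<in> box (strip_corner i0 m q) m" using x that by auto
      thus "1 \<le> level x - level (strip_corner i0 m q)" by (simp add: box_def)
      have "level (x - strip_corner i0 m q) \<le> (\<Sum>i\<in>(UNIV :: 'd set). int m)"
        unfolding level_def using q by (intro sum_mono) (auto simp: box_def)
      thus "level x - level (strip_corner i0 m q) \<le> int (CARD('d) * m)" by simp
    qed
    \<comment> \<open>The difference of the coordinates \<open>i0\<close> and \<open>i1\<close> is
      constant along the diagonal, and inside a box it deviates by at most \<open>m\<close> from its
      value at the corner: it lies in a window of length \<open>2 m + 1\<close> centred at
      \<open>r (2 m + 1)\<close>.\<close>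
    have "r = r'"
    proof (rule int_block_unique[of "x $ i0 - x $ i1 + int m" r "2 * int m + 1"])
      show "0 \<le> x $ i0 - x $ i1 + int m - int r * (2 * int m + 1)"
        "x $ i0 - x $ i1 + int m - int r * (2 * int m + 1) < 2 * int m + 1"
        using b[of p] unfolding p c by (simp_all add: algebra_simps)
      show "0 \<le> x $ i0 - x $ i1 + int m - int r' * (2 * int m + 1)"
        "x $ i0 - x $ i1 + int m - int r' * (2 * int m + 1) < 2 * int m + 1"
        using b[of p'] unfolding p c by (simp_all add: algebra_simps)
    qed
    \<comment> \<open>Within a strip, the level of a point of box \<open>j\<close> exceeds that of
      the start of the strip by a number from \<open>j d m + 1\<close> to
      \<open>(j + 1) d m\<close>; subtracting 1 turns this into the half-open window of the block
      lemma.\<close>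
    moreover have "j = j'"
    proof (rule int_block_unique[of "level x - int (r * (2 * m + 1)) - 1" j "int (CARD('d) * m)"])
      show "0 \<le> level x - int (r * (2 * m + 1)) - 1 - int j * int (CARD('d) * m)"
        "level x - int (r * (2 * m + 1)) - 1 - int j * int (CARD('d) * m) < int (CARD('d) * m)"
        using lv[of p] unfolding p c by (simp_all add: algebra_simps)
      show "0 \<le> level x - int (r * (2 * m + 1)) - 1 - int j' * int (CARD('d) * m)"
        "level x - int (r * (2 * m + 1)) - 1 - int j' * int (CARD('d) * m) < int (CARD('d) * m)"
        using lv[of p'] unfolding p c \<open>r = r'\<close> by (simp_all add: algebra_simps)
    qed
    ultimately show False using ne p by simp
  qed
qed

section \<open>Exponential moments of box crossings\<close>

context iid_weights
begin

lemma box_max_measurable [measurable]: "box_max m u \<in> borel_measurable Q"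
  unfolding box_max_def[abs_def] by (intro borel_measurable_Max) auto

text \<open>Bernoulli's inequality is the convexity bound \<open>z \<le> 1 + (z ^ m - 1) / m\<close>
  for \<open>z = exp (t x / m)\<close>. It keeps the exponential moment, at parameter
  \<open>t / m\<close>, of a walk of length proportional to \<open>m\<close> bounded independently
  of \<open>m\<close>.\<close>

lemma mgf_fraction_le:
  assumes "mgf_fin t" "m \<ge> 1"
  shows "mgf_fin (t / real m)" "mgf (t / real m) \<le> exp ((mgf t - 1) / real m)"
proof -
  interpret D: prob_space D by (rule prob_D)
  have conv: "exp (t / real m * x) \<le> 1 + (exp (t * x) - 1) / real m" for x
  proof -
    define z where "z = exp (t / real m * x)"
    have "1 + real m * (z - 1) \<le> (1 + (z - 1)) ^ m" by (rule Bernoulli_inequality) (simp add: z_def)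
    also have "\<dots> = exp (t * x)" using assms(2) by (simp add: z_def exp_of_nat_mult[symmetric])
    finally show ?thesis using assms(2) by (simp add: z_def field_simps)
  qed
  have int: "integrable D (\<lambda>x. 1 + (exp (t * x) - 1) / real m)"
    using assms(1) by (simp add: mgf_fin_def)
  show fin: "mgf_fin (t / real m)" unfolding mgf_fin_def
  proof (rule Bochner_Integration.integrable_bound[OF int])
    show "(\<lambda>x. exp (t / real m * x)) \<in> borel_measurable D" by (rule borel_measurable_D) simp
    show "AE x in D. norm (exp (t / real m * x)) \<le> norm (1 + (exp (t * x) - 1) / real m)"
    proof (rule AE_I2)
      fix x show "norm (exp (t / real m * x)) \<le> norm (1 + (exp (t * x) - 1) / real m)"
        using conv[of x] unfolding real_norm_def abs_exp_cancel by linarith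
    qed
  qed
  have "mgf (t / real m) \<le> (\<integral>x. 1 + (exp (t * x) - 1) / real m \<partial>D)"
    unfolding mgf_def using conv fin int by (intro integral_mono) (auto simp: mgf_fin_def)
  also have "\<dots> = 1 + (mgf t - 1) / real m"
    using assms(1) by (simp add: mgf_def mgf_fin_def D.prob_space)
  also have "\<dots> \<le> exp ((mgf t - 1) / real m)" by (rule exp_ge_add_one_self)
  finally show "mgf (t / real m) \<le> exp ((mgf t - 1) / real m)" .
qed

lemma walk_sum_mgf:
  fixes js :: "'d::finite list"
  assumes "mgf_fin t"
  shows "integrable Q (\<lambda>w. exp (t * walk_sum w u js))"
    and "(\<integral>w. exp (t * walk_sum w u js) \<partial>Q) = mgf t ^ length js"
proof -
  have eq: "exp (t * walk_sum w u js) = (\<Prod>k<length js. exp (t * w (u + pos (take (Suc k) js))))" for w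
    by (simp add: walk_sum_eq_sum sum_distrib_left exp_sum)
  have disj: "disjoint_family_on (\<lambda>k. {u + pos (take (Suc k) js)}) {..<length js}"
  proof (unfold disjoint_family_on_def, intro ballI impI)
    fix k k' assume k: "k \<in> {..<length js}" "k' \<in> {..<length js}" "k \<noteq> k'"
    from k have "level (u + pos (take (Suc k) js)) \<noteq> level (u + pos (take (Suc k') js))" by simp
    hence "u + pos (take (Suc k) js) \<noteq> u + pos (take (Suc k') js)" by metis
    thus "{u + pos (take (Suc k) js)} \<inter> {u + pos (take (Suc k') js)} = {}" by blast
  qed
  have dep: "depends_on {u + pos (take (Suc k) js)} (\<lambda>w. exp (t * w (u + pos (take (Suc k) js))))" for k
    by (rule depends_onI) simp
  note prod = expectation_prod[OF finite_lessThan disj dep mgf_fin_coord[OF assms]]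
  show "integrable Q (\<lambda>w. exp (t * walk_sum w u js))" unfolding eq by (rule prod(1))
  show "(\<integral>w. exp (t * walk_sum w u js) \<partial>Q) = mgf t ^ length js"
    unfolding eq prod(2) mgf_coord by simp
qed

text \<open>For large boxes the crossing time reaches slope \<open>c1\<close> with high probability,
  and there the exponential is strictly below 1. On the rare remaining event the crossing time is
  bounded below by the walk sum along one fixed path, whose exponential moments are bounded
  uniformly in \<open>m\<close> since \<open>s\<close> scales like \<open>1 / m\<close>.\<close>

lemma box_mgf:
  assumes d: "mgf_fin (- x0)" "x0 > 0" and "\<mu>' < c1"
    and lo: "(\<lambda>n. Pr (\<lambda>w :: int ^ 'd::finite \<Rightarrow> real. \<forall>js. pos js = diag n \<longrightarrow>
      walk_sum w 0 js < c1 * (real CARD('d) * real n))) \<longlonglongrightarrow> 0"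
  shows "\<exists>m\<ge>1. \<exists>s>0. \<exists>q<1. \<forall>u :: int ^ 'd.
    integrable Q (\<lambda>w. exp (- s * (box_max m u w - \<mu>' * (real CARD('d) * real m)))) \<and>
    (\<integral>w. exp (- s * (box_max m u w - \<mu>' * (real CARD('d) * real m))) \<partial>Q) \<le> q"
proof -
  interpret Q: prob_space "Q :: (int ^ 'd \<Rightarrow> real) measure" by (rule prob_Q)
  let ?d = "real CARD('d)"
  \<comment> \<open>Half of \<open>x0\<close>, so that the second moment of
    \<open>exp (- s * W w)\<close> is still controlled by \<open>mgf (- x0)\<close>. The constants
    \<open>B\<close>, \<open>g\<close> and \<open>l\<close> are all fixed before the scale
    \<open>m\<close>.\<close>
  define \<theta> where "\<theta> = x0 / 2"
  define B where "B = exp ((mgf (- x0) - 1) * ?d)"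
  define g where "g = exp (- \<theta> * \<mu>' * ?d) - exp (- \<theta> * c1 * ?d)"
  have g: "g > 0" using d \<open>\<mu>' < c1\<close> by (simp add: g_def \<theta>_def)
  have B: "B > 0" by (simp add: B_def)
  define l where "l = g / (2 * B)"
  have l: "l > 0" using g B by (simp add: l_def)
  have "\<forall>\<^sub>F n in sequentially. Pr (\<lambda>w :: int ^ 'd \<Rightarrow> real. \<forall>js. pos js = diag n \<longrightarrow>
      walk_sum w 0 js < c1 * (?d * real n)) < g * l / 2"
    using g l by (intro order_tendstoD(2)[OF lo]) auto
  then obtain m0 where m0: "\<And>n. m0 \<le> n \<Longrightarrow> Pr (\<lambda>w :: int ^ 'd \<Rightarrow> real. \<forall>js. pos js = diag n \<longrightarrow>
      walk_sum w 0 js < c1 * (?d * real n)) < g * l / 2"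
    by (auto simp: eventually_sequentially)
  define m where "m = max m0 1"
  have m: "m \<ge> 1" "m \<ge> m0" by (auto simp: m_def)
  define s where "s = \<theta> / real m"
  have s: "s > 0" "s * real m = \<theta>" using m d by (auto simp: s_def \<theta>_def)
  define q where "q = 1 - g / 2 * exp (\<theta> * \<mu>' * ?d)"
  have q: "q < 1" using g by (simp add: q_def)
  obtain j0 :: "'d list" where j0: "pos j0 = diag m" using steps_to_diag_nonempty by (auto simp: steps_to_def)
  have len: "length j0 = CARD('d) * m" using level_pos[of j0] unfolding j0 level_diag of_nat_eq_iff by simp
  define W where "W w = walk_sum w 0 j0" for w :: "int ^ 'd \<Rightarrow> real"
  define T where "T w = box_max m 0 w" for w :: "int ^ 'd \<Rightarrow> real"
  have [measurable]: "W \<in> borel_measurable Q" "T \<in> borel_measurable Q"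
    unfolding W_def T_def by measurable
  have WT: "W w \<le> T w" for w unfolding W_def T_def by (rule box_max_ge[OF j0])
  define a where "a = c1 * (?d * real m)"
  have "- x0 / real m = - (2 * s)" by (simp add: s_def \<theta>_def)
  note fr = mgf_fraction_le[OF d(1) m(1), unfolded this]
  have iW: "integrable Q (\<lambda>w. exp (- (2 * s) * W w))"
    unfolding W_def by (rule walk_sum_mgf(1)[OF fr(1)])
  have "(\<integral>w. exp (- (2 * s) * W w) \<partial>Q) = mgf (- (2 * s)) ^ (CARD('d) * m)"
    unfolding W_def by (subst walk_sum_mgf(2)[OF fr(1)]) (simp add: len)
  also have "\<dots> \<le> exp ((mgf (- x0) - 1) / real m) ^ (CARD('d) * m)"
    by (rule power_mono[OF fr(2)]) (use mgf_pos[OF fr(1)] in simp)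
  also have "\<dots> = B" using m by (simp add: B_def exp_of_nat_mult[symmetric])
  finally have EW: "(\<integral>w. exp (- (2 * s) * W w) \<partial>Q) \<le> B" .
  have PT: "Pr (\<lambda>w. T w < a) < g * l / 2"
  proof -
    have "Pr (\<lambda>w. T w < a) \<le> Pr (\<lambda>w :: int ^ 'd \<Rightarrow> real. \<forall>js. pos js = diag m \<longrightarrow>
      walk_sum w 0 js < c1 * (?d * real m))"
      by (rule Pr_mono) (auto simp: T_def a_def intro: le_less_trans[OF box_max_ge])
    thus ?thesis using m0[OF m(2)] by linarith
  qed
  have bound: "exp (- s * T w) \<le> exp (- \<theta> * c1 * ?d) + l / 2 * exp (- (2 * s) * W w) + of_bool (T w < a) / (2 * l)" for w
  proof (cases "T w < a")
    case True
    \<comment> \<open>Young's inequality \<open>y \<le> l / 2 * y\<^sup>2 + 1 / (2 * l)\<close>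
      takes the place of Cauchy-Schwarz. With \<open>l = g / (2 * B)\<close> the two error terms
      integrate to at most \<open>g / 4\<close> each.\<close>
    define y where "y = exp (- s * W w)"
    have "0 \<le> (l * y - 1)\<^sup>2" by simp
    hence "2 * l * y \<le> l\<^sup>2 * y\<^sup>2 + 1" by (simp add: power2_diff power_mult_distrib)
    hence "y \<le> l / 2 * y\<^sup>2 + 1 / (2 * l)" using l by (simp add: field_simps power2_eq_square)
    moreover have "y\<^sup>2 = exp (- (2 * s) * W w)"
      unfolding y_def by (simp add: power2_eq_square exp_add[symmetric] algebra_simps)
    moreover have "exp (- s * T w) \<le> y" using WT[of w] s by (simp add: y_def)
    ultimately have "exp (- s * T w) \<le> l / 2 * exp (- (2 * s) * W w) + 1 / (2 * l)" by simp
    moreover have "of_bool (T w < a) = (1 :: real)" using True by simp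
    ultimately show ?thesis using exp_ge_zero[of "- \<theta> * c1 * ?d"] by ((simp only:)?; linarith)
  next
    case False
    hence "s * a \<le> s * T w" using s by simp
    moreover have "s * a = \<theta> * c1 * ?d" unfolding s(2)[symmetric] by (simp add: a_def mult_ac)
    ultimately have "exp (- s * T w) \<le> exp (- \<theta> * c1 * ?d)" by simp
    moreover have "of_bool (T w < a) = (0 :: real)" using False by simp
    moreover have "0 \<le> l / 2 * exp (- (2 * s) * W w)" using l by simp
    ultimately show ?thesis by ((simp only:)?; linarith)
  qed
  have iB: "integrable Q (\<lambda>w. of_bool (T w < a) :: real)" by (rule Q.integrable_const_bound[of _ 1]) auto
  have iR: "integrable Q (\<lambda>w. exp (- \<theta> * c1 * ?d) + l / 2 * exp (- (2 * s) * W w) + of_bool (T w < a) / (2 * l))"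
    using iW iB by simp
  have iT: "integrable Q (\<lambda>w. exp (- s * T w))"
  proof (rule Bochner_Integration.integrable_bound[OF iR])
    show "AE w in Q. norm (exp (- s * T w))
        \<le> norm (exp (- \<theta> * c1 * ?d) + l / 2 * exp (- (2 * s) * W w) + of_bool (T w < a) / (2 * l))"
    proof (rule AE_I2)
      fix w
      show "norm (exp (- s * T w))
        \<le> norm (exp (- \<theta> * c1 * ?d) + l / 2 * exp (- (2 * s) * W w) + of_bool (T w < a) / (2 * l))"
        using bound[of w] unfolding real_norm_def abs_exp_cancel by linarith
    qed
  qed measurable
  have "(\<integral>w. exp (- s * T w) \<partial>Q)
      \<le> (\<integral>w. exp (- \<theta> * c1 * ?d) + l / 2 * exp (- (2 * s) * W w) + of_bool (T w < a) / (2 * l) \<partial>Q)"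
    by (rule integral_mono[OF iT iR bound])
  also have "\<dots> = exp (- \<theta> * c1 * ?d) + l / 2 * (\<integral>w. exp (- (2 * s) * W w) \<partial>Q) + Pr (\<lambda>w. T w < a) / (2 * l)"
    using iW iB by (simp add: Q.prob_space integral_of_bool)
  also have "\<dots> \<le> exp (- \<theta> * c1 * ?d) + l / 2 * B + (g * l / 2) / (2 * l)"
    using EW PT l by (intro add_mono mult_left_mono divide_right_mono) auto
  also have "\<dots> = exp (- \<theta> * \<mu>' * ?d) - g / 2"
  proof -
    have "l / 2 * B = g / 4" using B by (simp add: l_def)
    moreover have "(g * l / 2) / (2 * l) = g / 4" using l by simp
    ultimately show ?thesis using g_def by linarith
  qed
  finally have ET: "(\<integral>w. exp (- s * T w) \<partial>Q) \<le> exp (- \<theta> * \<mu>' * ?d) - g / 2" .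
  have eq: "exp (- s * (T w - \<mu>' * (?d * real m))) = exp (\<theta> * \<mu>' * ?d) * exp (- s * T w)" for w
    unfolding s(2)[symmetric] by (simp add: exp_add[symmetric] algebra_simps)
  have int0: "integrable Q (\<lambda>w. exp (- s * (T w - \<mu>' * (?d * real m))))"
    unfolding eq using iT by simp
  have "(\<integral>w. exp (- s * (T w - \<mu>' * (?d * real m))) \<partial>Q) = exp (\<theta> * \<mu>' * ?d) * (\<integral>w. exp (- s * T w) \<partial>Q)"
    unfolding eq by simp
  also have "\<dots> \<le> exp (\<theta> * \<mu>' * ?d) * (exp (- \<theta> * \<mu>' * ?d) - g / 2)" by (rule mult_left_mono[OF ET]) simp
  also have "\<dots> = q" by (simp add: q_def algebra_simps exp_add[symmetric])
  finally have E0: "(\<integral>w. exp (- s * (T w - \<mu>' * (?d * real m))) \<partial>Q) \<le> q" .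
  have "integrable Q (\<lambda>w. exp (- s * (box_max m u w - \<mu>' * (?d * real m)))) \<and>
    (\<integral>w. exp (- s * (box_max m u w - \<mu>' * (?d * real m))) \<partial>Q) \<le> q" for u :: "int ^ 'd"
  proof -
    define F where "F w = exp (- s * (T w - \<mu>' * (?d * real m)))" for w
    have F: "exp (- s * (box_max m u w - \<mu>' * (?d * real m))) = F (\<lambda>x. w (x + u))" for w
      using box_max_shift[of m 0 u w] by (simp add: F_def T_def)
    have "inj (\<lambda>x. x + u)" "F \<in> borel_measurable Q" unfolding F_def by (simp_all add: inj_on_def)
    from integral_reindex[OF this] show ?thesis unfolding F using int0 E0 by (simp add: F_def[abs_def])
  qed
  thus ?thesis using m(1) s(1) q by blast
qed

text \<open>If every strip falls short of \<open>b\<close> per box, the product of the exponentials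
  over all \<open>R * J\<close> boxes is at least 1, while its expectation factorises over the
  disjoint boxes.\<close>

lemma strips_bound:
  fixes i0 i1 :: "'d::finite"
  assumes "i0 \<noteq> i1" "s > 0"
    and box: "\<And>u :: int ^ 'd. integrable Q (\<lambda>w. exp (- s * (box_max m u w - b)))"
      "\<And>u :: int ^ 'd. (\<integral>w. exp (- s * (box_max m u w - b)) \<partial>Q) \<le> q"
  shows "Pr (\<lambda>w. \<forall>r<R. (\<Sum>j<J. box_max m (strip_corner i0 m (r, j)) w) < b * real J) \<le> q ^ (R * J)"
proof -
  let ?L = "{..<R} \<times> {..<J}"
  define F where "F p w = exp (- s * (box_max m (strip_corner i0 m p) w - b))" for p and w :: "int ^ 'd \<Rightarrow> real"
  have dep: "depends_on (box (strip_corner i0 m p) m) (F p)" for p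
  proof (rule depends_onI)
    fix v w :: "int ^ 'd \<Rightarrow> real" assume "\<And>x. x \<in> box (strip_corner i0 m p) m \<Longrightarrow> v x = w x"
    hence "box_max m (strip_corner i0 m p) v = box_max m (strip_corner i0 m p) w"
      by (rule depends_onD[OF box_max_depends_on])
    thus "F p v = F p w" by (simp add: F_def)
  qed
  have Fi: "integrable Q (F p)" for p unfolding F_def by (rule box(1))
  note prod = expectation_prod[OF _ disjoint_boxes[OF assms(1)] dep Fi, of ?L]
  have "Pr (\<lambda>w. \<forall>r<R. (\<Sum>j<J. box_max m (strip_corner i0 m (r, j)) w) < b * real J)
      \<le> (\<integral>w. (\<Prod>p\<in>?L. F p w) \<partial>Q)"
  proof (rule Markov_exp)
    show "integrable Q (\<lambda>w. \<Prod>p\<in>?L. F p w)" by (rule prod(1)) simp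
    show "0 \<le> (\<Prod>p\<in>?L. F p w)" for w by (intro prod_nonneg) (auto simp: F_def)
    fix w assume w: "\<forall>r<R. (\<Sum>j<J. box_max m (strip_corner i0 m (r, j)) w) < b * real J"
    have "(\<Prod>p\<in>?L. F p w) = (\<Prod>r<R. \<Prod>j<J. F (r, j) w)"
      by (simp add: prod.cartesian_product)
    also have "\<dots> \<ge> 1"
    proof (rule prod_ge_1)
      fix r assume "r \<in> {..<R}"
      hence "(\<Sum>j<J. box_max m (strip_corner i0 m (r, j)) w) < b * real J" using w by simp
      hence "0 \<le> s * (b * real J - (\<Sum>j<J. box_max m (strip_corner i0 m (r, j)) w))" using \<open>s > 0\<close> by simp
      also have "\<dots> = (\<Sum>j<J. - s * (box_max m (strip_corner i0 m (r, j)) w - b))"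
        by (simp add: sum_distrib_left[symmetric] sum_subtractf sum_negf algebra_simps)
      finally show "1 \<le> (\<Prod>j<J. F (r, j) w)" unfolding F_def by (subst exp_sum[symmetric]) auto
    qed
    finally show "1 \<le> (\<Prod>p\<in>?L. F p w)" .
  qed measurable
  also have "\<dots> = (\<Prod>p\<in>?L. \<integral>w. F p w \<partial>Q)" by (rule prod(2)) simp
  also have "\<dots> \<le> (\<Prod>p\<in>?L. q)"
    unfolding F_def by (intro prod_mono conjI box(2) Bochner_Integration.integral_nonneg) simp
  also have "\<dots> = q ^ (R * J)" by simp
  finally show ?thesis .
qed

end

lemma walk_sum_ge:
  assumes "\<And>k. k < length js \<Longrightarrow> - y \<le> w (u + pos (take (Suc k) js))"
  shows "- (y * real (length js)) \<le> walk_sum w u js"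
proof -
  have "(\<Sum>k<length js. - y) \<le> walk_sum w u js"
    unfolding walk_sum_eq_sum by (rule sum_mono) (use assms in auto)
  thus ?thesis by (simp add: mult.commute)
qed

text \<open>This is where \<open>\<nu> > 1\<close> enters: \<open>n powr \<nu>\<close> outgrows
  every multiple of \<open>n\<close>.\<close>

lemma eventually_powr_superexp:
  fixes c \<nu> C K :: real
  assumes "c > 0" "\<nu> > 1" "C \<ge> 0"
  shows "\<forall>\<^sub>F n in sequentially. C * exp (- c * real n powr \<nu>) \<le> exp (- K * real n) / 2"
proof -
  define X where "X = max ((K + 1) / c) 0"
  have "\<forall>\<^sub>F n in sequentially. X powr (1 / (\<nu> - 1)) \<le> real n"
    using filterlim_real_sequentially by (simp add: filterlim_at_top)
  hence 1: "\<forall>\<^sub>F n in sequentially. (K + 1) / c \<le> real n powr (\<nu> - 1)"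
  proof eventually_elim
    case (elim n)
    have "X = (X powr (1 / (\<nu> - 1))) powr (\<nu> - 1)"
      using assms by (simp add: powr_powr X_def)
    also have "\<dots> \<le> real n powr (\<nu> - 1)" using elim assms by (intro powr_mono2) auto
    finally show ?case by (simp add: X_def)
  qed
  have 2: "\<forall>\<^sub>F n in sequentially. 2 * C \<le> real n"
    using filterlim_real_sequentially by (simp add: filterlim_at_top)
  show ?thesis using 1 2 eventually_gt_at_top[of 0]
  proof eventually_elim
    case (elim n)
    have "K + 1 \<le> c * real n powr (\<nu> - 1)" using elim(1) assms by (simp add: field_simps)
    hence "(K + 1) * real n \<le> c * real n powr (\<nu> - 1) * real n" by (rule mult_right_mono) simp
    also have "\<dots> = c * real n powr \<nu>"
      using elim(3) by (simp add: powr_diff)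
    finally have "exp (- c * real n powr \<nu>) \<le> exp (- K * real n) * exp (- real n)"
      by (simp add: exp_add[symmetric] algebra_simps)
    hence "C * exp (- c * real n powr \<nu>) \<le> C * (exp (- K * real n) * exp (- real n))"
      using assms(3) by (rule mult_left_mono)
    also have "\<dots> = exp (- K * real n) * (C / exp (real n))" by (simp add: exp_minus field_simps)
    also have "\<dots> \<le> exp (- K * real n) * (1 / 2)"
    proof (rule mult_left_mono)
      have "2 * C \<le> exp (real n)" using elim(2) exp_ge_add_one_self[of "real n"] by linarith
      thus "C / exp (real n) \<le> 1 / 2" by (simp add: field_simps)
    qed simp
    finally show ?case by simp
  qed
qed

context iid_weights
begin

text \<open>All \<open>R\<close> strips fail with probability at most \<open>q ^ (R * J)\<close>
  with \<open>J\<close> of order \<open>n / m\<close>; since \<open>R\<close> may be taken as large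
  as desired, the rate exceeds any \<open>K\<close>. A successful strip extends to a full path by
  two pieces of bounded length, which can only spoil it if one of boundedly many weights lies below
  a negative multiple of \<open>n\<close>.\<close>

lemma lower_tail_superexp:
  assumes d2: "CARD('d::finite) \<ge> 2"
    and tail: "\<And>t. 0 < t \<Longrightarrow> measure D {x. x < - t} \<le> exp (- c * t powr \<nu>)" and "c > 0" "\<nu> > 1"
    and mgf: "mgf_fin (- x0)" "x0 > 0" and "\<delta> > 0"
    and lo: "\<And>c1. c1 < \<mu> \<Longrightarrow> (\<lambda>n. Pr (\<lambda>w :: int ^ 'd \<Rightarrow> real. \<forall>js. pos js = diag n \<longrightarrow>
      walk_sum w 0 js < c1 * (real CARD('d) * real n))) \<longlonglongrightarrow> 0"
  shows "\<forall>\<^sub>F n in sequentially. Pr (\<lambda>w :: int ^ 'd \<Rightarrow> real. \<forall>js. pos js = diag n \<longrightarrow>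
      walk_sum w 0 js < (\<mu> - \<delta>) * (real CARD('d) * real n)) \<le> exp (- K * real n)"
proof -
  interpret Q: prob_space "Q :: (int ^ 'd \<Rightarrow> real) measure" by (rule prob_Q)
  let ?d = "real CARD('d)"
  obtain i0 i1 :: 'd where i01: "i0 \<noteq> i1"
  proof (cases "(UNIV :: 'd set) \<subseteq> {undefined}")
    case True
    hence "CARD('d) \<le> card {undefined :: 'd}" by (intro card_mono) simp
    thus ?thesis using d2 by simp
  next
    case False
    thus ?thesis using that by blast
  qed
  \<comment> \<open>The margin \<open>\<delta>\<close> is spent as follows: half on the slope of the
    strips, a quarter on the two connecting pieces and a quarter on the length that the strip leaves
    uncovered.\<close>
  define \<mu>' where "\<mu>' = \<mu> - \<delta> / 2"
  have "\<mu>' < \<mu> - \<delta> / 4" using \<open>\<delta> > 0\<close> by (simp add: \<mu>'_def)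
  have "\<mu> - \<delta> / 4 < \<mu>" using \<open>\<delta> > 0\<close> by simp
  from box_mgf[OF mgf \<open>\<mu>' < \<mu> - \<delta> / 4\<close> lo[OF this]]
  obtain m s q0 where m: "m \<ge> 1" and s: "s > 0" and q0: "q0 < 1"
    and box: "\<And>u :: int ^ 'd. integrable Q (\<lambda>w. exp (- s * (box_max m u w - \<mu>' * (?d * real m))))"
      "\<And>u :: int ^ 'd. (\<integral>w. exp (- s * (box_max m u w - \<mu>' * (?d * real m))) \<partial>Q) \<le> q0"
    by blast
  define q where "q = max q0 (1/2)"
  have q: "0 < q" "q < 1" "q0 \<le> q" using q0 by (auto simp: q_def)
  define K' where "K' = \<bar>K\<bar>"
  \<comment> \<open>Chosen so that \<open>q ^ (R * J)\<close> is at most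
    \<open>exp (- 2 m (K' + 1) J)\<close>, where \<open>2 J m \<ge> n\<close> for large
    \<open>n\<close>.\<close>
  define R where "R = nat \<lceil>2 * real m * (K' + 1) / (- ln q)\<rceil>"
  have lnq: "ln q < 0" using q by simp
  have "2 * real m * (K' + 1) / (- ln q) \<le> real R" unfolding R_def by linarith
  hence R: "2 * real m * (K' + 1) \<le> real R * (- ln q)" using lnq by (simp add: field_simps)
  \<comment> \<open>\<open>C2\<close> bounds the length of the piece from the origin to the start of
    any strip, \<open>C1\<close> the total length of the two connecting pieces. Neither depends on
    \<open>n\<close>.\<close>
  define C2 where "C2 = R * (2 * m + 1)"
  define C1 where "C1 = C2 + CARD('d) * (C2 + m)"
  define \<eta> where "\<eta> = \<delta> * ?d / (4 * (real C1 + 1))"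
  have \<eta>: "\<eta> > 0" using \<open>\<delta> > 0\<close> by (simp add: \<eta>_def)
  have bad: "\<forall>\<^sub>F n in sequentially. real (R * C1) * exp (- (c * \<eta> powr \<nu>) * real n powr \<nu>) \<le> exp (- K' * real n) / 2"
    by (rule eventually_powr_superexp) (use \<open>c > 0\<close> \<open>\<nu> > 1\<close> \<eta> in auto)
  have big: "\<forall>\<^sub>F n in sequentially. 2 * real (C2 + m) + 2 + 4 * \<bar>\<mu>'\<bar> * real (C2 + m) / \<delta> \<le> real n"
    using filterlim_real_sequentially by (simp add: filterlim_at_top)
  show ?thesis using bad big
  proof eventually_elim
    case (elim n)
    have nn: "2 * real (C2 + m) + 2 \<le> real n" "4 * \<bar>\<mu>'\<bar> * real (C2 + m) / \<delta> \<le> real n"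
    proof -
      have "0 \<le> 4 * \<bar>\<mu>'\<bar> * real (C2 + m) / \<delta>" using \<open>\<delta> > 0\<close> by simp
      thus "2 * real (C2 + m) + 2 \<le> real n" "4 * \<bar>\<mu>'\<bar> * real (C2 + m) / \<delta> \<le> real n"
        using elim(2) of_nat_0_le_iff[of "C2 + m"] by linarith+
    qed
    hence n: "n \<ge> 2 * (C2 + m) + 2" by linarith
    \<comment> \<open>The reserve \<open>C2\<close> keeps the end of every strip below
      \<open>(n, ..., n)\<close> in each coordinate, so that a directed connection exists.\<close>
    define J where "J = (n - C2) div m"
    have Jm: "J * m \<le> n - C2" "n - C2 < J * m + m"
      using m div_mult_mod_eq[of "n - C2" m] mod_less_divisor[of m "n - C2"] unfolding J_def by linarith+
    obtain L where L: "L = J * m" by blast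
    obtain t where t: "n = C2 + t" using n le_Suc_ex[of C2 n] by auto
    have t2: "L \<le> t" "t < L + m" using Jm unfolding L[symmetric] t by simp_all
    have nL: "L + C2 \<le> n" "n \<le> L + (C2 + m)" using t2 t by linarith+
    have "2 * C2 + 2 * m \<le> n" using n by simp
    hence nL: "L + C2 \<le> n" "n \<le> L + (C2 + m)" "n \<le> 2 * L" using nL by linarith+
    have hL: "int L + int C2 \<le> int n" "int n - int L \<le> int (C2 + m)"
      using nL(1,2) by linarith+
    have hL': "real n - real L \<le> real (C2 + m)" "0 \<le> real n - real L" "real n \<le> 2 * real L"
      using nL by linarith+
    note hL = hL[unfolded L] hL'[unfolded L]
    define S where "S r = replicate (r * (2 * m + 1)) i0" for r
    define e where "e r = pos (S r) + diag (J * m)" for r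
    have posS: "pos (S r) $ i \<le> int C2" if "r < R" for r i
    proof -
      have "count_list (S r) i \<le> length (S r)" by (rule count_le_length)
      also have "\<dots> \<le> C2" using that by (simp add: S_def C2_def mult_right_mono del: mult_Suc_right)
      finally show ?thesis by (simp add: pos_nth)
    qed
    have "\<exists>ks. pos ks = diag n - e r" if "r < R" for r
    proof (rule steps_to_nonempty)
      fix i
      show "0 \<le> (diag n - e r) $ i" using posS[OF that, of i] hL(1) by (simp add: e_def)
    qed
    then obtain E where E: "\<And>r. r < R \<Longrightarrow> pos (E r) = diag n - e r" by metis
    have lenS: "length (S r) \<le> C2" if "r < R" for r
      using that by (simp add: S_def C2_def mult_right_mono del: mult_Suc_right)
    have lenE: "length (E r) \<le> CARD('d) * (C2 + m)" if "r < R" for r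
    proof -
      have "int (length (E r)) = int (CARD('d) * n) - int (length (S r)) - int (CARD('d) * (J * m))"
        using level_pos[of "E r"] unfolding E[OF that] by (simp add: e_def)
      also have "\<dots> \<le> int (CARD('d) * n) - int (CARD('d) * (J * m))" by simp
      also have "\<dots> = int CARD('d) * (int n - int (J * m))" by (simp add: algebra_simps)
      also have "\<dots> \<le> int CARD('d) * int (C2 + m)" using hL(2) by (intro mult_left_mono) simp_all
      finally show ?thesis by (simp only: of_nat_mult[symmetric] of_nat_le_iff)
    qed
    define V where "V r = (\<lambda>k. pos (take (Suc k) (S r))) ` {..<length (S r)}
        \<union> (\<lambda>k. e r + pos (take (Suc k) (E r))) ` {..<length (E r)}" for r
    have cardV: "card (V r) \<le> C1" if "r < R" for r
    proof -
      have "card (V r) \<le> card {..<length (S r)} + card {..<length (E r)}"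
        unfolding V_def by (rule order_trans[OF card_Un_le]) (intro add_mono card_image_le, auto)
      thus ?thesis using lenS[OF that] lenE[OF that] by (simp add: C1_def)
    qed
    have finV: "finite (V r)" for r by (simp add: V_def)
    define W where "W = (\<Union>r<R. V r)"
    have finW: "finite W" using finV by (simp add: W_def)
    have "card W \<le> (\<Sum>r<R. card (V r))" unfolding W_def by (rule card_UN_le) simp
    also have "\<dots> \<le> (\<Sum>r<R. C1)" by (rule sum_mono) (use cardV in auto)
    finally have cardW: "card W \<le> R * C1" by simp
    define A where "A w \<longleftrightarrow> (\<forall>r<R. (\<Sum>j<J. box_max m (strip_corner i0 m (r, j)) w) < \<mu>' * (?d * real m) * real J)"
      for w :: "int ^ 'd \<Rightarrow> real"
    define B where "B w \<longleftrightarrow> (\<exists>x\<in>W. w x < - (\<eta> * real n))" for w :: "int ^ 'd \<Rightarrow> real"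
    have [measurable]: "Measurable.pred Q A" "Measurable.pred Q B"
      unfolding A_def B_def using finW by measurable
    have AB: "A w \<or> B w" if low: "\<forall>js. pos js = diag n \<longrightarrow> walk_sum w 0 js < (\<mu> - \<delta>) * (?d * real n)" for w
    proof (rule ccontr)
      assume "\<not> (A w \<or> B w)"
      then obtain r where r: "r < R" "\<mu>' * (?d * real m) * real J \<le> (\<Sum>j<J. box_max m (strip_corner i0 m (r, j)) w)"
        and nB: "\<And>x. x \<in> W \<Longrightarrow> - (\<eta> * real n) \<le> w x"
        by (auto simp: A_def B_def not_less)
      obtain js where js: "pos js = diag (J * m)" "walk_sum w (pos (S r)) js = (\<Sum>j<J. box_max m (pos (S r) + diag (j * m)) w)"
        using strip_path by blast
      have mid: "\<mu>' * (?d * real m) * real J \<le> walk_sum w (pos (S r)) js"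
        using r(2) unfolding js(2) by (simp only: strip_corner_def S_def prod.case)
      have "- (\<eta> * real n * real (length (S r))) \<le> walk_sum w 0 (S r)"
      proof (rule walk_sum_ge)
        fix k assume "k < length (S r)"
        hence "pos (take (Suc k) (S r)) \<in> V r" unfolding V_def by blast
        hence "pos (take (Suc k) (S r)) \<in> W" using r(1) unfolding W_def by blast
        from nB[OF this] show "- (\<eta> * real n) \<le> w (0 + pos (take (Suc k) (S r)))" by simp
      qed
      moreover have "- (\<eta> * real n * real (length (E r))) \<le> walk_sum w (e r) (E r)"
      proof (rule walk_sum_ge)
        fix k assume "k < length (E r)"
        hence "e r + pos (take (Suc k) (E r)) \<in> V r" unfolding V_def by blast
        hence "e r + pos (take (Suc k) (E r)) \<in> W" using r(1) unfolding W_def by blast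
        from nB[OF this] show "- (\<eta> * real n) \<le> w (e r + pos (take (Suc k) (E r)))" by simp
      qed
      moreover have "pos (S r @ js @ E r) = diag n" using E[OF r(1)] js(1) by (simp add: e_def)
      hence "walk_sum w 0 (S r @ js @ E r) < (\<mu> - \<delta>) * (?d * real n)" using low by blast
      moreover have "walk_sum w 0 (S r @ js @ E r) = walk_sum w 0 (S r) + walk_sum w (pos (S r)) js + walk_sum w (e r) (E r)"
        using js(1) by (simp add: walk_sum_append e_def add.assoc)
      ultimately have lt: "\<mu>' * (?d * real m) * real J - \<eta> * real n * (real (length (S r)) + real (length (E r)))
          < (\<mu> - \<delta>) * (?d * real n)"
        using mid by (simp add: algebra_simps)
      have "\<eta> * real n * (real (length (S r)) + real (length (E r))) \<le> \<eta> * real n * real C1"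
        using lenS[OF r(1)] lenE[OF r(1)] \<eta> unfolding C1_def
        by (intro mult_left_mono) (simp_all only: of_nat_add[symmetric] of_nat_le_iff add_mono, auto)
      also have "\<dots> \<le> \<eta> * real n * (real C1 + 1)" using \<eta> by (intro mult_left_mono) auto
      also have "\<dots> = \<delta> / 4 * (?d * real n)" by (simp add: \<eta>_def field_simps)
      finally have conn: "\<eta> * real n * (real (length (S r)) + real (length (E r))) \<le> \<delta> / 4 * (?d * real n)" .
      have "\<bar>\<mu>'\<bar> * ?d * (real n - real (J * m)) \<le> \<bar>\<mu>'\<bar> * ?d * real (C2 + m)" using hL(3) by (intro mult_left_mono) auto
      also have "\<dots> \<le> \<delta> / 4 * (?d * real n)"
      proof -
        have "\<bar>\<mu>'\<bar> * real (C2 + m) \<le> \<delta> / 4 * real n" using nn(2) \<open>\<delta> > 0\<close> by (simp add: field_simps)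
        hence "?d * (\<bar>\<mu>'\<bar> * real (C2 + m)) \<le> ?d * (\<delta> / 4 * real n)" by (rule mult_left_mono) simp
        thus ?thesis by (simp add: mult_ac)
      qed
      finally have "\<bar>\<mu>'\<bar> * ?d * (real n - real (J * m)) \<le> \<delta> / 4 * (?d * real n)" .
      moreover have "\<mu>' * ?d * (real n - real (J * m)) \<le> \<bar>\<mu>'\<bar> * ?d * (real n - real (J * m))"
        using hL(4) by (intro mult_right_mono) auto
      ultimately have "\<mu>' * (?d * real m) * real J \<ge> \<mu>' * (?d * real n) - \<delta> / 4 * (?d * real n)"
        by (simp add: algebra_simps)
      thus False using lt conn by (simp add: \<mu>'_def algebra_simps)
    qed
    have "Pr (\<lambda>w :: int ^ 'd \<Rightarrow> real. \<forall>js. pos js = diag n \<longrightarrow> walk_sum w 0 js < (\<mu> - \<delta>) * (?d * real n))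
        \<le> Pr (\<lambda>w. A w \<or> B w)"
      by (rule Pr_mono[OF AB]) measurable
    also have "\<dots> \<le> Pr A + Pr B"
    proof -
      have "Pr (\<lambda>w. A w \<or> B w) = measure Q (Collect A \<union> Collect B)" by (simp add: Collect_disj_eq)
      also have "\<dots> \<le> Pr A + Pr B" by (rule measure_Un_le) (auto intro: sets_Q_Collect)
      finally show ?thesis .
    qed
    also have "Pr A \<le> exp (- K' * real n) / 2"
    proof -
      have "Pr A \<le> q ^ (R * J)"
        unfolding A_def by (rule strips_bound[OF i01 s box(1) order_trans[OF box(2) q(3)]])
      also have "\<dots> = exp (- (real R * (- ln q)) * real J)"
        using q by (simp add: exp_of_nat_mult[symmetric] powr_realpow[symmetric] powr_def mult_ac)
      also have "\<dots> \<le> exp (- (2 * real m * (K' + 1)) * real J)"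
        using mult_right_mono[OF R, of "real J"] by simp
      also have "\<dots> \<le> exp (- (K' + 1) * real n)"
      proof -
        from hL(5) have "(K' + 1) * real n \<le> (K' + 1) * (2 * real (J * m))" by (rule mult_left_mono) (simp add: K'_def)
        hence "- (2 * real m * (K' + 1)) * real J \<le> - (K' + 1) * real n" by (simp add: algebra_simps)
        thus ?thesis by simp
      qed
      also have "\<dots> = exp (- K' * real n) * exp (- real n)" by (simp add: exp_add[symmetric] algebra_simps)
      also have "\<dots> \<le> exp (- K' * real n) * (1 / 2)"
      proof (rule mult_left_mono)
        have "2 \<le> exp (real n)" using exp_ge_add_one_self[of "real n"] n by linarith
        thus "exp (- real n) \<le> 1 / 2" by (simp add: exp_minus field_simps)
      qed simp
      finally show ?thesis by simp
    qed
    also have "Pr B \<le> exp (- K' * real n) / 2"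
    proof -
      have "Pr B = measure Q (\<Union>x\<in>W. {w. w x < - (\<eta> * real n)})"
        by (rule arg_cong[where f = "measure Q"]) (auto simp: B_def)
      also have "\<dots> \<le> (\<Sum>x\<in>W. Pr (\<lambda>w. w x < - (\<eta> * real n)))"
      proof (rule Q.finite_measure_subadditive_finite[OF finW])
        have "Measurable.pred Q (\<lambda>w. w x < - (\<eta> * real n))" for x :: "int ^ 'd" by measurable
        thus "(\<lambda>x. {w. w x < - (\<eta> * real n)}) ` W \<subseteq> sets Q" by (auto intro: sets_Q_Collect)
      qed
      also have "\<dots> \<le> (\<Sum>x\<in>W. exp (- (c * \<eta> powr \<nu>) * real n powr \<nu>))"
      proof (rule sum_mono)
        fix x :: "int ^ 'd"
        have "0 < \<eta> * real n" using \<eta> n by simp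
        have "Pr (\<lambda>w. w x < - (\<eta> * real n)) = measure D {y. y < - (\<eta> * real n)}" by (rule Pr_coord) measurable
        also have "\<dots> \<le> exp (- c * (\<eta> * real n) powr \<nu>)" by (rule tail) fact
        also have "\<dots> = exp (- (c * \<eta> powr \<nu>) * real n powr \<nu>)" using \<eta> by (simp add: powr_mult)
        finally show "Pr (\<lambda>w. w x < - (\<eta> * real n)) \<le> exp (- (c * \<eta> powr \<nu>) * real n powr \<nu>)" .
      qed
      also have "\<dots> = real (card W) * exp (- (c * \<eta> powr \<nu>) * real n powr \<nu>)" by simp
      also have "\<dots> \<le> real (R * C1) * exp (- (c * \<eta> powr \<nu>) * real n powr \<nu>)"
        using cardW by (intro mult_right_mono) (simp_all only: of_nat_le_iff, simp)
      also note elim(1)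
      finally show ?thesis .
    qed
    also have "exp (- K' * real n) / 2 + exp (- K' * real n) / 2 \<le> exp (- K * real n)"
      by (simp add: K'_def mult_right_mono)
    finally show ?case by simp
  qed
qed

end

section \<open>Weights along the corner path\<close>

text \<open>Here \<open>x l\<close> is the weight of the \<open>l\<close>-th vertex of the corner path, whose corners are at
  \<open>l = i n\<close>. The conditions at the corners decouple because each of them is increasing in \<open>x\<close>.\<close>

definition good_line :: "real \<Rightarrow> nat \<Rightarrow> nat \<Rightarrow> (nat \<Rightarrow> real) \<Rightarrow> bool" where
  "good_line \<rho> d n x \<longleftrightarrow> (\<forall>i\<in>{1..<d}.
     (\<forall>a\<le>i * n. 0 \<le> (\<Sum>j<a. x (i * n - j) - \<rho>)) \<and>
     (\<forall>b\<le>d * n - i * n. 0 \<le> (\<Sum>j<b. x (i * n + 1 + j) - \<rho>)))"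

context iid_weights
begin

lemma prod_exp_integral:
  assumes "mgf_fin t" "finite K"
  shows "integrable Q (\<lambda>w. exp (t * (\<Sum>x\<in>K. w x)))" "(\<integral>w. exp (t * (\<Sum>x\<in>K. w x)) \<partial>Q) = mgf t ^ card K"
proof -
  have eq: "exp (t * (\<Sum>x\<in>K. w x)) = (\<Prod>x\<in>K. exp (t * w x))" for w
    using assms(2) by (simp add: exp_sum sum_distrib_left)
  have disj: "disjoint_family_on (\<lambda>x. {x}) K" by (auto simp: disjoint_family_on_def)
  have dep: "depends_on {x} (\<lambda>w. exp (t * w x))" for x by (rule depends_onI) simp
  note prod = expectation_prod[OF assms(2) disj dep mgf_fin_coord[OF assms(1)]]
  show "integrable Q (\<lambda>w. exp (t * (\<Sum>x\<in>K. w x)))" unfolding eq by (rule prod(1))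
  show "(\<integral>w. exp (t * (\<Sum>x\<in>K. w x)) \<partial>Q) = mgf t ^ card K" unfolding eq prod(2) mgf_coord by simp
qed

text \<open>The sign of \<open>t\<close> is left open: negative \<open>t\<close> gives lower tails,
  positive \<open>t\<close> upper tails. The constant \<open>r\<close> stands for
  \<open>exp (- t * a)\<close>.\<close>

lemma Pr_sum_less:
  assumes "mgf_fin t" "finite K" "t * a = - ln r" "0 < r" "\<And>y. y \<in> A \<Longrightarrow> t * a * real (card K) \<le> t * y"
    and [measurable]: "Measurable.pred borel (\<lambda>y. y \<in> A)"
  shows "Pr (\<lambda>w. (\<Sum>x\<in>K. w x) \<in> A) \<le> (r * mgf t) ^ card K"
proof -
  have "Pr (\<lambda>w. (\<Sum>x\<in>K. w x) \<in> A) \<le> (\<integral>w. r ^ card K * exp (t * (\<Sum>x\<in>K. w x)) \<partial>Q)"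
  proof (rule Markov_exp)
    show "integrable Q (\<lambda>w. r ^ card K * exp (t * (\<Sum>x\<in>K. w x)))"
      using prod_exp_integral[OF assms(1,2)] by simp
    show "0 \<le> r ^ card K * exp (t * (\<Sum>x\<in>K. w x))" for w using assms(4) by simp
    fix w assume "(\<Sum>x\<in>K. w x) \<in> A"
    hence "- ln r * real (card K) \<le> t * (\<Sum>x\<in>K. w x)" using assms(3,5) by simp
    hence "1 \<le> exp (ln r * real (card K) + t * (\<Sum>x\<in>K. w x))" by simp
    also have "\<dots> = r ^ card K * exp (t * (\<Sum>x\<in>K. w x))"
      using assms(4) by (simp add: exp_add exp_of_nat2_mult)
    finally show "1 \<le> r ^ card K * exp (t * (\<Sum>x\<in>K. w x))" .
  qed measurable
  also have "\<dots> = (r * mgf t) ^ card K"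
    using prod_exp_integral[OF assms(1,2)] by (simp add: power_mult_distrib)
  finally show ?thesis .
qed

text \<open>The hypothesis is a Chernoff condition saying that the walk with steps
  \<open>w - \<rho>\<close> drifts upwards. Its sum is negative at time \<open>k\<close> with
  probability at most \<open>r ^ k\<close>, so from some \<open>k0\<close> on these events cost at
  most 1/2 in total; before \<open>k0\<close> all steps are forced to be nonnegative. Both
  requirements are increasing, and Harris combines them with a bound free of the length
  \<open>b\<close>.\<close>

lemma ex_positive_walk_bound:
  assumes s: "s > 0" "mgf_fin (- s)" "exp (s * \<rho>) * mgf (- s) < 1"
  shows "\<exists>p>0. p \<le> 1 \<and> (\<forall>(\<sigma> :: nat \<Rightarrow> 'i) b. inj_on \<sigma> {..<b} \<longrightarrow>
    p \<le> Pr (\<lambda>w. \<forall>k\<le>b. 0 \<le> (\<Sum>j<k. w (\<sigma> j) - \<rho>)))"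
proof -
  interpret D: prob_space D by (rule prob_D)
  interpret Q: prob_space "Q :: ('i \<Rightarrow> real) measure" by (rule prob_Q)
  define r where "r = exp (s * \<rho>) * mgf (- s)"
  have r: "0 < r" "r < 1" using s mgf_pos[OF s(2)] by (simp_all add: r_def)
  define p0 where "p0 = measure D {x. \<rho> \<le> x}"
  \<comment> \<open>Weights almost surely below \<open>\<rho>\<close> would force
    \<open>r \<ge> 1\<close>.\<close>
  have p0: "p0 > 0"
  proof (rule ccontr)
    assume "\<not> p0 > 0"
    hence "D.prob {x. \<rho> \<le> x} = 0" using measure_nonneg[of D "{x. \<rho> \<le> x}"] unfolding p0_def by linarith
    hence "AE x in D. x \<notin> {x. \<rho> \<le> x}" using D.prob_eq_0[of "{x. \<rho> \<le> x}"] sets_D by simp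
    hence "AE x in D. exp (- s * \<rho>) \<le> exp (- s * x)"
      by eventually_elim (use s in auto)
    hence "(\<integral>x. exp (- s * \<rho>) \<partial>D) \<le> (\<integral>x. exp (- s * x) \<partial>D)"
      by (intro integral_mono_AE) (use s in \<open>auto simp: mgf_fin_def\<close>)
    hence "exp (- s * \<rho>) \<le> mgf (- s)" by (simp add: mgf_def D.prob_space)
    hence "exp (s * \<rho>) * exp (- s * \<rho>) \<le> r" unfolding r_def by (intro mult_left_mono) auto
    thus False using r by (simp add: exp_add[symmetric])
  qed
  \<comment> \<open>Makes the geometric tail \<open>r ^ k0 / (1 - r)\<close> at most 1/2.\<close>
  obtain k0 where k0: "r ^ k0 < (1 - r) / 2"
    using real_arch_pow_inv[of "(1 - r) / 2" r] r by auto
  have "p0 ^ k0 / 2 \<le> Pr (\<lambda>w. \<forall>k\<le>b. 0 \<le> (\<Sum>j<k. w (\<sigma> j) - \<rho>))" if inj: "inj_on \<sigma> {..<b}" for \<sigma> :: "nat \<Rightarrow> 'i" and b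
  proof -
    define S where "S k w = (\<Sum>j<k. w (\<sigma> j) - \<rho>)" for k and w :: "'i \<Rightarrow> real"
    have [measurable]: "S k \<in> borel_measurable Q" for k unfolding S_def by measurable
    have dS: "depends_on (\<sigma> ` {..<b}) (S k)" if "k \<le> b" for k
    proof (rule depends_onI)
      fix v w :: "'i \<Rightarrow> real" assume *: "\<And>x. x \<in> \<sigma> ` {..<b} \<Longrightarrow> v x = w x"
      show "S k v = S k w" unfolding S_def by (rule sum.cong) (use * that in auto)
    qed
    have mS: "S k v \<le> S k w" if "v \<le> w" for k v w
      unfolding S_def by (rule sum_mono) (use that in \<open>auto simp: le_fun_def\<close>)
    have step: "Pr (\<lambda>w. S k w < 0) \<le> r ^ k" if "k \<le> b" for k
    proof -
      have inj': "inj_on \<sigma> {..<k}" using inj that by (rule_tac inj_on_subset) auto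
      have "(S k w < 0) = ((\<Sum>x\<in>\<sigma> ` {..<k}. w x) \<in> {..<\<rho> * real k})" for w
        using sum.reindex[OF inj', of w] by (simp add: S_def sum_subtractf mult.commute)
      hence "Pr (\<lambda>w. S k w < 0) = Pr (\<lambda>w. (\<Sum>x\<in>\<sigma> ` {..<k}. w x) \<in> {..<\<rho> * real k})" by simp
      also have "\<dots> \<le> (exp (s * \<rho>) * mgf (- s)) ^ card (\<sigma> ` {..<k})"
        by (rule Pr_sum_less[OF s(2), where a = \<rho>]) (use s card_image[OF inj'] in auto)
      finally show ?thesis using card_image[OF inj'] by (simp add: r_def)
    qed
    define A where "A w \<longleftrightarrow> (\<forall>j\<in>{..<min k0 b}. \<rho> \<le> w (\<sigma> j))" for w :: "'i \<Rightarrow> real"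
    define B where "B w \<longleftrightarrow> (\<forall>k\<in>{k0..b}. 0 \<le> S k w)" for w
    have [measurable]: "Measurable.pred Q A" "Measurable.pred Q B" unfolding A_def B_def by measurable
    have "p0 ^ k0 \<le> p0 ^ card {..<min k0 b}"
      by (rule power_decreasing) (use p0 in \<open>auto simp: p0_def\<close>)
    also have "\<dots> \<le> Pr (\<lambda>w. \<forall>j\<in>{..<min k0 b}. \<rho> \<le> w (\<sigma> j))"
    proof (rule Harris_Ball[where r = "(\<le>)" and J = "\<sigma> ` {..<b}"])
      fix j assume j: "j \<in> {..<min k0 b}"
      show "depends_on (\<sigma> ` {..<b}) (\<lambda>w. \<rho> \<le> w (\<sigma> j))" by (rule depends_onI) (use j in auto)
      show "\<rho> \<le> w (\<sigma> j)" if "v \<le> w" "\<rho> \<le> v (\<sigma> j)" for v w :: "'i \<Rightarrow> real"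
        using that by (auto simp: le_fun_def intro: order_trans)
      have "Pr (\<lambda>w. \<rho> \<le> w (\<sigma> j)) = p0" unfolding p0_def by (rule Pr_coord) measurable
      thus "p0 \<le> Pr (\<lambda>w. \<rho> \<le> w (\<sigma> j))" by simp
    qed (use p0 in auto)
    finally have PA: "p0 ^ k0 \<le> Pr A" by (simp add: A_def[abs_def])
    have "1 - Pr B = Pr (\<lambda>w. \<not> B w)"
      using Q.prob_compl[OF sets_Q_Collect[of B]] by (simp add: Compl_eq_Diff_UNIV[symmetric] Collect_neg_eq)
    also have "\<dots> \<le> measure Q (\<Union>k\<in>{k0..b}. {w. S k w < 0})"
    proof (rule Q.finite_measure_mono)
      have "Measurable.pred Q (\<lambda>w. S k w < 0)" for k by measurable
      thus "(\<Union>k\<in>{k0..b}. {w. S k w < 0}) \<in> sets Q" by (intro sets.finite_UN sets_Q_Collect) auto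
    qed (auto simp: B_def not_le)
    also have "\<dots> \<le> (\<Sum>k\<in>{k0..b}. Pr (\<lambda>w. S k w < 0))"
    proof (rule Q.finite_measure_subadditive_finite)
      have "Measurable.pred Q (\<lambda>w. S k w < 0)" for k by measurable
      thus "(\<lambda>k. {w. S k w < 0}) ` {k0..b} \<subseteq> sets Q" by (auto intro: sets_Q_Collect)
    qed simp
    also have "\<dots> \<le> (\<Sum>k\<in>{k0..b}. r ^ k)" by (rule sum_mono) (use step in auto)
    also have "\<dots> \<le> r ^ k0 / (1 - r)"
    proof (cases "k0 \<le> b")
      case True
      have "(1 - r) * (\<Sum>k\<in>{k0..b}. r ^ k) = r ^ k0 - r ^ Suc b" by (rule sum_gp_multiplied[OF True])
      also have "\<dots> \<le> r ^ k0" using r by simp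
      finally show ?thesis using r by (simp add: pos_le_divide_eq mult.commute)
    next
      case False
      thus ?thesis using r by simp
    qed
    also have "\<dots> \<le> 1 / 2" using k0 r by (simp add: field_simps)
    finally have PB: "1 / 2 \<le> Pr B" by simp
    have "p0 ^ k0 / 2 = p0 ^ k0 * (1 / 2)" by simp
    also have "\<dots> \<le> Pr A * Pr B" using PA PB p0 by (intro mult_mono) auto
    also have "\<dots> \<le> Pr (\<lambda>w. A w \<and> B w)"
    proof (rule Harris_conj[where r = "(\<le>)" and J = "\<sigma> ` {..<b}"])
      show "depends_on (\<sigma> ` {..<b}) A"
      proof (rule depends_onI)
        fix v w :: "'i \<Rightarrow> real" assume *: "\<And>x. x \<in> \<sigma> ` {..<b} \<Longrightarrow> v x = w x"
        have "v (\<sigma> j) = w (\<sigma> j)" if "j \<in> {..<min k0 b}" for j using that by (intro *) auto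
        thus "A v = A w" by (simp add: A_def)
      qed
      show "depends_on (\<sigma> ` {..<b}) B"
      proof (rule depends_onI)
        fix v w :: "'i \<Rightarrow> real" assume *: "\<And>x. x \<in> \<sigma> ` {..<b} \<Longrightarrow> v x = w x"
        have "S k v = S k w" if "k \<in> {k0..b}" for k
          by (rule depends_onD[OF dS]) (use that * in auto)
        thus "B v = B w" by (simp add: B_def)
      qed
      show "A w" if "v \<le> w" "A v" for v w
        using that by (auto simp: A_def le_fun_def intro: order_trans)
      show "B w" if "v \<le> w" "B v" for v w
        using that(2) mS[OF that(1)] by (auto simp: B_def intro: order_trans)
    qed auto
    also have "\<dots> \<le> Pr (\<lambda>w. \<forall>k\<le>b. 0 \<le> S k w)"
    proof (rule Pr_mono)
      fix w assume AB: "A w \<and> B w"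
      show "\<forall>k\<le>b. 0 \<le> S k w"
      proof (intro allI impI)
        fix k assume k: "k \<le> b"
        show "0 \<le> S k w"
        proof (cases "k0 \<le> k")
          case True thus ?thesis using AB k by (auto simp: B_def)
        next
          case False
          thus ?thesis unfolding S_def using AB k by (intro sum_nonneg) (auto simp: A_def)
        qed
      qed
    qed measurable
    finally show ?thesis by (simp add: S_def)
  qed
  moreover have "p0 ^ k0 / 2 > 0" using p0 by simp
  moreover have "p0 ^ k0 / 2 \<le> 1"
  proof -
    have "p0 ^ k0 \<le> 1" using p0 by (intro power_le_one) (auto simp: p0_def)
    thus ?thesis by simp
  qed
  ultimately show ?thesis by blast
qed

lemma pred_good_line [measurable]: "Measurable.pred Q (good_line \<rho> d n)"
  unfolding good_line_def by measurable

text \<open>The one-sided conditions at the corners are increasing in \<open>x\<close>, so Harris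
  bounds their intersection below by a constant. The cap on the total weight is decreasing and
  cannot be included this way; its failure has probability tending to 0 and is subtracted.\<close>

lemma good_line_prob:
  assumes s: "s > 0" "mgf_fin (- s)" "exp (s * \<rho>) * mgf (- s) < 1"
    and s': "s' > 0" "mgf_fin s'" "exp (- s' * M) * mgf s' < 1" and "d \<ge> 1"
  shows "\<exists>p>0. \<forall>\<^sub>F n in sequentially.
    p \<le> Pr (\<lambda>x. good_line \<rho> d n x \<and> (\<Sum>l\<le>d * n. x l) \<le> M * real (d * n + 1))"
proof -
  interpret Q: prob_space "Q :: (nat \<Rightarrow> real) measure" by (rule prob_Q)
  obtain p where p: "p > 0" "p \<le> 1" and walk: "\<And>(\<sigma> :: nat \<Rightarrow> nat) b. inj_on \<sigma> {..<b} \<Longrightarrow>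
    p \<le> Pr (\<lambda>w. \<forall>k\<le>b. 0 \<le> (\<Sum>j<k. w (\<sigma> j) - \<rho>))"
    using ex_positive_walk_bound[OF s, where 'i = nat] by blast
  define r where "r = exp (- s' * M) * mgf s'"
  have r: "0 < r" "r < 1" using s' mgf_pos[OF s'(2)] by (simp_all add: r_def)
  define p1 where "p1 = p ^ (2 * d)"
  have p1: "p1 > 0" using p by (simp add: p1_def)
  have "(\<lambda>n. r ^ n) \<longlonglongrightarrow> 0" using r by (intro LIMSEQ_power_zero) auto
  hence "\<forall>\<^sub>F n in sequentially. r ^ n < p1 / 2" using p1 by (intro order_tendstoD(2)) auto
  then have "\<forall>\<^sub>F n in sequentially.
    p1 / 2 \<le> Pr (\<lambda>x. good_line \<rho> d n x \<and> (\<Sum>l\<le>d * n. x l) \<le> M * real (d * n + 1))"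
  proof eventually_elim
    case (elim n)
    \<comment> \<open>A pair encodes one side of the corner at \<open>i * n\<close>:
      \<open>True\<close> reads the weights after it, \<open>False\<close> those up to and including
      it, backwards.\<close>
    define b where "b e = (if snd e then d * n - fst e * n else fst e * n)" for e :: "nat \<times> bool"
    define \<sigma> where "\<sigma> e j = (if snd e then fst e * n + 1 + j else fst e * n - j)" for e :: "nat \<times> bool" and j :: nat
    define L where "L = {1..<d} \<times> (UNIV :: bool set)"
    have \<sigma>: "inj_on (\<sigma> e) {..<b e}" "\<sigma> e ` {..<b e} \<subseteq> {..d * n}" if "e \<in> L" for e
    proof -
      have le: "fst e * n \<le> d * n" using that by (intro mult_right_mono) (auto simp: L_def)
      have "fst e * n - j \<le> d * n" for j using le by (rule order_trans[OF diff_le_self])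
      thus "\<sigma> e ` {..<b e} \<subseteq> {..d * n}" by (auto simp: \<sigma>_def b_def)
      show "inj_on (\<sigma> e) {..<b e}" by (auto simp: \<sigma>_def b_def inj_on_def)
    qed
    have good: "good_line \<rho> d n x \<longleftrightarrow> (\<forall>e\<in>L. \<forall>k\<le>b e. 0 \<le> (\<Sum>j<k. x (\<sigma> e j) - \<rho>))" for x
      by (auto simp: good_line_def L_def b_def \<sigma>_def all_bool_eq)
    have "p1 \<le> p ^ card L" unfolding p1_def
      using p by (intro power_decreasing) (auto simp: L_def card_cartesian_product)
    also have "\<dots> \<le> Pr (\<lambda>x. \<forall>e\<in>L. \<forall>k\<le>b e. 0 \<le> (\<Sum>j<k. x (\<sigma> e j) - \<rho>))"
    proof (rule Harris_Ball[where r = "(\<le>)" and J = "{..d * n}"])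
      fix e assume e: "e \<in> L"
      show "p \<le> Pr (\<lambda>x. \<forall>k\<le>b e. 0 \<le> (\<Sum>j<k. x (\<sigma> e j) - \<rho>))" by (rule walk[OF \<sigma>(1)[OF e]])
      show "depends_on {..d * n} (\<lambda>x. \<forall>k\<le>b e. 0 \<le> (\<Sum>j<k. x (\<sigma> e j) - \<rho>))"
      proof (rule depends_onI)
        fix v w :: "nat \<Rightarrow> real" assume *: "\<And>x. x \<in> {..d * n} \<Longrightarrow> v x = w x"
        have "(\<Sum>j<k. v (\<sigma> e j) - \<rho>) = (\<Sum>j<k. w (\<sigma> e j) - \<rho>)" if k: "k \<le> b e" for k
        proof (rule sum.cong)
          fix j assume "j \<in> {..<k}"
          hence "j \<in> {..<b e}" using k by simp
          hence "\<sigma> e j \<in> {..d * n}" using \<sigma>(2)[OF e] by blast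
          from *[OF this] show "v (\<sigma> e j) - \<rho> = w (\<sigma> e j) - \<rho>" by simp
        qed simp
        thus "(\<forall>k\<le>b e. 0 \<le> (\<Sum>j<k. v (\<sigma> e j) - \<rho>)) = (\<forall>k\<le>b e. 0 \<le> (\<Sum>j<k. w (\<sigma> e j) - \<rho>))" by simp
      qed
      show "Measurable.pred Q (\<lambda>x. \<forall>k\<le>b e. 0 \<le> (\<Sum>j<k. x (\<sigma> e j) - \<rho>))" by measurable
      show "\<forall>k\<le>b e. 0 \<le> (\<Sum>j<k. w (\<sigma> e j) - \<rho>)"
        if le: "v \<le> w" and v: "\<forall>k\<le>b e. 0 \<le> (\<Sum>j<k. v (\<sigma> e j) - \<rho>)" for v w :: "nat \<Rightarrow> real"
      proof (intro allI impI)
        fix k assume "k \<le> b e"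
        hence "0 \<le> (\<Sum>j<k. v (\<sigma> e j) - \<rho>)" using v by blast
        also have "\<dots> \<le> (\<Sum>j<k. w (\<sigma> e j) - \<rho>)" using le by (intro sum_mono) (auto simp: le_fun_def)
        finally show "0 \<le> (\<Sum>j<k. w (\<sigma> e j) - \<rho>)" .
      qed
    qed (use p in \<open>auto simp: L_def\<close>)
    finally have P1: "p1 \<le> Pr (good_line \<rho> d n)" by (simp add: good[abs_def])
    have "Pr (\<lambda>x. (\<Sum>l\<in>{..d * n}. x l) \<in> {M * real (d * n + 1)<..}) \<le> (exp (- s' * M) * mgf s') ^ card {..d * n}"
      by (rule Pr_sum_less[OF s'(2), where a = M]) (use s' in \<open>auto simp: mult.assoc\<close>)
    also have "\<dots> = r ^ (d * n + 1)" by (simp add: r_def)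
    also have "\<dots> \<le> r ^ n"
    proof (rule power_decreasing)
      show "n \<le> d * n + 1" using \<open>d \<ge> 1\<close> by (metis le_add1 mult_le_mono1 mult_1 order_trans)
    qed (use r in auto)
    finally have P2: "Pr (\<lambda>x. (\<Sum>l\<in>{..d * n}. x l) \<in> {M * real (d * n + 1)<..}) \<le> p1 / 2" using elim by simp
    have [measurable]: "Measurable.pred Q (good_line \<rho> d n)" by (rule pred_good_line)
    let ?C = "\<lambda>x :: nat \<Rightarrow> real. (\<Sum>l\<in>{..d * n}. x l) \<in> {M * real (d * n + 1)<..}"
    let ?E = "\<lambda>x. good_line \<rho> d n x \<and> (\<Sum>l\<le>d * n. x l) \<le> M * real (d * n + 1)"
    have [measurable]: "Measurable.pred Q ?C" "Measurable.pred Q ?E" by measurable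
    have "Pr (good_line \<rho> d n) \<le> Pr (\<lambda>x. ?E x \<or> ?C x)"
      by (rule Pr_mono) auto
    also have "\<dots> = measure Q (Collect ?E \<union> Collect ?C)" by (rule arg_cong[where f = "measure Q"]) auto
    also have "\<dots> \<le> Pr ?E + Pr ?C" by (rule measure_Un_le) (rule sets_Q_Collect, measurable)+
    finally show ?case using P1 P2 by linarith
  qed
  thus ?thesis using p1 by (intro exI[of _ "p1 / 2"]) auto
qed

text \<open>Tilting merely shifts the argument of the moment generating function, so Chernoff
  conditions for the tilted law can be stated through the original \<open>mgf\<close>.\<close>

lemma tilted_weights:
  assumes "mgf_fin t"
  defines "D' \<equiv> density D (\<lambda>x. ennreal (exp (t * x) / mgf t))"
  shows "iid_weights D'"
    and "mgf_fin (t + u) \<Longrightarrow> iid_weights.mgf_fin D' u"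
    and "mgf_fin (t + u) \<Longrightarrow> iid_weights.mgf D' u = mgf (t + u) / mgf t"
proof -
  interpret D: prob_space D by (rule prob_D)
  have m: "(\<lambda>x. exp (t * x) / mgf t) \<in> borel_measurable D" by (rule borel_measurable_D) simp
  have pos: "mgf t > 0" by (rule mgf_pos[OF assms(1)])
  have "(\<integral>\<^sup>+x. ennreal (exp (t * x) / mgf t) \<partial>D) = ennreal (\<integral>x. exp (t * x) / mgf t \<partial>D)"
    by (rule nn_integral_eq_integral) (use assms(1) pos in \<open>auto simp: mgf_fin_def\<close>)
  also have "(\<integral>x. exp (t * x) / mgf t \<partial>D) = 1" using pos by (simp add: mgf_def)
  finally have "prob_space D'"
    unfolding D'_def using m by (intro prob_spaceI) (simp add: emeasure_density space_D)
  moreover have "sets D' = sets borel" by (simp add: D'_def sets_D)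
  ultimately show I: "iid_weights D'" by (rule iid_weights.intro)
  have eq: "exp (t * x) / mgf t * exp (u * x) = exp ((t + u) * x) / mgf t" for u x :: real
    by (simp add: exp_add[symmetric] algebra_simps)
  have mu: "(\<lambda>x. exp (u * x)) \<in> borel_measurable D" for u by (rule borel_measurable_D) simp
  assume u: "mgf_fin (t + u)"
  show "iid_weights.mgf_fin D' u"
    unfolding iid_weights.mgf_fin_def[OF I] unfolding D'_def
    using pos u integrable_density[OF mu m, of u] by (simp add: eq mgf_fin_def del: times_divide_eq_left)
  show "iid_weights.mgf D' u = mgf (t + u) / mgf t"
    unfolding iid_weights.mgf_def[OF I] unfolding D'_def
    using pos integral_density[OF mu m, of u] by (simp add: eq mgf_def[of "t + u"] del: times_divide_eq_left)
qed

lemma good_line_depends_on: "depends_on {..d * n} (good_line \<rho> d n)"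
proof (rule depends_onI)
  fix v w :: "nat \<Rightarrow> real" assume *: "\<And>x. x \<in> {..d * n} \<Longrightarrow> v x = w x"
  have "(\<Sum>j<a. v (i * n - j) - \<rho>) = (\<Sum>j<a. w (i * n - j) - \<rho>)" if "i \<in> {1..<d}" for i a
  proof (rule sum.cong)
    fix j
    have "i * n \<le> d * n" using that by (intro mult_right_mono) auto
    hence "i * n - j \<le> d * n" by (rule order_trans[OF diff_le_self])
    thus "v (i * n - j) - \<rho> = w (i * n - j) - \<rho>" by (subst *) auto
  qed simp
  moreover have "(\<Sum>j<b. v (i * n + 1 + j) - \<rho>) = (\<Sum>j<b. w (i * n + 1 + j) - \<rho>)"
    if "i \<in> {1..<d}" "b \<le> d * n - i * n" for i b
  proof (rule sum.cong)
    fix j assume "j \<in> {..<b}"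
    thus "v (i * n + 1 + j) - \<rho> = w (i * n + 1 + j) - \<rho>" using that by (subst *) auto
  qed simp
  ultimately show "good_line \<rho> d n v = good_line \<rho> d n w"
    unfolding good_line_def by (intro ball_cong refl conj_cong all_cong) auto
qed

text \<open>For the tilted law the conditions with \<open>s\<close> and \<open>s'\<close> are
  Chernoff conditions that place its mean between \<open>\<rho>\<close> and \<open>M\<close>, so the
  good event with capped total weight has probability bounded below. The cap is exactly what limits
  the cost of returning to the original law.\<close>

lemma good_line_lower_bound:
  assumes t: "mgf_fin t" "t \<ge> 0" and s: "s > 0" "mgf_fin (t - s)" "exp (s * \<rho>) * mgf (t - s) < mgf t"
    and s': "s' > 0" "mgf_fin (t + s')" "exp (- s' * M) * mgf (t + s') < mgf t" and "d \<ge> 1"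
  shows "\<exists>p>0. \<forall>\<^sub>F n in sequentially.
    p * (mgf t ^ (d * n + 1) * exp (- (t * (M * real (d * n + 1))))) \<le> Pr (good_line \<rho> d n)"
proof -
  define D' where "D' = density D (\<lambda>x. ennreal (exp (t * x) / mgf t))"
  note tilt = tilted_weights[OF t(1), folded D'_def]
  interpret T: iid_weights D' by (rule tilt(1))
  have pos: "mgf t > 0" by (rule mgf_pos[OF t(1)])
  have "T.mgf_fin (- s)" "T.mgf (- s) = mgf (t - s) / mgf t"
    using tilt(2,3)[of "- s"] s(2) by simp_all
  moreover have "exp (s * \<rho>) * (mgf (t - s) / mgf t) < 1" using s(3) pos by (simp add: field_simps)
  moreover have "T.mgf_fin s'" "T.mgf s' = mgf (t + s') / mgf t" using tilt(2,3)[of s'] s'(2) by simp_all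
  moreover have "exp (- s' * M) * (mgf (t + s') / mgf t) < 1" using s'(3) pos by (simp add: field_simps)
  ultimately obtain p where p: "p > 0" "\<forall>\<^sub>F n in sequentially.
      p \<le> T.Pr (\<lambda>x. good_line \<rho> d n x \<and> (\<Sum>l\<le>d * n. x l) \<le> M * real (d * n + 1))"
    using T.good_line_prob[of s \<rho> s' M d] s(1) s'(1) \<open>d \<ge> 1\<close> by auto
  show ?thesis
  proof (rule exI[of _ p], intro conjI p(1))
    show "\<forall>\<^sub>F n in sequentially.
      p * (mgf t ^ (d * n + 1) * exp (- (t * (M * real (d * n + 1))))) \<le> Pr (good_line \<rho> d n)"
      using p(2)
    proof eventually_elim
      case (elim n)
      let ?E = "\<lambda>x. good_line \<rho> d n x \<and> (\<Sum>l\<le>d * n. x l) \<le> M * real (d * n + 1)"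
      have [measurable]: "Measurable.pred Q (good_line \<rho> d n)" by (rule pred_good_line)
      have mE: "Measurable.pred Q ?E" by measurable
      have "mgf t ^ card {..d * n} * exp (- (t * (M * real (d * n + 1)))) * measure T.Q (Collect ?E) \<le> Pr ?E"
      proof (rule Pr_tilt_ge[OF tilt(1) D'_def _ _ mE _ t(2) pos])
        show "depends_on {..d * n} ?E"
        proof (rule depends_onI)
          fix v w :: "nat \<Rightarrow> real" assume *: "\<And>x. x \<in> {..d * n} \<Longrightarrow> v x = w x"
          have "good_line \<rho> d n v = good_line \<rho> d n w" by (rule depends_onD[OF good_line_depends_on *])
          moreover have "(\<Sum>l\<le>d * n. v l) = (\<Sum>l\<le>d * n. w l)" by (rule sum.cong) (use * in auto)
          ultimately show "?E v = ?E w" by simp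
        qed
      qed auto
      also have "Pr ?E \<le> Pr (good_line \<rho> d n)" by (rule Pr_mono) auto
      finally have "(mgf t ^ (d * n + 1) * exp (- (t * (M * real (d * n + 1))))) * T.Pr ?E \<le> Pr (good_line \<rho> d n)"
        by simp
      moreover have "(mgf t ^ (d * n + 1) * exp (- (t * (M * real (d * n + 1))))) * p
          \<le> (mgf t ^ (d * n + 1) * exp (- (t * (M * real (d * n + 1))))) * T.Pr ?E"
        using elim pos by (intro mult_left_mono) auto
      ultimately show ?case by (simp add: mult.commute)
    qed
  qed
qed

end

section \<open>Excursions from the corner path\<close>

definition corner_steps :: "nat \<Rightarrow> 'd::{finite,linorder} list" where
  "corner_steps n = concat (map (replicate n) (rev (sorted_list_of_set UNIV)))"

lemma corner_path_eq: "corner_path n = path_of_steps (corner_steps n)"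
  by (simp add: corner_path_def corner_steps_def)

lemma length_concat_replicate [simp]: "length (concat (map (replicate n) xs)) = length xs * n"
  by (induction xs) auto

lemma nth_concat_replicate:
  "k < length xs * n \<Longrightarrow> concat (map (replicate n) xs) ! k = xs ! (k div n)"
proof (induction xs arbitrary: k)
  case (Cons x xs)
  show ?case
  proof (cases "k < n")
    case False
    have "n > 0" using Cons.prems by (cases n) auto
    hence "k div n = Suc ((k - n) div n)" using False by (metis le_div_geq not_less)
    thus ?thesis using False Cons by (simp add: nth_append)
  qed (simp add: nth_append)
qed simp

lemma count_concat_replicate: "count_list (concat (map (replicate n) xs)) i = n * count_list xs i"
proof -
  have "count_list (replicate n x) i = (if x = i then n else 0)" for x by (induction n) auto
  thus ?thesis by (induction xs) (auto simp: algebra_simps)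
qed

lemma length_corner_steps [simp]: "length (corner_steps n :: 'd::{finite,linorder} list) = CARD('d) * n"
  by (simp add: corner_steps_def)

lemma pos_corner_steps: "pos (corner_steps n) = diag n"
proof -
  have "count_list (rev (sorted_list_of_set (UNIV :: 'a set))) i = 1" for i
    using distinct_count_atmost_1[of "rev (sorted_list_of_set (UNIV :: 'a set))"] by (simp add: count_mset)
  thus ?thesis unfolding corner_steps_def by (simp add: vec_eq_iff pos_nth count_concat_replicate)
qed

lemma nth_corner_steps:
  fixes k k' :: nat
  assumes "k < CARD('d) * n" "k' < CARD('d) * n" "k div n = k' div n"
  shows "(corner_steps n :: 'd::{finite,linorder} list) ! k = corner_steps n ! k'"
  unfolding corner_steps_def using assms by (subst (1 2) nth_concat_replicate) auto

definition corner_vertex :: "nat \<Rightarrow> nat \<Rightarrow> int ^ 'd::{finite,linorder}" where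
  "corner_vertex n l = pos (take l (corner_steps n))"

lemma level_corner_vertex:
  "l \<le> CARD('d) * n \<Longrightarrow> level (corner_vertex n l :: int ^ 'd::{finite,linorder}) = int l"
  by (simp add: corner_vertex_def min_def)

text \<open>Here \<open>l\<close> is the position of a corner. Both endpoints of an excursion lie on the corner path and
  are left out of the sum, so that this depends only on weights off that path.\<close>

definition off_good ::
    "real \<Rightarrow> nat \<Rightarrow> nat \<Rightarrow> nat \<Rightarrow> nat \<Rightarrow> 'd::{finite,linorder} weights \<Rightarrow> bool" where
  "off_good \<rho> n l a b w \<longleftrightarrow> (\<forall>js. pos js = corner_vertex n (l + b) - corner_vertex n (l - a) \<longrightarrow>
     (\<forall>k\<in>{0<..<a + b}. corner_vertex n (l - a) + pos (take k js) \<notin> corner_vertex n ` {..CARD('d) * n}) \<longrightarrow>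
     (\<Sum>k\<in>{0<..<a + b}. w (corner_vertex n (l - a) + pos (take k js)) - \<rho>) \<le> 0)"

lemma pos_take_add: "pos (take (l + k) js) = pos (take l js) + pos (take k (drop l js))"
  by (simp add: take_add)

text \<open>Between two consecutive corners the corner path is straight, and a displacement along a
  single axis is realised by only one directed path. A path that leaves right after
  \<open>l'\<close> can therefore return only beyond the next corner.\<close>

lemma excursion_straddles_corner:
  fixes ks :: "'d::{finite,linorder} list"
  assumes ks: "pos ks = diag n" and l: "l' < l" "l \<le> CARD('d) * n"
    and eq: "pos (take l' ks) = corner_vertex n l'" "pos (take l ks) = corner_vertex n l"
    and neq: "pos (take (Suc l') ks) \<noteq> corner_vertex n (Suc l')"
  shows "\<exists>i\<in>{1..<CARD('d)}. l' < i * n \<and> i * n < l"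
proof -
  let ?N = "CARD('d) * n" and ?cs = "corner_steps n :: 'd list"
  have len: "length ks = ?N" using level_pos[of ks] unfolding ks level_diag of_nat_eq_iff by simp
  have n: "n > 0" using l by (cases n) auto
  \<comment> \<open>\<open>i * n\<close> is the first corner position strictly after
    \<open>l'\<close>.\<close>
  define i where "i = Suc (l' div n)"
  have i: "l' < i * n" unfolding i_def using n
    by (metis dividend_less_div_times mult_Suc add.commute)
  have "i * n < l"
  proof (rule ccontr)
    assume "\<not> i * n < l"
    hence div: "k div n = l' div n" if "l' \<le> k" "k < l" for k
    proof -
      have "k div n < i" using that \<open>\<not> i * n < l\<close> n by (simp add: div_less_iff_less_mult)
      moreover have "l' div n \<le> k div n" using that by (simp add: div_le_mono)
      ultimately show ?thesis by (simp add: i_def)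
    qed
    define c where "c = ?cs ! l'"
    have cs: "take (l - l') (drop l' ?cs) = replicate (l - l') c"
    proof (rule nth_equalityI)
      fix k assume "k < length (take (l - l') (drop l' ?cs))"
      hence k: "k < l - l'" by simp
      hence "?cs ! (l' + k) = c" unfolding c_def using l by (intro nth_corner_steps div) auto
      thus "take (l - l') (drop l' ?cs) ! k = replicate (l - l') c ! k" using k l by simp
    qed (use l in simp)
    have "pos (take (l - l') (drop l' ks)) = pos (replicate (l - l') c)"
      using pos_take_add[of l' "l - l'" ks] pos_take_add[of l' "l - l'" ?cs] eq l
      by (simp add: corner_vertex_def cs)
    hence "count_list (take (l - l') (drop l' ks)) j = count_list (replicate (l - l') c) j" for j
      by (metis pos_nth of_nat_eq_iff)
    moreover have "count_list (replicate (l - l') c) j = 0" if "j \<noteq> c" for j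
      using that by (simp add: count_list_0_iff)
    ultimately have sub: "set (take (l - l') (drop l' ks)) \<subseteq> {c}"
      by (metis count_list_0_iff insertCI subsetI)
    have "take (l - l') (drop l' ks) ! 0 \<in> set (take (l - l') (drop l' ks))"
      by (rule nth_mem) (use l len in simp)
    hence "ks ! l' = c" using sub l len by auto
    hence "pos (take (Suc l') ks) = corner_vertex n (Suc l')"
      using eq(1) l len by (simp add: corner_vertex_def pos_take_Suc c_def)
    thus False using neq by simp
  qed
  moreover have "i < CARD('d)"
  proof (rule ccontr)
    assume "\<not> i < CARD('d)"
    hence "CARD('d) * n \<le> i * n" by simp
    thus False using \<open>i * n < l\<close> l by linarith
  qed
  ultimately show ?thesis using i by (intro bexI[of _ i]) (auto simp: i_def)
qed

lemma sum_around:
  fixes f :: "nat \<Rightarrow> real"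
  assumes "l' < m" "m < l"
  shows "(\<Sum>j\<in>{l'<..<l}. f j) = (\<Sum>t<m - l'. f (m - t)) + (\<Sum>t<l - m - 1. f (m + 1 + t))"
proof -
  have "{l'<..<l} = {l'<..m} \<union> {m<..<l}" using assms by auto
  hence "(\<Sum>j\<in>{l'<..<l}. f j) = (\<Sum>j\<in>{l'<..m}. f j) + (\<Sum>j\<in>{m<..<l}. f j)"
    by (simp add: sum.union_disjoint ivl_disj_int)
  moreover have "(\<Sum>j\<in>{l'<..m}. f j) = (\<Sum>t<m - l'. f (m - t))"
    by (rule sum.reindex_bij_witness[of _ "\<lambda>t. m - t" "\<lambda>j. m - j"]) (use assms in auto)
  moreover have "(\<Sum>j\<in>{m<..<l}. f j) = (\<Sum>t<l - m - 1. f (m + 1 + t))"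
    by (rule sum.reindex_bij_witness[of _ "\<lambda>t. m + 1 + t" "\<lambda>j. j - (m + 1)"]) (use assms in auto)
  ultimately show ?thesis by simp
qed

text \<open>Strong induction over the meeting points of \<open>ks\<close> with the corner path.
  Strictly between two successive meeting points \<open>ks\<close> gathers on average at most
  \<open>\<rho>\<close> per vertex by \<open>off_good\<close>, the corner path at least
  \<open>\<rho>\<close> by \<open>good_line\<close>, applied on both sides of a corner in
  between.\<close>

lemma corner_geodesic:
  fixes w :: "'d::{finite,linorder} weights"
  assumes line: "good_line \<rho> CARD('d) n (\<lambda>l. w (corner_vertex n l))"
    and off: "\<And>i a b. i \<in> {1..<CARD('d)} \<Longrightarrow> a \<in> {1..i * n} \<Longrightarrow> b \<in> {1..CARD('d) * n - i * n} \<Longrightarrow>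
      off_good \<rho> n (i * n) a b w"
    and ks: "pos ks = diag n"
  shows "walk_sum w 0 ks \<le> walk_sum w 0 (corner_steps n)"
proof -
  let ?N = "CARD('d) * n"
  define \<kappa> where "\<kappa> l = pos (take l ks)" for l
  define \<gamma> :: "nat \<Rightarrow> int ^ 'd::{finite,linorder}" where "\<gamma> l = corner_vertex n l" for l
  have len: "length ks = ?N" using level_pos[of ks] unfolding ks level_diag of_nat_eq_iff by simp
  have l\<kappa>: "level (\<kappa> l) = int l" if "l \<le> ?N" for l using that len by (simp add: \<kappa>_def)
  have l\<gamma>: "level (\<gamma> l) = int l" if "l \<le> ?N" for l using that by (simp add: \<gamma>_def level_corner_vertex)
  have 0: "\<kappa> 0 = \<gamma> 0" by (simp add: \<kappa>_def \<gamma>_def corner_vertex_def)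
  have claim: "(\<Sum>k\<in>{0<..l}. w (\<kappa> k)) \<le> (\<Sum>k\<in>{0<..l}. w (\<gamma> k))" if "l \<le> ?N" "\<kappa> l = \<gamma> l" for l
    using that
  proof (induction l rule: less_induct)
    case (less l)
    show ?case
    proof (cases "l = 0")
      case False
      \<comment> \<open>The previous meeting point. Both paths are at level \<open>j\<close> after
        \<open>j\<close> steps, so a meeting can only occur at equal indices.\<close>
      define l' where "l' = Max {j. j < l \<and> \<kappa> j = \<gamma> j}"
      have fin: "finite {j. j < l \<and> \<kappa> j = \<gamma> j}" by simp
      have "l' \<in> {j. j < l \<and> \<kappa> j = \<gamma> j}"
        unfolding l'_def using 0 False by (intro Max_in) auto
      hence l': "l' < l" "\<kappa> l' = \<gamma> l'" by auto
      have ne: "\<kappa> j \<noteq> \<gamma> j" if "l' < j" "j < l" for j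
        using Max_ge[OF fin, of j] that unfolding l'_def[symmetric] by auto
      have inner: "(\<Sum>j\<in>{l'<..<l}. w (\<kappa> j)) \<le> (\<Sum>j\<in>{l'<..<l}. w (\<gamma> j))"
      proof (cases "Suc l' = l")
        case True
        hence "{l'<..<l} = {}" by auto
        thus ?thesis by simp
      next
        case False
        hence "\<kappa> (Suc l') \<noteq> \<gamma> (Suc l')" using l' by (intro ne) auto
        then obtain i where i: "i \<in> {1..<CARD('d)}" "l' < i * n" "i * n < l"
          using excursion_straddles_corner[OF ks l'(1) less.prems(1)] l'(2) less.prems(2)
          unfolding \<kappa>_def \<gamma>_def by blast
        define a where "a = i * n - l'"
        define b where "b = l - i * n"
        have ab: "i * n - a = l'" "i * n + b = l" "a + b = l - l'" "1 \<le> a" "1 \<le> b" "a \<le> i * n"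
          using i by (auto simp: a_def b_def)
        have bN: "b \<le> ?N - i * n" using less.prems(1) by (simp add: b_def diff_le_mono)
        define js where "js = take (l - l') (drop l' ks)"
        have js: "pos (take k js) = \<kappa> (l' + k) - \<kappa> l'" if "k \<le> l - l'" for k
          using that pos_take_add[of l' k ks] by (simp add: js_def \<kappa>_def min_absorb1)
        have "off_good \<rho> n (i * n) a b w" using i ab bN by (intro off) auto
        moreover have "pos js = corner_vertex n (i * n + b) - corner_vertex n (i * n - a)"
          using js[of "l - l'"] l' less.prems by (simp add: js_def ab \<gamma>_def[symmetric])
        moreover have "corner_vertex n (i * n - a) + pos (take k js) \<notin> corner_vertex n ` {..?N}"
          if k: "k \<in> {0<..<a + b}" for k
        proof
          assume "corner_vertex n (i * n - a) + pos (take k js) \<in> corner_vertex n ` {..?N}"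
          hence "\<kappa> (l' + k) \<in> \<gamma> ` {..?N}"
            using js[of k] k l' by (simp add: ab \<gamma>_def[symmetric] \<gamma>_def[abs_def, symmetric] image_def)
          then obtain m where m: "m \<le> ?N" "\<kappa> (l' + k) = \<gamma> m" by auto
          have "l' + k \<le> ?N" using k ab(3) less.prems(1) l'(1) by auto
          hence "int (l' + k) = int m" using l\<kappa>[of "l' + k"] l\<gamma>[of m] m by simp
          hence "l' + k = m" by (simp only: of_nat_eq_iff)
          hence "\<kappa> (l' + k) = \<gamma> (l' + k)" using m by simp
          moreover have "l' < l' + k" "l' + k < l" using k ab(3) by auto
          ultimately show False using ne[of "l' + k"] by blast
        qed
        ultimately have "(\<Sum>k\<in>{0<..<a + b}. w (corner_vertex n (i * n - a) + pos (take k js)) - \<rho>) \<le> 0"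
          unfolding off_good_def by blast
        also have "(\<Sum>k\<in>{0<..<a + b}. w (corner_vertex n (i * n - a) + pos (take k js)) - \<rho>)
            = (\<Sum>k\<in>{0<..<a + b}. w (\<kappa> (l' + k)) - \<rho>)"
          using l' by (intro sum.cong refl) (simp add: js ab \<gamma>_def[symmetric])
        also have "\<dots> = (\<Sum>j\<in>{l'<..<l}. w (\<kappa> j) - \<rho>)"
          by (rule sum.reindex_bij_witness[of _ "\<lambda>j. j - l'" "\<lambda>k. l' + k"]) (use ab in auto)
        finally have "(\<Sum>j\<in>{l'<..<l}. w (\<kappa> j) - \<rho>) \<le> 0" .
        moreover have "0 \<le> (\<Sum>j\<in>{l'<..<l}. w (\<gamma> j) - \<rho>)"
        proof -
          have "0 \<le> (\<Sum>t<i * n - l'. w (\<gamma> (i * n - t)) - \<rho>)"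
            using line i unfolding good_line_def \<gamma>_def by auto
          moreover have "l - i * n - 1 \<le> ?N - i * n" using less.prems(1) by simp
          hence "0 \<le> (\<Sum>t<l - i * n - 1. w (\<gamma> (i * n + 1 + t)) - \<rho>)"
            using line i unfolding good_line_def \<gamma>_def by auto
          ultimately show ?thesis using sum_around[OF i(2,3), of "\<lambda>j. w (\<gamma> j) - \<rho>"] by simp
        qed
        ultimately show ?thesis by (simp add: sum_subtractf)
      qed
      have split: "(\<Sum>k\<in>{0<..l}. f k) = (\<Sum>k\<in>{0<..l'}. f k) + (\<Sum>k\<in>{l'<..<l}. f k) + f l" for f :: "nat \<Rightarrow> real"
      proof -
        have "{0<..l} = insert l ({0<..l'} \<union> {l'<..<l})" using l'(1) by auto
        hence "(\<Sum>k\<in>{0<..l}. f k) = f l + (\<Sum>k\<in>{0<..l'} \<union> {l'<..<l}. f k)"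
          using l'(1) by (simp only:) (rule sum.insert, auto)
        also have "(\<Sum>k\<in>{0<..l'} \<union> {l'<..<l}. f k) = (\<Sum>k\<in>{0<..l'}. f k) + (\<Sum>k\<in>{l'<..<l}. f k)"
          by (rule sum.union_disjoint) auto
        finally show ?thesis by simp
      qed
      have "(\<Sum>k\<in>{0<..l'}. w (\<kappa> k)) \<le> (\<Sum>k\<in>{0<..l'}. w (\<gamma> k))"
        using l' less.prems by (intro less.IH) auto
      thus ?thesis unfolding split using inner less.prems(2) by simp
    qed simp
  qed
  have conv: "walk_sum w 0 js = (\<Sum>k\<in>{0<..?N}. w (pos (take k js)))" if "length js = ?N" for js
  proof -
    have "walk_sum w 0 js = (\<Sum>k<?N. w (pos (take (Suc k) js)))" by (simp add: walk_sum_eq_sum that)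
    also have "\<dots> = (\<Sum>k\<in>{0<..?N}. w (pos (take k js)))"
      by (rule sum.reindex_bij_witness[of _ "\<lambda>k. k - 1" Suc]) auto
    finally show ?thesis .
  qed
  have "\<kappa> ?N = \<gamma> ?N"
    using ks len by (simp add: \<kappa>_def \<gamma>_def corner_vertex_def pos_corner_steps)
  from claim[OF _ this] show ?thesis
    unfolding conv[OF len] conv[OF length_corner_steps] by (simp add: \<kappa>_def \<gamma>_def corner_vertex_def)
qed

lemma walk_sum_corner_segment:
  fixes f :: "'d::{finite,linorder} weights"
  assumes "p \<le> p'" "p' \<le> CARD('d) * n"
  shows "walk_sum f (corner_vertex n p) (take (p' - p) (drop p (corner_steps n)))
    = (\<Sum>j\<in>{p<..p'}. f (corner_vertex n j))"
proof -
  have "walk_sum f (corner_vertex n p) (take (p' - p) (drop p (corner_steps n)))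
      = (\<Sum>t<p' - p. f (corner_vertex n (p + Suc t)))"
    using assms by (simp add: walk_sum_eq_sum corner_vertex_def pos_take_add min_absorb1 del: add_Suc_right)
  also have "\<dots> = (\<Sum>j\<in>{p<..p'}. f (corner_vertex n j))"
    by (rule sum.reindex_bij_witness[of _ "\<lambda>j. j - p - 1" "\<lambda>t. p + Suc t"]) (use assms in auto)
  finally show ?thesis .
qed

lemma pos_corner_segment:
  assumes "p \<le> p'"
  shows "pos (take (p' - p) (drop p (corner_steps n :: 'd::{finite,linorder} list))) = corner_vertex n p' - corner_vertex n p"
proof -
  have "corner_vertex n p' = corner_vertex n p + pos (take (p' - p) (drop p (corner_steps n :: 'd list)))"
    using pos_take_add[of p "p' - p" "corner_steps n :: 'd list"] assms by (simp add: corner_vertex_def)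
  thus ?thesis by simp
qed

lemma off_good_antimono:
  fixes v w :: "'d::{finite,linorder} weights"
  assumes le: "v \<le> w" and w: "off_good \<rho> n l a b w"
  shows "off_good \<rho> n l a b v"
proof -
  have "(\<Sum>k\<in>{0<..<a + b}. v (f k) - \<rho>) \<le> (\<Sum>k\<in>{0<..<a + b}. w (f k) - \<rho>)" for f
    by (rule sum_mono) (use le in \<open>simp add: le_fun_def\<close>)
  note mono = this
  show ?thesis unfolding off_good_def
  proof (intro allI impI)
    fix js :: "'d list" assume js: "pos js = corner_vertex n (l + b) - corner_vertex n (l - a)"
      "\<forall>k\<in>{0<..<a + b}. corner_vertex n (l - a) + pos (take k js) \<notin> corner_vertex n ` {..CARD('d) * n}"
    have "(\<Sum>k\<in>{0<..<a + b}. w (corner_vertex n (l - a) + pos (take k js)) - \<rho>) \<le> 0"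
      using w[unfolded off_good_def, rule_format, OF js(1)] js(2) by blast
    thus "(\<Sum>k\<in>{0<..<a + b}. v (corner_vertex n (l - a) + pos (take k js)) - \<rho>) \<le> 0"
      by (rule order_trans[OF mono])
  qed
qed

lemma length_excursion:
  fixes js :: "'d::{finite,linorder} list"
  assumes "pos js = corner_vertex n (l + b) - corner_vertex n (l - a)" "a \<le> l" "l + b \<le> CARD('d) * n"
  shows "length js = a + b"
proof -
  have "int (length js) = level (corner_vertex n (l + b) - corner_vertex n (l - a) :: int ^ 'd::{finite,linorder})"
    using assms(1) level_pos[of js] by simp
  also have "\<dots> = int (l + b) - int (l - a)"
    using assms(2,3) by (subst level_diff) (simp add: level_corner_vertex)
  finally show ?thesis using assms(2) by simp
qed

text \<open>A finite set of sites disjoint from the corner path that contains everything the events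
  \<open>off_good\<close> can look at: finiteness is required for Harris, disjointness for
  independence from the weights on the corner path.\<close>

definition off_vertices :: "nat \<Rightarrow> (int ^ 'd::{finite,linorder}) set" where
  "off_vertices n = pos ` {js. length js \<le> CARD('d) * n} - corner_vertex n ` {..CARD('d) * n}"

lemma finite_lists_le: "finite {js :: 'd::finite list. length js \<le> k}"
  using finite_lists_length_le[of "UNIV :: 'd set" k] by simp

lemma finite_off_vertices: "finite (off_vertices n)"
  unfolding off_vertices_def by (intro finite_Diff finite_imageI finite_lists_le)

lemma off_good_depends_on:
  assumes "a \<le> l" "l + b \<le> CARD('d) * n"
  shows "depends_on (off_vertices n :: (int ^ 'd::{finite,linorder}) set) (off_good \<rho> n l a b)"
proof (rule depends_onI)
  fix v w :: "'d::{finite,linorder} weights"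
  assume *: "\<And>x. x \<in> off_vertices n \<Longrightarrow> v x = w x"
  have "(\<Sum>k\<in>{0<..<a + b}. v (corner_vertex n (l - a) + pos (take k js)) - \<rho>)
      = (\<Sum>k\<in>{0<..<a + b}. w (corner_vertex n (l - a) + pos (take k js)) - \<rho>)"
    if js: "pos js = corner_vertex n (l + b) - corner_vertex n (l - a)"
      and off: "\<forall>k\<in>{0<..<a + b}. corner_vertex n (l - a) + pos (take k js) \<notin> corner_vertex n ` {..CARD('d) * n}"
    for js :: "'d list"
  proof (rule sum.cong)
    fix k assume k: "k \<in> {0<..<a + b}"
    have "corner_vertex n (l - a) + pos (take k js) = pos (take (l - a) (corner_steps n) @ take k js)"
      by (simp add: corner_vertex_def)
    moreover have "length (take (l - a) (corner_steps n :: 'd list) @ take k js) \<le> CARD('d) * n"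
      using k assms by auto
    ultimately have "corner_vertex n (l - a) + pos (take k js) \<in> off_vertices n"
      using off k unfolding off_vertices_def by blast
    from *[OF this] show "v (corner_vertex n (l - a) + pos (take k js)) - \<rho>
      = w (corner_vertex n (l - a) + pos (take k js)) - \<rho>" by simp
  qed simp
  thus "off_good \<rho> n l a b v = off_good \<rho> n l a b w"
    unfolding off_good_def by (metis (no_types, lifting))
qed

section \<open>Probability that a whole cell of excursions is harmless\<close>

context iid_weights
begin

lemma pred_off_good [measurable]:
  "Measurable.pred (Q :: ('d::{finite,linorder} weights) measure) (off_good \<rho> n l a b)"
proof -
  have "Measurable.pred Q (\<lambda>w. C \<longrightarrow> (\<Sum>k\<in>{0<..<a + b}. w (f k) - \<rho>) \<le> 0)" for C and f :: "nat \<Rightarrow> int ^ 'd::{finite,linorder}"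
    by (cases C) simp_all
  thus ?thesis unfolding off_good_def[abs_def] by (rule pred_all_steps)
qed

text \<open>Near the corner it is enough to force every weight within \<open>k0\<close> steps of the
  common starting vertex to be at most \<open>\<rho>\<close>. The number of these weights is bounded
  independently of \<open>n\<close>.\<close>

lemma cell_prob_small:
  fixes n l a1 a2 b1 b2 k0 :: nat
  assumes ab: "1 \<le> a1" "a2 \<le> l" "1 \<le> b1" "l + b2 \<le> CARD('d) * n" and small: "a2 + b2 \<le> k0"
  shows "measure D {x. x \<le> \<rho>} ^ card {js :: 'd::{finite,linorder} list. length js \<le> k0} \<le>
    Pr (\<lambda>w :: 'd::{finite,linorder} weights. \<forall>a\<in>{a1..a2}. \<forall>b\<in>{b1..b2}. off_good \<rho> n l a b w)"
proof -
  interpret D: prob_space D by (rule prob_D)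
  define V where "V = (\<lambda>js :: 'd list. corner_vertex n (l - a2) + pos js) ` {js. length js \<le> k0}"
  have fV: "finite V" unfolding V_def by (intro finite_imageI finite_lists_le)
  have "measure D {x. x \<le> \<rho>} ^ card {js :: 'd list. length js \<le> k0} \<le> measure D {x. x \<le> \<rho>} ^ card V"
    unfolding V_def by (intro power_decreasing card_image_le finite_lists_le) auto
  also have "\<dots> \<le> Pr (\<lambda>w. \<forall>x\<in>V. w x \<le> \<rho>)"
  proof (rule Harris_Ball[where r = "(\<ge>)" and J = V])
    fix x assume "x \<in> V"
    thus "depends_on V (\<lambda>w. w x \<le> \<rho>)" by (intro depends_onI) auto
    have "Pr (\<lambda>w. w x \<le> \<rho>) = measure D {x. x \<le> \<rho>}" by (rule Pr_coord) measurable
    thus "measure D {x. x \<le> \<rho>} \<le> Pr (\<lambda>w. w x \<le> \<rho>)" by simp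
    show "w x \<le> \<rho>" if "w \<le> v" "v x \<le> \<rho>" for v w :: "'d::{finite,linorder} weights"
      using that by (auto simp: le_fun_def intro: order_trans)
  qed (use fV in auto)
  also have "\<dots> \<le> Pr (\<lambda>w :: 'd::{finite,linorder} weights.
      \<forall>a\<in>{a1..a2}. \<forall>b\<in>{b1..b2}. off_good \<rho> n l a b w)"
  proof (rule Pr_mono)
    fix w :: "'d::{finite,linorder} weights" assume w: "\<forall>x\<in>V. w x \<le> \<rho>"
    show "\<forall>a\<in>{a1..a2}. \<forall>b\<in>{b1..b2}. off_good \<rho> n l a b w"
    proof (intro ballI, unfold off_good_def, intro allI impI, rule sum_nonpos)
      fix a b k and js :: "'d list"
      assume a: "a \<in> {a1..a2}" and b: "b \<in> {b1..b2}" and k: "k \<in> {0<..<a + b}"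
      let ?s = "take ((l - a) - (l - a2)) (drop (l - a2) (corner_steps n :: 'd list))"
      have "corner_vertex n (l - a2) + pos (?s @ take k js) = corner_vertex n (l - a) + pos (take k js)"
      proof -
        have "pos ?s = corner_vertex n (l - a) - corner_vertex n (l - a2)"
          using a by (intro pos_corner_segment) auto
        thus ?thesis by (simp only: pos_append) simp
      qed
      moreover have "length (?s @ take k js) \<le> k0" using a b k small by auto
      ultimately have "corner_vertex n (l - a) + pos (take k js) \<in> V"
        unfolding V_def by (metis (mono_tags, lifting) imageI mem_Collect_eq)
      thus "w (corner_vertex n (l - a) + pos (take k js)) - \<rho> \<le> 0" using w by simp
    qed
  qed measurable
  finally show ?thesis .
qed

text \<open>Every excursion of the cell is prolonged along the corner path to one common pair of
  endpoints, at positions \<open>l - a2\<close> and \<open>l + b2\<close>, so a single passage time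
  controls them all. The prolongation uses few vertices because the cell is thin, and by Markov's
  inequality their total deficit below \<open>\<rho>\<close> is likely to be at most
  \<open>\<delta> * k\<close>; the slack between \<open>\<rho>\<close> and
  \<open>\<rho> - \<delta>\<close> pays for it.\<close>

lemma cell_prob_big:
  fixes n l a1 a2 b1 b2 :: nat
  assumes ab: "1 \<le> a1" "a1 \<le> a2" "a2 \<le> l" "1 \<le> b1" "b1 \<le> b2" "l + b2 \<le> CARD('d) * n"
    and "\<delta> > 0" and int: "integrable D (\<lambda>x. max 0 (\<rho> - x))" and m: "m = (\<integral>x. max 0 (\<rho> - x) \<partial>D)"
    and thin: "8 * m * (real (a2 - a1) + real (b2 - b1) + 1) \<le> 2 * \<delta> * real (a2 + b2)"
    and hit: "\<And>e :: int ^ 'd::{finite,linorder}. level e = int (a2 + b2) \<Longrightarrow> hit e ((\<rho> - \<delta>) * real (a2 + b2)) \<le> 1 / 4"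
  shows "1 / 2 \<le> Pr (\<lambda>w :: 'd::{finite,linorder} weights.
    \<forall>a\<in>{a1..a2}. \<forall>b\<in>{b1..b2}. off_good \<rho> n l a b w)"
proof -
  let ?N = "CARD('d) * n" and ?\<gamma> = "corner_vertex n :: nat \<Rightarrow> int ^ 'd::{finite,linorder}"
  let ?cs = "corner_steps n :: 'd list"
  define k where "k = a2 + b2"
  have k: "k > 0" using ab by (simp add: k_def)
  define u where "u = ?\<gamma> (l - a2)"
  define e where "e = ?\<gamma> (l + b2) - u"
  \<comment> \<open>Positions on the corner path that a prolongation may use. The end
    \<open>l + b\<close> of an excursion is among them, as the sum in \<open>off_good\<close> omits
    it.\<close>
  define J where "J = {l - a2<..l - a1} \<union> {l + b1..l + b2}"
  have finJ: "finite J" by (simp add: J_def)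
  define C where "C w \<longleftrightarrow> (\<forall>a\<in>{a1..a2}. \<forall>b\<in>{b1..b2}. off_good \<rho> n l a b w)"
    for w :: "'d::{finite,linorder} weights"
  define H where "H w \<longleftrightarrow> (\<exists>js. pos js = e \<and> (\<rho> - \<delta>) * real k < walk_sum w u js)"
    for w :: "'d::{finite,linorder} weights"
  define F where "F w = (\<Sum>j\<in>J. max 0 (\<rho> - w (?\<gamma> j)))" for w :: "'d::{finite,linorder} weights"
  define Z where "Z w \<longleftrightarrow> \<delta> * real k < F w" for w
  have [measurable]: "F \<in> borel_measurable Q" unfolding F_def by measurable
  have mC [measurable]: "Measurable.pred Q C" unfolding C_def by measurable
  have mH [measurable]: "Measurable.pred Q H" unfolding H_def by measurable
  have mZ [measurable]: "Measurable.pred Q Z" unfolding Z_def by measurable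
  have "level e = int k" unfolding e_def u_def using ab
    by (subst level_diff) (simp add: level_corner_vertex k_def)
  hence PH: "Pr H \<le> 1 / 4"
    using hit[of e] hit_shift[of e "(\<rho> - \<delta>) * real k" u] by (simp add: H_def[abs_def] k_def)
  have PZ: "Pr Z \<le> 1 / 4"
  proof -
    have fi: "integrable Q (\<lambda>w. max 0 (\<rho> - w x))" and fe: "(\<integral>w. max 0 (\<rho> - w x) \<partial>Q) = m" for x :: "int ^ 'd::{finite,linorder}"
      using integrable_coord[of "\<lambda>y. max 0 (\<rho> - y)" x] integral_coord[of "\<lambda>y. max 0 (\<rho> - y)" x] int m by simp_all
    have iF: "integrable Q F" unfolding F_def by (intro Bochner_Integration.integrable_sum fi)
    have "Pr Z \<le> (\<integral>w. F w / (\<delta> * real k) \<partial>Q)"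
    proof (rule Markov_exp[OF _ _ _ mZ])
      show "integrable Q (\<lambda>w. F w / (\<delta> * real k))" using iF by simp
      show "0 \<le> F w / (\<delta> * real k)" for w
        using \<open>\<delta> > 0\<close> unfolding F_def by (intro divide_nonneg_nonneg sum_nonneg) auto
      show "1 \<le> F w / (\<delta> * real k)" if "Z w" for w
        using that \<open>\<delta> > 0\<close> k by (simp add: Z_def)
    qed
    also have "\<dots> = real (card J) * m / (\<delta> * real k)"
      unfolding F_def by (simp add: Bochner_Integration.integral_sum fi fe)
    also have "\<dots> \<le> 1 / 4"
    proof -
      have "m \<ge> 0" unfolding m by (intro Bochner_Integration.integral_nonneg) simp
      have "card J \<le> card {l - a2<..l - a1} + card {l + b1..l + b2}" unfolding J_def by (rule card_Un_le)
      also have "\<dots> = (a2 - a1) + (b2 - b1) + 1" using ab by simp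
      finally have "real (card J) \<le> real (a2 - a1) + real (b2 - b1) + 1" by linarith
      hence "8 * m * real (card J) \<le> 8 * m * (real (a2 - a1) + real (b2 - b1) + 1)"
        using \<open>m \<ge> 0\<close> by (intro mult_left_mono) auto
      also note thin
      finally have "8 * (m * real (card J)) \<le> 2 * (\<delta> * real k)" unfolding k_def by (simp only: mult.assoc)
      hence "real (card J) * m \<le> 1 / 4 * (\<delta> * real k)" by (simp only: mult.commute[of m])
      moreover have "0 < \<delta> * real k" using \<open>\<delta> > 0\<close> k by simp
      ultimately show ?thesis by (simp only: pos_divide_le_eq)
    qed
    finally show ?thesis .
  qed
  have main: "C w" if nH: "\<not> H w" and nZ: "\<not> Z w" for w
    unfolding C_def
  proof (intro ballI, unfold off_good_def, intro allI impI)
    fix a b and js :: "'d list"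
    assume a: "a \<in> {a1..a2}" and b: "b \<in> {b1..b2}" and js: "pos js = ?\<gamma> (l + b) - ?\<gamma> (l - a)"
    define X where "X x = w x - \<rho>" for x
    define s1 where "s1 = take ((l - a) - (l - a2)) (drop (l - a2) ?cs)"
    define s2 where "s2 = take ((l + b2) - (l + b)) (drop (l + b) ?cs)"
    have p1: "pos s1 = ?\<gamma> (l - a) - u" unfolding s1_def u_def using a by (intro pos_corner_segment) auto
    have p2: "pos s2 = ?\<gamma> (l + b2) - ?\<gamma> (l + b)" unfolding s2_def using b by (intro pos_corner_segment) auto
    have ljs: "length js = a + b" using a b ab by (intro length_excursion[OF js]) auto
    have pe: "pos (s1 @ js @ s2) = e" by (simp add: p1 p2 js e_def)
    have len: "length (s1 @ js @ s2) = k" unfolding s1_def s2_def using a b ab by (simp add: ljs k_def)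
    have "walk_sum w u (s1 @ js @ s2) \<le> (\<rho> - \<delta>) * real k"
      using nH pe unfolding H_def not_ex de_Morgan_conj not_less by metis
    have "walk_sum X u (s1 @ js @ s2) = walk_sum w u (s1 @ js @ s2) - \<rho> * real k"
      unfolding X_def using walk_sum_const_diff[of w \<rho> u "s1 @ js @ s2"] len by simp
    also have "\<dots> \<le> (\<rho> - \<delta>) * real k - \<rho> * real k" using \<open>walk_sum w u (s1 @ js @ s2) \<le> _\<close> by (rule diff_right_mono)
    also have "\<dots> = - (\<delta> * real k)" by (simp add: algebra_simps)
    finally have tot: "walk_sum X u (s1 @ js @ s2) \<le> - (\<delta> * real k)" .
    have "walk_sum X u s1 = (\<Sum>j\<in>{l - a2<..l - a}. X (?\<gamma> j))"
      unfolding s1_def u_def using a ab by (intro walk_sum_corner_segment) auto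
    moreover have "walk_sum X (?\<gamma> (l + b)) s2 = (\<Sum>j\<in>{l + b<..l + b2}. X (?\<gamma> j))"
      unfolding s2_def using b ab by (intro walk_sum_corner_segment) auto
    moreover have "walk_sum X (?\<gamma> (l - a)) js
        = (\<Sum>k\<in>{0<..<a + b}. X (?\<gamma> (l - a) + pos (take k js))) + X (?\<gamma> (l + b))"
    proof -
      have "walk_sum X (?\<gamma> (l - a)) js = (\<Sum>t<a + b. X (?\<gamma> (l - a) + pos (take (Suc t) js)))"
        by (simp add: walk_sum_eq_sum ljs)
      also have "\<dots> = (\<Sum>k\<in>{0<..a + b}. X (?\<gamma> (l - a) + pos (take k js)))"
        by (rule sum.reindex_bij_witness[of _ "\<lambda>k. k - 1" Suc]) auto
      also have "{0<..a + b} = insert (a + b) {0<..<a + b}" using a ab by auto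
      also have "(\<Sum>k\<in>insert (a + b) {0<..<a + b}. X (?\<gamma> (l - a) + pos (take k js)))
          = X (?\<gamma> (l - a) + pos (take (a + b) js)) + (\<Sum>k\<in>{0<..<a + b}. X (?\<gamma> (l - a) + pos (take k js)))"
        by (rule sum.insert) auto
      also have "?\<gamma> (l - a) + pos (take (a + b) js) = ?\<gamma> (l + b)" by (simp add: ljs[symmetric] js)
      finally show ?thesis by simp
    qed
    moreover have "walk_sum X u (s1 @ js @ s2) = walk_sum X u s1 + walk_sum X (?\<gamma> (l - a)) js + walk_sum X (?\<gamma> (l + b)) s2"
      by (simp add: walk_sum_append p1 js)
    moreover have "(\<Sum>j\<in>{l - a2<..l - a}. X (?\<gamma> j)) + (X (?\<gamma> (l + b)) + (\<Sum>j\<in>{l + b<..l + b2}. X (?\<gamma> j))) \<ge> - F w"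
    proof -
      have i1: "{l + b..l + b2} = insert (l + b) {l + b<..l + b2}" using b by auto
      have "X (?\<gamma> (l + b)) + (\<Sum>j\<in>{l + b<..l + b2}. X (?\<gamma> j)) = (\<Sum>j\<in>{l + b..l + b2}. X (?\<gamma> j))"
        unfolding i1 by (rule sum.insert[symmetric]) auto
      hence "(\<Sum>j\<in>{l - a2<..l - a}. X (?\<gamma> j)) + (X (?\<gamma> (l + b)) + (\<Sum>j\<in>{l + b<..l + b2}. X (?\<gamma> j)))
          = (\<Sum>j\<in>{l - a2<..l - a} \<union> {l + b..l + b2}. X (?\<gamma> j))"
        using a b ab by (subst sum.union_disjoint) auto
      also have "\<dots> \<ge> (\<Sum>j\<in>{l - a2<..l - a} \<union> {l + b..l + b2}. - max 0 (\<rho> - w (?\<gamma> j)))"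
        by (rule sum_mono) (simp add: X_def)
      also have "(\<Sum>j\<in>{l - a2<..l - a} \<union> {l + b..l + b2}. - max 0 (\<rho> - w (?\<gamma> j)))
          = - (\<Sum>j\<in>{l - a2<..l - a} \<union> {l + b..l + b2}. max 0 (\<rho> - w (?\<gamma> j)))" by (rule sum_negf)
      moreover have "(\<Sum>j\<in>{l - a2<..l - a} \<union> {l + b..l + b2}. max 0 (\<rho> - w (?\<gamma> j))) \<le> F w"
        unfolding F_def by (rule sum_mono2[OF finJ]) (use a b in \<open>auto simp: J_def\<close>)
      ultimately show ?thesis by linarith
    qed
    ultimately have "(\<Sum>k\<in>{0<..<a + b}. X (?\<gamma> (l - a) + pos (take k js))) \<le> - (\<delta> * real k) + F w"
      using tot by linarith
    also have "\<dots> \<le> 0" using nZ by (simp add: Z_def)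
    finally show "(\<Sum>k\<in>{0<..<a + b}. w (?\<gamma> (l - a) + pos (take k js)) - \<rho>) \<le> 0" by (simp add: X_def)
  qed
  have "1 = measure (Q :: ('d::{finite,linorder} weights) measure) UNIV" by simp
  also have "UNIV = Collect C \<union> (Collect H \<union> Collect Z)" using main by blast
  also have "measure Q \<dots> \<le> Pr C + measure Q (Collect H \<union> Collect Z)"
    by (rule measure_Un_le) (intro sets.Un sets_Q_Collect mC mH mZ)+
  also have "measure Q (Collect H \<union> Collect Z) \<le> Pr H + Pr Z"
    by (rule measure_Un_le) (intro sets_Q_Collect mH mZ)+
  finally show ?thesis using PH PZ by (simp add: C_def[abs_def])
qed

end

text \<open>Integer version of the geometric progression with ratio \<open>1 + \<eta>\<close>. The
  \<open>+ 1\<close> lets it grow even while \<open>\<eta> * grid \<eta> k\<close> is below 1, and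
  the cell from \<open>grid \<eta> k\<close> to \<open>grid \<eta> (Suc k) - 1\<close> still has
  width at most \<open>\<eta> * grid \<eta> k\<close>.\<close>

primrec grid :: "real \<Rightarrow> nat \<Rightarrow> nat" where
  "grid \<eta> 0 = 1"
| "grid \<eta> (Suc k) = grid \<eta> k + nat \<lfloor>\<eta> * real (grid \<eta> k)\<rfloor> + 1"

lemma grid_ge_1: "1 \<le> grid \<eta> k"
  by (induction k) auto

lemma grid_ge_power:
  assumes "\<eta> > 0" shows "(1 + \<eta>) ^ k \<le> real (grid \<eta> k)"
proof (induction k)
  case (Suc k)
  have "(1 + \<eta>) ^ Suc k \<le> (1 + \<eta>) * real (grid \<eta> k)" using Suc assms by (simp add: mult_left_mono)
  also have "\<dots> = real (grid \<eta> k) + \<eta> * real (grid \<eta> k)" by (simp add: algebra_simps)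
  also have "\<eta> * real (grid \<eta> k) \<le> real (nat \<lfloor>\<eta> * real (grid \<eta> k)\<rfloor>) + 1" by linarith
  finally show ?case by simp
qed simp

lemma grid_cover:
  "1 \<le> a \<Longrightarrow> a < grid \<eta> K \<Longrightarrow> \<exists>k<K. grid \<eta> k \<le> a \<and> a < grid \<eta> (Suc k)"
proof (induction K)
  case (Suc K)
  show ?case
  proof (cases "a < grid \<eta> K")
    case True
    then show ?thesis using Suc by (meson less_SucI)
  next
    case False
    then show ?thesis using Suc.prems by (intro exI[of _ K]) auto
  qed
qed simp

lemma grid_thin:
  assumes "\<eta> > 0"
  shows "real (grid \<eta> (Suc k) - 1 - grid \<eta> k) \<le> \<eta> * real (grid \<eta> k)"
proof -
  have "0 \<le> \<eta> * real (grid \<eta> k)" using assms by simp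
  thus ?thesis by simp
qed

context iid_weights
begin

text \<open>Cells with \<open>a2 + b2\<close> bounded are covered by forcing boundedly many weights
  down; all larger ones fall under the estimate for thin cells. One constant \<open>q\<close>
  therefore serves all cells, corners and \<open>n\<close>.\<close>

lemma ex_cell_bound:
  fixes \<rho> \<delta> :: real
  assumes "\<delta> > 0" and int: "integrable D (\<lambda>x. max 0 (\<rho> - x))" and p: "0 < measure D {x. x \<le> \<rho>}"
    and lim: "(\<lambda>n. hit (\<chi> i::'d::{finite,linorder}. int n) ((\<rho> - \<delta>) * (real CARD('d) * real n))) \<longlonglongrightarrow> 0"
  shows "\<exists>\<eta>>0. \<exists>q>0. q \<le> 1 \<and> (\<forall>n l a1 a2 b1 b2. 1 \<le> a1 \<longrightarrow> a1 \<le> a2 \<longrightarrow> a2 \<le> l \<longrightarrow>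
    1 \<le> b1 \<longrightarrow> b1 \<le> b2 \<longrightarrow> l + b2 \<le> CARD('d) * n \<longrightarrow>
    real (a2 - a1) \<le> \<eta> * real a1 \<longrightarrow> real (b2 - b1) \<le> \<eta> * real b1 \<longrightarrow>
    q \<le> Pr (\<lambda>w :: 'd::{finite,linorder} weights. \<forall>a\<in>{a1..a2}. \<forall>b\<in>{b1..b2}. off_good \<rho> n l a b w))"
proof -
  interpret D: prob_space D by (rule prob_D)
  define m where "m = (\<integral>x. max 0 (\<rho> - x) \<partial>D)"
  have m: "m \<ge> 0" unfolding m_def by (intro Bochner_Integration.integral_nonneg) simp
  \<comment> \<open>Makes \<open>8 * m * \<eta> \<le> \<delta>\<close>, where \<open>m\<close> is
    the mean deficit of a weight below \<open>\<rho>\<close>.\<close>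
  define \<eta> where "\<eta> = \<delta> / (8 * (m + 1))"
  have \<eta>: "\<eta> > 0" using m \<open>\<delta> > 0\<close> by (simp add: \<eta>_def)
  obtain k0 where k0: "\<And>(e :: int ^ 'd::{finite,linorder}) k. level e = int k \<Longrightarrow> k0 \<le> k \<Longrightarrow>
      hit e ((\<rho> - \<delta>) * real k) \<le> 1 / 4"
    using hit_uniformly_small[OF lim, of "1 / 4"] by auto
  \<comment> \<open>Once \<open>a2 + b2 \<ge> 1 / \<eta>\<close>, the summand 1 in the thinness
    condition is absorbed into \<open>\<eta> * real (a2 + b2)\<close>.\<close>
  define k1 where "k1 = max k0 (nat \<lceil>1 / \<eta>\<rceil>)"
  define q where "q = min (1 / 2) (measure D {x. x \<le> \<rho>} ^ card {js :: 'd list. length js \<le> k1})"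
  have q: "q > 0" "q \<le> 1" using p by (auto simp: q_def)
  have "q \<le> Pr (\<lambda>w :: 'd::{finite,linorder} weights. \<forall>a\<in>{a1..a2}. \<forall>b\<in>{b1..b2}. off_good \<rho> n l a b w)"
    if ab: "1 \<le> a1" "a1 \<le> a2" "a2 \<le> l" "1 \<le> b1" "b1 \<le> b2" "l + b2 \<le> CARD('d) * n"
      and thin: "real (a2 - a1) \<le> \<eta> * real a1" "real (b2 - b1) \<le> \<eta> * real b1" for n l a1 a2 b1 b2
  proof (cases "a2 + b2 \<le> k1")
    case True
    show ?thesis
      by (rule order_trans[OF _ cell_prob_small[OF ab(1,3,4,6) True]]) (simp add: q_def)
  next
    case False
    hence k: "k0 \<le> a2 + b2" "1 / \<eta> \<le> real (a2 + b2)" by (auto simp: k1_def) linarith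
    have "1 \<le> \<eta> * real (a2 + b2)" using k(2) \<eta> by (simp add: field_simps)
    moreover have "\<eta> * real a1 + \<eta> * real b1 \<le> \<eta> * real (a2 + b2)"
      using ab \<eta> by (simp add: distrib_left[symmetric])
    ultimately have "real (a2 - a1) + real (b2 - b1) + 1 \<le> 2 * (\<eta> * real (a2 + b2))"
      using thin by linarith
    hence "8 * m * (real (a2 - a1) + real (b2 - b1) + 1) \<le> 8 * m * (2 * (\<eta> * real (a2 + b2)))"
      using m by (intro mult_left_mono) auto
    also have "\<dots> = (8 * m * \<eta>) * (2 * real (a2 + b2))" by (simp add: mult_ac)
    also have "\<dots> \<le> \<delta> * (2 * real (a2 + b2))"
    proof (rule mult_right_mono)
      have "8 * m * \<eta> = \<delta> * (m / (m + 1))" using m by (simp add: \<eta>_def field_simps)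
      also have "\<dots> \<le> \<delta> * 1" using m \<open>\<delta> > 0\<close> by (intro mult_left_mono) auto
      finally show "8 * m * \<eta> \<le> \<delta>" by simp
    qed simp
    finally have "8 * m * (real (a2 - a1) + real (b2 - b1) + 1) \<le> 2 * \<delta> * real (a2 + b2)" by (simp add: mult_ac)
    from cell_prob_big[OF ab \<open>\<delta> > 0\<close> int m_def this k0[OF _ k(1)]]
    have "1 / 2 \<le> Pr (\<lambda>w :: 'd::{finite,linorder} weights. \<forall>a\<in>{a1..a2}. \<forall>b\<in>{b1..b2}. off_good \<rho> n l a b w)" .
    thus ?thesis by (simp add: q_def)
  qed
  thus ?thesis using \<eta> q by blast
qed

text \<open>All cell events are decreasing, so Harris gives \<open>q\<close> to the power of the
  number of cells. That number only has to be \<open>o(n)\<close>; bounding the logarithm by a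
  fourth root makes it of order at most \<open>sqrt n\<close>, which is enough.\<close>

lemma off_good_prob:
  fixes \<rho> \<delta> \<epsilon> :: real
  assumes "\<delta> > 0" and int: "integrable D (\<lambda>x. max 0 (\<rho> - x))" and p: "0 < measure D {x. x \<le> \<rho>}"
    and lim: "(\<lambda>n. hit (\<chi> i::'d::{finite,linorder}. int n) ((\<rho> - \<delta>) * (real CARD('d) * real n))) \<longlonglongrightarrow> 0"
    and "\<epsilon> > 0"
  shows "\<forall>\<^sub>F n in sequentially. exp (- \<epsilon> * real n) \<le>
    Pr (\<lambda>w :: 'd::{finite,linorder} weights. \<forall>i\<in>{1..<CARD('d)}. \<forall>a\<in>{1..i * n}.
      \<forall>b\<in>{1..CARD('d) * n - i * n}. off_good \<rho> n (i * n) a b w)"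
proof -
  let ?d = "CARD('d)"
  obtain \<eta> q where \<eta>: "\<eta> > 0" and q: "0 < q" "q \<le> 1" and cell0: "\<forall>n l a1 a2 b1 b2. 1 \<le> a1 \<longrightarrow> a1 \<le> a2 \<longrightarrow> a2 \<le> l \<longrightarrow>
    1 \<le> b1 \<longrightarrow> b1 \<le> b2 \<longrightarrow> l + b2 \<le> CARD('d) * n \<longrightarrow>
    real (a2 - a1) \<le> \<eta> * real a1 \<longrightarrow> real (b2 - b1) \<le> \<eta> * real b1 \<longrightarrow>
    q \<le> Pr (\<lambda>w :: 'd::{finite,linorder} weights. \<forall>a\<in>{a1..a2}. \<forall>b\<in>{b1..b2}. off_good \<rho> n l a b w)"
    using ex_cell_bound[OF assms(1-4)] by (elim exE conjE)
  note cell = cell0[THEN spec, THEN spec, THEN spec, THEN spec, THEN spec, THEN spec,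
      THEN mp, THEN mp, THEN mp, THEN mp, THEN mp, THEN mp, THEN mp, THEN mp]
  \<comment> \<open>From \<open>ln y \<le> 4 * sqrt (sqrt y)\<close>; the summand 1 pays for
    rounding \<open>K\<close> up.\<close>
  define C where "C = 4 / ln (1 + \<eta>) + 1"
  have lnp: "ln (1 + \<eta>) > 0" using \<eta> by simp
  have C: "C > 0" using lnp by (simp add: C_def add_pos_pos)
  define B where "B = (- ln q) * real ?d * C\<^sup>2 * sqrt (real ?d + 1)"
  have "0 \<le> - ln q" using q by simp
  hence B: "B \<ge> 0" unfolding B_def by (intro mult_nonneg_nonneg) auto
  have "\<forall>\<^sub>F n in sequentially. (B / \<epsilon>)\<^sup>2 \<le> real n"
    using filterlim_real_sequentially by (simp add: filterlim_at_top)
  thus ?thesis using eventually_gt_at_top[of 0]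
  proof eventually_elim
    case (elim n)
    define y where "y = real (?d * n) + 1"
    have y: "y \<ge> 1" by (simp add: y_def)
    define K where "K = nat \<lceil>ln y / ln (1 + \<eta>)\<rceil>"
    have "ln y / ln (1 + \<eta>) \<le> real K" unfolding K_def by linarith
    hence "ln y \<le> real K * ln (1 + \<eta>)" using lnp by (simp add: field_simps)
    hence "y \<le> exp (real K * ln (1 + \<eta>))" using y by (metis exp_le_cancel_iff exp_ln less_le_trans zero_less_one)
    also have "\<dots> = (1 + \<eta>) ^ K" using \<eta> by (simp add: exp_of_nat_mult)
    also have "\<dots> \<le> real (grid \<eta> K)" by (rule grid_ge_power[OF \<eta>])
    finally have gK: "?d * n < grid \<eta> K" unfolding y_def by linarith
    have Kle: "real K \<le> C * sqrt (sqrt y)"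
    proof -
      have "ln y = 4 * ln (sqrt (sqrt y))" using y by (simp add: ln_sqrt)
      also have "\<dots> \<le> 4 * sqrt (sqrt y)" using y by (intro mult_left_mono ln_bound) auto
      finally have "ln y / ln (1 + \<eta>) \<le> 4 * sqrt (sqrt y) / ln (1 + \<eta>)" using lnp by (intro divide_right_mono) auto
      moreover have "real K \<le> ln y / ln (1 + \<eta>) + 1" using y lnp unfolding K_def by simp
      moreover have "1 \<le> sqrt (sqrt y)" using y by simp
      ultimately have "real K \<le> 4 * sqrt (sqrt y) / ln (1 + \<eta>) + sqrt (sqrt y)" by linarith
      also have "\<dots> = C * sqrt (sqrt y)" unfolding C_def by (simp add: distrib_right)
      finally show ?thesis .
    qed
    hence "(real K)\<^sup>2 \<le> (C * sqrt (sqrt y))\<^sup>2" by (intro power_mono) auto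
    also have "\<dots> = C\<^sup>2 * sqrt y" using y by (simp add: power_mult_distrib)
    also have "sqrt y \<le> sqrt ((real ?d + 1) * real n)"
      using elim(2) by (intro real_sqrt_le_mono) (simp add: y_def algebra_simps)
    finally have K2: "(real K)\<^sup>2 \<le> C\<^sup>2 * (sqrt (real ?d + 1) * sqrt (real n))"
      using C by (simp add: real_sqrt_mult mult_left_mono)
    define L where "L = {1..<?d} \<times> {..<K} \<times> {..<K}"
    \<comment> \<open>Cells are cut off at the two ends of the corner path; one that becomes empty
      holds vacuously.\<close>
    define A where "A = (\<lambda>(i, k, k') (w :: 'd::{finite,linorder} weights).
      \<forall>a\<in>{grid \<eta> k..min (grid \<eta> (Suc k) - 1) (i * n)}.
      \<forall>b\<in>{grid \<eta> k'..min (grid \<eta> (Suc k') - 1) (?d * n - i * n)}. off_good \<rho> n (i * n) a b w)"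
    have iN: "i * n \<le> ?d * n" if "i \<in> {1..<?d}" for i using that by (intro mult_right_mono) auto
    have PA: "q \<le> Pr (A l)" if l: "l \<in> L" for l
    proof -
      obtain i k k' where ik: "l = (i, k, k')" "i \<in> {1..<?d}" using l by (auto simp: L_def)
      define a2 where "a2 = min (grid \<eta> (Suc k) - 1) (i * n)"
      define b2 where "b2 = min (grid \<eta> (Suc k') - 1) (?d * n - i * n)"
      show ?thesis
      proof (cases "grid \<eta> k \<le> a2 \<and> grid \<eta> k' \<le> b2")
        case True
        have "a2 - grid \<eta> k \<le> grid \<eta> (Suc k) - 1 - grid \<eta> k" unfolding a2_def by (intro diff_le_mono) simp
        hence 1: "real (a2 - grid \<eta> k) \<le> \<eta> * real (grid \<eta> k)"
          using grid_thin[OF \<eta>, of k] by (meson of_nat_le_iff order_trans)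
        have "b2 - grid \<eta> k' \<le> grid \<eta> (Suc k') - 1 - grid \<eta> k'" unfolding b2_def by (intro diff_le_mono) simp
        hence 2: "real (b2 - grid \<eta> k') \<le> \<eta> * real (grid \<eta> k')"
          using grid_thin[OF \<eta>, of k'] by (meson of_nat_le_iff order_trans)
        have "b2 \<le> ?d * n - i * n" by (simp add: b2_def)
        hence 3: "i * n + b2 \<le> ?d * n" using iN[OF ik(2)] by linarith
        have "q \<le> Pr (\<lambda>w :: 'd::{finite,linorder} weights.
            \<forall>a\<in>{grid \<eta> k..a2}. \<forall>b\<in>{grid \<eta> k'..b2}. off_good \<rho> n (i * n) a b w)"
          by (rule cell) (use True 1 2 3 grid_ge_1 in \<open>auto simp: a2_def\<close>)
        thus ?thesis by (simp add: A_def ik(1) a2_def b2_def)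
      next
        case False
        hence "{grid \<eta> k..a2} = {} \<or> {grid \<eta> k'..b2} = {}" by auto
        hence "A l w" for w
          unfolding A_def ik(1) prod.case a2_def[symmetric] b2_def[symmetric] by blast
        hence "A l = (\<lambda>_. True)" by (intro ext) simp
        thus ?thesis using q by simp
      qed
    qed
    have mA: "Measurable.pred Q (A l)" for l
    proof -
      have *: "Measurable.pred Q (\<lambda>w :: 'd::{finite,linorder} weights.
          \<forall>a\<in>{a1..a2}. \<forall>b\<in>{b1..b2}. off_good \<rho> n m a b w)" for a1 a2 b1 b2 m
        by measurable
      show ?thesis unfolding A_def by (cases l) (simp only: prod.case *)
    qed
    have "real (card L) \<le> real ?d * (real K)\<^sup>2"
      by (simp add: L_def card_cartesian_product power2_eq_square mult_right_mono)
    also have "\<dots> \<le> real ?d * (C\<^sup>2 * (sqrt (real ?d + 1) * sqrt (real n)))" by (rule mult_left_mono[OF K2]) simp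
    finally have "(- ln q) * real (card L) \<le> (- ln q) * (real ?d * (C\<^sup>2 * (sqrt (real ?d + 1) * sqrt (real n))))"
      using q by (intro mult_left_mono) auto
    also have "\<dots> = B * sqrt (real n)" by (simp add: B_def mult_ac)
    also have "\<dots> \<le> (\<epsilon> * sqrt (real n)) * sqrt (real n)"
    proof (rule mult_right_mono)
      have "B / \<epsilon> \<le> sqrt (real n)" by (rule real_le_rsqrt[OF elim(1)])
      thus "B \<le> \<epsilon> * sqrt (real n)" using \<open>\<epsilon> > 0\<close> by (simp add: field_simps)
    qed simp
    also have "\<dots> = \<epsilon> * real n" by (simp add: mult.assoc)
    finally have "- \<epsilon> * real n \<le> real (card L) * ln q" by (simp add: mult.commute)
    hence "exp (- \<epsilon> * real n) \<le> exp (real (card L) * ln q)" by simp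
    also have "\<dots> = q ^ card L" using q by (simp add: exp_of_nat_mult)
    also have "\<dots> \<le> Pr (\<lambda>w. \<forall>l\<in>L. A l w)"
    proof (rule Harris_Ball[where r = "(\<ge>)" and J = "off_vertices n"])
      fix l assume l: "l \<in> L"
      then obtain i k k' where ik: "l = (i, k, k')" "i \<in> {1..<?d}" by (auto simp: L_def)
      show "depends_on (off_vertices n) (A l)"
      proof (rule depends_onI)
        fix v w :: "'d::{finite,linorder} weights"
        assume *: "\<And>x. x \<in> off_vertices n \<Longrightarrow> v x = w x"
        have "off_good \<rho> n (i * n) a b v = off_good \<rho> n (i * n) a b w"
          if "a \<le> i * n" "b \<le> ?d * n - i * n" for a b
          by (rule depends_onD[OF off_good_depends_on *]) (use that iN[OF ik(2)] in linarith)+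
        thus "A l v = A l w" by (simp add: A_def ik(1))
      qed
      show "A l w" if "w \<le> v" "A l v" for v w
        using that(2) off_good_antimono[OF that(1)] unfolding A_def ik(1) prod.case by blast
      show "q \<le> Pr (A l)" by (rule PA[OF l])
    qed (use q mA finite_off_vertices in \<open>auto simp: L_def\<close>)
    also have "\<dots> \<le> Pr (\<lambda>w :: 'd::{finite,linorder} weights. \<forall>i\<in>{1..<?d}. \<forall>a\<in>{1..i * n}.
      \<forall>b\<in>{1..?d * n - i * n}. off_good \<rho> n (i * n) a b w)"
    proof (rule Pr_mono)
      fix w assume w: "\<forall>l\<in>L. A l w"
      show "\<forall>i\<in>{1..<?d}. \<forall>a\<in>{1..i * n}. \<forall>b\<in>{1..?d * n - i * n}. off_good \<rho> n (i * n) a b w"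
      proof (intro ballI)
        fix i a b assume i: "i \<in> {1..<?d}" and a: "a \<in> {1..i * n}" and b: "b \<in> {1..?d * n - i * n}"
        have "a < grid \<eta> K" "b < grid \<eta> K" using a b gK iN[OF i] by auto
        then obtain k k' where k: "k < K" "grid \<eta> k \<le> a" "a < grid \<eta> (Suc k)"
          and k': "k' < K" "grid \<eta> k' \<le> b" "b < grid \<eta> (Suc k')"
          using grid_cover[of a \<eta> K] grid_cover[of b \<eta> K] a b by auto
        have "A (i, k, k') w" using w i k(1) k'(1) by (auto simp: L_def)
        moreover have "a \<in> {grid \<eta> k..min (grid \<eta> (Suc k) - 1) (i * n)}" using k a by auto
        moreover have "b \<in> {grid \<eta> k'..min (grid \<eta> (Suc k') - 1) (?d * n - i * n)}" using k' b by auto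
        ultimately show "off_good \<rho> n (i * n) a b w" unfolding A_def prod.case by blast
      qed
    qed measurable
    finally show ?case .
  qed
qed

end

section \<open>The moment generating function\<close>

lemma abs_exp_minus_one_le: "\<bar>exp y - 1\<bar> \<le> \<bar>y\<bar> * exp \<bar>y :: real\<bar>"
proof (cases "y \<ge> 0")
  case True
  have "1 - y \<le> exp (- y)" using exp_ge_add_one_self[of "- y"] by simp
  hence "(1 - y) * exp y \<le> exp (- y) * exp y" by (rule mult_right_mono) simp
  also have "\<dots> = 1" by (simp add: exp_add[symmetric])
  finally show ?thesis using True by (simp add: algebra_simps)
next
  case False
  have "1 - exp y \<le> - y" using exp_ge_add_one_self[of y] by linarith
  also have "\<dots> \<le> - y * exp (- y)" using False by (simp add: mult_le_cancel_left1)
  finally show ?thesis using False by simp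
qed

text \<open>Integrable majorant for differentiating under the integral. The factor
  \<open>\<bar>x\<bar>\<close> from the bound on \<open>exp y - 1\<close> is absorbed into a second
  factor \<open>exp (r * \<bar>x\<bar>)\<close>, whence \<open>2 * r\<close>.\<close>

lemma exp_difference_quotient_bound:
  fixes t h x r :: real
  assumes "r > 0" "\<bar>h\<bar> \<le> r" "h \<noteq> 0"
  shows "\<bar>(exp ((t + h) * x) - exp (t * x)) / h\<bar> \<le> (exp ((t + 2 * r) * x) + exp ((t - 2 * r) * x)) / r"
proof -
  have "\<bar>exp (h * x) - 1\<bar> \<le> \<bar>h * x\<bar> * exp \<bar>h * x\<bar>" by (rule abs_exp_minus_one_le)
  also have "\<dots> \<le> \<bar>h\<bar> * \<bar>x\<bar> * exp (r * \<bar>x\<bar>)"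
    using assms by (simp add: abs_mult mult_left_mono mult_right_mono)
  finally have 1: "\<bar>exp (h * x) - 1\<bar> / \<bar>h\<bar> \<le> \<bar>x\<bar> * exp (r * \<bar>x\<bar>)"
    using assms(3) by (simp add: pos_divide_le_eq mult_ac)
  have "r * \<bar>x\<bar> \<le> exp (r * \<bar>x\<bar>)" using exp_ge_add_one_self[of "r * \<bar>x\<bar>"] by linarith
  hence "\<bar>x\<bar> \<le> exp (r * \<bar>x\<bar>) / r" using assms(1) by (simp add: pos_le_divide_eq mult.commute)
  hence "\<bar>x\<bar> * exp (r * \<bar>x\<bar>) \<le> exp (r * \<bar>x\<bar>) / r * exp (r * \<bar>x\<bar>)" by (rule mult_right_mono) simp
  also have "\<dots> = exp (2 * r * \<bar>x\<bar>) / r" by (simp add: exp_add[symmetric])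
  finally have "\<bar>exp (h * x) - 1\<bar> / \<bar>h\<bar> \<le> exp (2 * r * \<bar>x\<bar>) / r" using 1 by linarith
  hence "exp (t * x) * (\<bar>exp (h * x) - 1\<bar> / \<bar>h\<bar>) \<le> exp (t * x) * (exp (2 * r * \<bar>x\<bar>) / r)"
    by (rule mult_left_mono) simp
  also have "\<dots> = exp (t * x + 2 * r * \<bar>x\<bar>) / r" by (simp add: exp_add)
  also have "\<dots> \<le> (exp ((t + 2 * r) * x) + exp ((t - 2 * r) * x)) / r"
    using assms(1) by (intro divide_right_mono) (cases "x \<ge> 0"; simp add: algebra_simps add_increasing add_increasing2)+
  also have "exp (t * x) * (\<bar>exp (h * x) - 1\<bar> / \<bar>h\<bar>) = \<bar>(exp ((t + h) * x) - exp (t * x)) / h\<bar>"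
  proof -
    have "exp ((t + h) * x) - exp (t * x) = exp (t * x) * (exp (h * x) - 1)"
      by (simp add: exp_add[symmetric] algebra_simps)
    thus ?thesis by (simp add: abs_mult)
  qed
  finally show ?thesis .
qed

context iid_weights
begin

lemma mgf_fin_between:
  assumes "mgf_fin a" "mgf_fin b" "a \<le> t" "t \<le> b"
  shows "mgf_fin t"
  unfolding mgf_fin_def
proof (rule Bochner_Integration.integrable_bound)
  show "integrable D (\<lambda>x. exp (a * x) + exp (b * x))" using assms by (simp add: mgf_fin_def)
  show "(\<lambda>x. exp (t * x)) \<in> borel_measurable D" by (rule borel_measurable_D) simp
  show "AE x in D. norm (exp (t * x)) \<le> norm (exp (a * x) + exp (b * x))"
  proof (rule AE_I2)
    fix x :: real
    have "t * x \<le> a * x \<or> t * x \<le> b * x"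
      using assms(3,4) by (cases "x \<ge> 0") (auto intro: mult_right_mono mult_right_mono_neg)
    hence "exp (t * x) \<le> exp (a * x) + exp (b * x)"
      by (auto intro: add_increasing add_increasing2)
    thus "norm (exp (t * x)) \<le> norm (exp (a * x) + exp (b * x))" by simp
  qed
qed

lemma mgf_has_derivative:
  assumes "r > 0" "mgf_fin (t - 2 * r)" "mgf_fin (t + 2 * r)"
  shows "\<exists>m. (mgf has_real_derivative m) (at t)"
proof -
  define m where "m = (\<integral>x. x * exp (t * x) \<partial>D)"
  have "(\<lambda>h. (mgf (t + h) - mgf t) / h) \<midarrow>0\<rightarrow> m"
    unfolding tendsto_at_iff_sequentially
  proof (intro allI impI)
    fix X :: "nat \<Rightarrow> real" assume X: "\<forall>i. X i \<in> UNIV - {0}" "X \<longlonglongrightarrow> 0"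
    \<comment> \<open>Set to 0 for the finitely many \<open>n\<close> at which the increment is too
      large for the majorant.\<close>
    define f where "f n x = (if \<bar>X n\<bar> \<le> r then (exp ((t + X n) * x) - exp (t * x)) / X n else 0)" for n x
    have ev: "\<forall>\<^sub>F n in sequentially. \<bar>X n\<bar> \<le> r"
      using tendstoD[OF X(2) \<open>r > 0\<close>] by eventually_elim (simp add: dist_real_def)
    have "(\<lambda>n. \<integral>x. f n x \<partial>D) \<longlonglongrightarrow> m" unfolding m_def
    proof (rule integral_dominated_convergence[where w = "\<lambda>x. (exp ((t + 2 * r) * x) + exp ((t - 2 * r) * x)) / r"])
      show "integrable D (\<lambda>x. (exp ((t + 2 * r) * x) + exp ((t - 2 * r) * x)) / r)"
        using assms by (simp add: mgf_fin_def)
      show "(\<lambda>x. x * exp (t * x)) \<in> borel_measurable D" "f n \<in> borel_measurable D" for n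
        unfolding f_def by (rule borel_measurable_D, simp)+
      show "AE x in D. norm (f n x) \<le> (exp ((t + 2 * r) * x) + exp ((t - 2 * r) * x)) / r" for n
      proof (rule AE_I2)
        fix x
        have "X n \<noteq> 0" using X(1) by auto
        thus "norm (f n x) \<le> (exp ((t + 2 * r) * x) + exp ((t - 2 * r) * x)) / r"
          using exp_difference_quotient_bound[OF \<open>r > 0\<close>, of "X n" t x] \<open>r > 0\<close>
          by (auto simp: f_def)
      qed
      show "AE x in D. (\<lambda>n. f n x) \<longlonglongrightarrow> x * exp (t * x)"
      proof (rule AE_I2)
        fix x :: real
        have "((\<lambda>s. exp (s * x)) has_real_derivative x * exp (t * x)) (at t)"
          by (auto intro!: derivative_eq_intros)
        hence "(\<lambda>h. (exp ((t + h) * x) - exp (t * x)) / h) \<midarrow>0\<rightarrow> x * exp (t * x)"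
          by (simp add: DERIV_def)
        hence "(\<lambda>n. (exp ((t + X n) * x) - exp (t * x)) / X n) \<longlonglongrightarrow> x * exp (t * x)"
          using X unfolding tendsto_at_iff_sequentially by (auto simp: comp_def)
        thus "(\<lambda>n. f n x) \<longlonglongrightarrow> x * exp (t * x)"
          by (rule Lim_transform_eventually) (use ev in \<open>auto elim!: eventually_mono simp: f_def\<close>)
      qed
    qed
    moreover have "\<forall>\<^sub>F n in sequentially. (\<integral>x. f n x \<partial>D) = (mgf (t + X n) - mgf t) / X n"
      using ev
    proof eventually_elim
      case (elim n)
      have "mgf_fin (t + X n)" "mgf_fin t"
        using elim \<open>r > 0\<close> by (auto intro: mgf_fin_between[OF assms(2,3)])
      thus ?case using elim by (simp add: f_def mgf_def mgf_fin_def)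
    qed
    ultimately show "((\<lambda>h. (mgf (t + h) - mgf t) / h) \<circ> X) \<longlonglongrightarrow> m"
      unfolding comp_def by (rule Lim_transform_eventually)
  qed
  hence "(mgf has_real_derivative m) (at t)" by (simp add: DERIV_def)
  thus ?thesis by blast
qed

lemma log_mgf_has_derivative:
  assumes "r > 0" "mgf_fin (t - 2 * r)" "mgf_fin (t + 2 * r)"
  shows "\<exists>m. ((\<lambda>s. ln (mgf s)) has_real_derivative m) (at t)"
proof -
  obtain m where m: "(mgf has_real_derivative m) (at t)" using mgf_has_derivative[OF assms] by blast
  have "mgf t > 0" using \<open>r > 0\<close> by (intro mgf_pos mgf_fin_between[OF assms(2,3)]) auto
  from DERIV_chain2[OF DERIV_ln[OF this] m] show ?thesis by blast
qed

text \<open>The slope \<open>m\<close> of the logarithmic moment generating function at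
  \<open>t\<close> is the mean of the tilted law. As it lies strictly between \<open>\<rho>\<close>
  and \<open>M\<close>, a small step to the left and one to the right give the strict Chernoff
  conditions.\<close>

lemma tilt_params:
  assumes fin: "\<And>s. s \<in> {- x0..t1 + x0} \<Longrightarrow> mgf_fin s" "x0 > 0" "0 \<le> t" "t \<le> t1"
    and m: "((\<lambda>s. ln (mgf s)) has_real_derivative m) (at t)" and "\<rho> < m" "m < M"
  shows "\<exists>s>0. mgf_fin (t - s) \<and> exp (s * \<rho>) * mgf (t - s) < mgf t"
    and "\<exists>s>0. mgf_fin (t + s) \<and> exp (- s * M) * mgf (t + s) < mgf t"
proof -
  have "((\<lambda>s. ln (mgf s) - \<rho> * s) has_real_derivative m - \<rho>) (at t)"
    by (rule derivative_eq_intros m refl | simp)+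
  from DERIV_pos_inc_left[OF this] \<open>\<rho> < m\<close>
  obtain e where e: "e > 0" "\<And>h. 0 < h \<Longrightarrow> h < e \<Longrightarrow> ln (mgf (t - h)) - \<rho> * (t - h) < ln (mgf t) - \<rho> * t"
    by auto
  define s where "s = min e x0 / 2"
  have s: "s > 0" "s < e" "s \<le> x0" using e(1) \<open>x0 > 0\<close> by (auto simp: s_def)
  have f: "mgf_fin (t - s)" "mgf_fin t" using s assms by (auto intro!: fin(1))
  have "ln (mgf (t - s)) + s * \<rho> < ln (mgf t)" using e(2)[of s] s by (simp add: algebra_simps)
  hence "exp (ln (mgf (t - s)) + s * \<rho>) < exp (ln (mgf t))" by simp
  hence "exp (s * \<rho>) * mgf (t - s) < mgf t"
    using mgf_pos[OF f(1)] mgf_pos[OF f(2)] by (simp add: exp_add mult.commute)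
  thus "\<exists>s>0. mgf_fin (t - s) \<and> exp (s * \<rho>) * mgf (t - s) < mgf t" using s f by blast
next
  have "((\<lambda>s. ln (mgf s) - M * s) has_real_derivative m - M) (at t)"
    by (rule derivative_eq_intros m refl | simp)+
  from DERIV_neg_dec_right[OF this] \<open>m < M\<close>
  obtain e where e: "e > 0" "\<And>h. 0 < h \<Longrightarrow> h < e \<Longrightarrow> ln (mgf (t + h)) - M * (t + h) < ln (mgf t) - M * t"
    by auto
  define s where "s = min e x0 / 2"
  have s: "s > 0" "s < e" "s \<le> x0" using e(1) \<open>x0 > 0\<close> by (auto simp: s_def)
  have f: "mgf_fin (t + s)" "mgf_fin t" using s assms by (auto intro!: fin(1))
  have "ln (mgf (t + s)) - s * M < ln (mgf t)" using e(2)[of s] s by (simp add: algebra_simps)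
  hence "exp (ln (mgf (t + s)) + - s * M) < exp (ln (mgf t))" by simp
  hence "exp (- s * M) * mgf (t + s) < mgf t"
    using mgf_pos[OF f(1)] mgf_pos[OF f(2)] by (simp only: exp_add exp_ln mult.commute)
  thus "\<exists>s>0. mgf_fin (t + s) \<and> exp (- s * M) * mgf (t + s) < mgf t" using s f by blast
qed

text \<open>The slope \<open>\<rho>\<close> is attained by \<open>\<Lambda>'\<close> at a minimum of \<open>\<Lambda>(s) - \<rho> s\<close> over \<open>[0, t1]\<close>,
  unless \<open>\<Lambda>'(0) \<ge> \<rho>\<close>; in that case no tilting is needed.\<close>

lemma choose_tilt:
  assumes fin: "\<And>s. s \<in> {- x0..t1 + x0} \<Longrightarrow> mgf_fin s" "x0 > 0" "0 \<le> t1"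
    and m1: "((\<lambda>s. ln (mgf s)) has_real_derivative m1) (at t1)" "\<rho> < m1"
  shows "\<exists>t m. 0 \<le> t \<and> t \<le> t1 \<and> ((\<lambda>s. ln (mgf s)) has_real_derivative m) (at t) \<and>
    \<rho> \<le> m \<and> (t = 0 \<or> m = \<rho>)"
proof -
  have der: "\<exists>m. ((\<lambda>s. ln (mgf s)) has_real_derivative m) (at t)" if "0 \<le> t" "t \<le> t1" for t
    by (rule log_mgf_has_derivative[of "x0 / 2"]) (use that fin in auto)
  obtain m0 where m0: "((\<lambda>s. ln (mgf s)) has_real_derivative m0) (at 0)" using der[of 0] fin(3) by auto
  show ?thesis
  proof (cases "\<rho> \<le> m0")
    case True
    thus ?thesis using m0 fin(3) by (intro exI[of _ 0] exI[of _ m0]) auto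
  next
    case False
    define f where "f s = ln (mgf s) - \<rho> * s" for s
    have fder: "(f has_real_derivative m - \<rho>) (at t)"
      if "((\<lambda>s. ln (mgf s)) has_real_derivative m) (at t)" for t m
      unfolding f_def by (rule derivative_eq_intros that refl | simp)+
    have "continuous_on {0..t1} f"
    proof (intro continuous_at_imp_continuous_on ballI)
      fix t assume "t \<in> {0..t1}"
      then obtain m where "((\<lambda>s. ln (mgf s)) has_real_derivative m) (at t)" using der[of t] by auto
      from DERIV_isCont[OF fder[OF this]] show "isCont f t" .
    qed
    then obtain t where t: "t \<in> {0..t1}" and min: "\<And>s. s \<in> {0..t1} \<Longrightarrow> f t \<le> f s"
      using continuous_attains_inf[of "{0..t1}" f] fin(3) by auto
    have "t1 \<noteq> 0"
    proof
      assume "t1 = 0"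
      hence "m0 = m1" using DERIV_unique[OF m0] m1(1) by simp
      thus False using False m1(2) by simp
    qed
    hence t1: "t1 > 0" using fin(3) by simp
    \<comment> \<open>The slope of \<open>f\<close> is negative at 0 and positive at
      \<open>t1\<close>, so the minimum is interior.\<close>
    have "t \<noteq> 0"
    proof
      assume "t = 0"
      from DERIV_neg_dec_right[OF fder[OF m0]] False
      obtain e where e: "e > 0" "\<And>h. 0 < h \<Longrightarrow> h < e \<Longrightarrow> f (0 + h) < f 0" by auto
      define h where "h = min e t1 / 2"
      have "h > 0" "h < e" "h \<le> t1" using e(1) t1 by (auto simp: h_def)
      thus False using e(2)[of h] min[of h] \<open>t = 0\<close> by auto
    qed
    moreover have "t \<noteq> t1"
    proof
      assume "t = t1"
      from DERIV_pos_inc_left[OF fder[OF m1(1)]] m1(2)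
      obtain e where e: "e > 0" "\<And>h. 0 < h \<Longrightarrow> h < e \<Longrightarrow> f (t1 - h) < f t1" by auto
      define h where "h = min e t1 / 2"
      have "h > 0" "h < e" "h \<le> t1" using e(1) t1 by (auto simp: h_def)
      thus False using e(2)[of h] min[of "t1 - h"] \<open>t = t1\<close> by auto
    qed
    ultimately have tt: "0 < t" "t < t1" using t by auto
    obtain m where m: "((\<lambda>s. ln (mgf s)) has_real_derivative m) (at t)" using der[of t] t by auto
    have "m - \<rho> = 0"
    proof (rule DERIV_local_min[OF fder[OF m]])
      show "0 < min t (t1 - t)" using tt by simp
      show "\<forall>y. \<bar>t - y\<bar> < min t (t1 - t) \<longrightarrow> f t \<le> f y" using min by (auto simp: abs_if split: if_splits)
    qed
    thus ?thesis using m t by (intro exI[of _ t] exI[of _ m]) auto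
  qed
qed

text \<open>Provides a finite mean deficit below \<open>\<rho>\<close>, to which Markov's inequality
  is applied for thin cells. The linear growth at minus infinity is dominated by the exponential
  moment at \<open>- x0\<close>.\<close>

lemma integrable_negative_part:
  assumes "mgf_fin (- x0)" "x0 > 0"
  shows "integrable D (\<lambda>x. max 0 (\<rho> - x))"
proof (rule Bochner_Integration.integrable_bound)
  interpret D: prob_space D by (rule prob_D)
  show "integrable D (\<lambda>x. \<bar>\<rho>\<bar> + exp (- x0 * x) / x0)"
    using assms by (simp add: mgf_fin_def)
  show "(\<lambda>x. max 0 (\<rho> - x)) \<in> borel_measurable D" by (rule borel_measurable_D) simp
  show "AE x in D. norm (max 0 (\<rho> - x)) \<le> norm (\<bar>\<rho>\<bar> + exp (- x0 * x) / x0)"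
  proof (rule AE_I2)
    fix x :: real
    have "- x0 * x \<le> exp (- x0 * x)" using exp_ge_add_one_self[of "- x0 * x"] by linarith
    hence "- x \<le> exp (- x0 * x) / x0" using assms(2) by (simp add: pos_le_divide_eq mult.commute)
    moreover have "0 \<le> exp (- x0 * x) / x0" using assms(2) by simp
    ultimately have "max 0 (\<rho> - x) \<le> \<bar>\<rho>\<bar> + exp (- x0 * x) / x0" by linarith
    thus "norm (max 0 (\<rho> - x)) \<le> norm (\<bar>\<rho>\<bar> + exp (- x0 * x) / x0)" by simp
  qed
qed

text \<open>Weights bounded by \<open>\<rho>\<close> would satisfy
  \<open>exp (t * x) \<le> exp (s * \<rho>) * exp ((t - s) * x)\<close>, against the strict
  inequality. Together with \<open>lower_mass_pos\<close> this provides the spread that makes a flip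
  condition fail with positive probability.\<close>

lemma upper_mass_pos:
  assumes "s > 0" "mgf_fin t" "mgf_fin (t - s)" "exp (s * \<rho>) * mgf (t - s) < mgf t"
  shows "0 < measure D {x. \<rho> < x}"
proof (rule ccontr)
  interpret D: prob_space D by (rule prob_D)
  assume "\<not> 0 < measure D {x. \<rho> < x}"
  hence "D.prob {x. \<rho> < x} = 0" using measure_nonneg[of D "{x. \<rho> < x}"] by linarith
  hence "AE x in D. x \<notin> {x. \<rho> < x}" using D.prob_eq_0[of "{x. \<rho> < x}"] sets_D by simp
  hence "AE x in D. exp (t * x) \<le> exp (s * \<rho>) * exp ((t - s) * x)"
  proof eventually_elim
    case (elim x)
    hence "s * x \<le> s * \<rho>" using assms(1) by simp
    thus ?case by (simp add: exp_add[symmetric] algebra_simps)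
  qed
  hence "mgf t \<le> (\<integral>x. exp (s * \<rho>) * exp ((t - s) * x) \<partial>D)"
    unfolding mgf_def using assms by (intro integral_mono_AE) (auto simp: mgf_fin_def)
  thus False using assms(4) by (simp add: mgf_def)
qed

text \<open>If almost all weights exceeded \<open>\<rho>\<close>, so would the average along every
  path, and \<open>hit\<close> could not tend to 0.\<close>

lemma lower_mass_pos:
  assumes lim: "(\<lambda>n. hit (\<chi> i::'d::finite. int n) (\<rho> * (real CARD('d) * real n))) \<longlonglongrightarrow> 0"
  shows "0 < measure D {x. x \<le> \<rho>}"
proof (rule ccontr)
  interpret D: prob_space D by (rule prob_D)
  assume "\<not> 0 < measure D {x. x \<le> \<rho>}"
  hence "D.prob {x. x \<le> \<rho>} = 0" using measure_nonneg[of D "{x. x \<le> \<rho>}"] by linarith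
  moreover have "D.prob (UNIV - {x. x \<le> \<rho>}) = 1 - D.prob {x. x \<le> \<rho>}"
    using D.prob_compl[of "{x. x \<le> \<rho>}"] sets_D space_D by simp
  moreover have "UNIV - {x. x \<le> \<rho>} = {x. \<rho> < x}" by auto
  ultimately have p: "measure D {x. \<rho> < x} = 1" by simp
  have "1 \<le> hit (\<chi> i::'d. int n) (\<rho> * (real CARD('d) * real n))" if n: "n > 0" for n
  proof -
    obtain js :: "'d list" where js: "pos js = (\<chi> i. int n)" using diag_steps_nonempty by blast
    have len: "length js = CARD('d) * n" using level_pos[of js] unfolding js level_const of_nat_eq_iff by simp
    define V where "V = (\<lambda>k. pos (take (Suc k) js)) ` {..<length js}"
    have "1 ^ card V \<le> Pr (\<lambda>w. \<forall>x\<in>V. \<rho> < w x)"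
    proof (rule Harris_Ball[where r = "(\<le>)" and J = V])
      fix x assume "x \<in> V"
      thus "depends_on V (\<lambda>w. \<rho> < w x)" by (intro depends_onI) auto
      have "Pr (\<lambda>w. \<rho> < w x) = measure D {x. \<rho> < x}" by (rule Pr_coord) measurable
      thus "1 \<le> Pr (\<lambda>w. \<rho> < w x)" using p by simp
      show "\<rho> < w x" if "v \<le> w" "\<rho> < v x" for v w :: "int ^ 'd \<Rightarrow> real"
        using that by (auto simp: le_fun_def intro: less_le_trans)
    qed (auto simp: V_def)
    also have "\<dots> \<le> hit (\<chi> i::'d. int n) (\<rho> * (real CARD('d) * real n))" unfolding hit_def
    proof (rule Pr_mono)
      fix w :: "int ^ 'd \<Rightarrow> real" assume w: "\<forall>x\<in>V. \<rho> < w x"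
      have "(\<Sum>k<length js. \<rho>) < (\<Sum>k<length js. w (0 + pos (take (Suc k) js)))"
      proof (rule sum_strict_mono)
        show "{..<length js} \<noteq> {}" using n len by (simp add: lessThan_empty_iff)
      qed (use w in \<open>auto simp: V_def\<close>)
      hence "\<rho> * (real CARD('d) * real n) < walk_sum w 0 js"
        by (simp add: walk_sum_eq_sum len mult.commute)
      thus "\<exists>js. pos js = (\<chi> i::'d. int n) \<and> \<rho> * (real CARD('d) * real n) < walk_sum w 0 js"
        using js by blast
    qed measurable
    finally show ?thesis by simp
  qed
  moreover have "\<forall>\<^sub>F n in sequentially. hit (\<chi> i::'d. int n) (\<rho> * (real CARD('d) * real n)) < 1"
    using lim by (intro order_tendstoD(2)) auto
  then obtain n0 where "\<And>n. n \<ge> n0 \<Longrightarrow> hit (\<chi> i::'d. int n) (\<rho> * (real CARD('d) * real n)) < 1"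
    by (auto simp: eventually_sequentially)
  from this[of "Suc n0"] have "hit (\<chi> i::'d. int (Suc n0)) (\<rho> * (real CARD('d) * real (Suc n0))) < 1"
    using le_SucI[OF order_refl] by blast
  ultimately show False by (metis not_le zero_less_Suc)
qed

end

section \<open>Likely paths\<close>

definition maximal_steps :: "nat \<Rightarrow> 'd::finite list \<Rightarrow> (int ^ 'd \<Rightarrow> real) \<Rightarrow> bool" where
  "maximal_steps n js w \<longleftrightarrow> (\<forall>ks. pos ks = diag n \<longrightarrow> walk_sum w 0 ks \<le> walk_sum w 0 js)"

context iid_weights
begin

lemma pred_maximal_steps: "Measurable.pred Q (maximal_steps n js)"
  unfolding maximal_steps_def[abs_def] by (rule pred_geodesic)

text \<open>The event on the corner path and the events off it use disjoint sets of sites, so their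
  probabilities multiply. Independence is essential here, as the former is increasing and the latter
  are decreasing. The constant \<open>p0\<close> is absorbed into half of
  \<open>\<epsilon>\<close>.\<close>

lemma corner_prob_ge:
  fixes \<rho> \<delta> \<epsilon> M :: real
  assumes t: "mgf_fin t" "t \<ge> 0" and s: "s > 0" "mgf_fin (t - s)" "exp (s * \<rho>) * mgf (t - s) < mgf t"
    and s': "s' > 0" "mgf_fin (t + s')" "exp (- s' * M) * mgf (t + s') < mgf t"
    and "\<delta> > 0" and int: "integrable D (\<lambda>x. max 0 (\<rho> - x))" and p: "0 < measure D {x. x \<le> \<rho>}"
    and lim: "(\<lambda>n. hit (\<chi> i::'d::{finite,linorder}. int n) ((\<rho> - \<delta>) * (real CARD('d) * real n))) \<longlonglongrightarrow> 0"
    and "\<epsilon> > 0"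
  shows "\<forall>\<^sub>F n in sequentially.
    exp (- \<epsilon> * real n) * (mgf t ^ (CARD('d) * n + 1) * exp (- (t * (M * real (CARD('d) * n + 1)))))
      \<le> Pr (maximal_steps n (corner_steps n :: 'd list))"
proof -
  let ?d = "CARD('d)"
  have d: "?d \<ge> 1" by (simp add: Suc_leI)
  obtain p0 where p0: "p0 > 0" and line: "\<forall>\<^sub>F n in sequentially.
      p0 * (mgf t ^ (?d * n + 1) * exp (- (t * (M * real (?d * n + 1))))) \<le> Pr (good_line \<rho> ?d n)"
    using good_line_lower_bound[OF t s s' d] by blast
  have e2: "\<epsilon> / 2 > 0" using \<open>\<epsilon> > 0\<close> by simp
  note off = off_good_prob[OF \<open>\<delta> > 0\<close> int p lim e2]
  have big: "\<forall>\<^sub>F n in sequentially. - ln p0 / (\<epsilon> / 2) \<le> real n"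
    using filterlim_real_sequentially by (simp add: filterlim_at_top)
  show ?thesis using line off big
  proof eventually_elim
    case (elim n)
    let ?N = "?d * n"
    let ?\<gamma> = "corner_vertex n :: nat \<Rightarrow> int ^ 'd::{finite,linorder}"
    define X where "X = mgf t ^ (?N + 1) * exp (- (t * (M * real (?N + 1))))"
    have X: "X > 0" using mgf_pos[OF t(1)] by (simp add: X_def)
    define A where "A w \<longleftrightarrow> good_line \<rho> ?d n (\<lambda>l. w (?\<gamma> l))" for w :: "'d::{finite,linorder} weights"
    define B where "B w \<longleftrightarrow> (\<forall>i\<in>{1..<?d}. \<forall>a\<in>{1..i * n}. \<forall>b\<in>{1..?N - i * n}. off_good \<rho> n (i * n) a b w)"
      for w :: "'d::{finite,linorder} weights"
    \<comment> \<open>Allows the event stated for weights indexed by \<open>nat\<close> to be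
      transported to the sites of the corner path.\<close>
    have inj: "inj_on ?\<gamma> {..?N}"
    proof (rule inj_onI)
      fix l l' assume "l \<in> {..?N}" "l' \<in> {..?N}" "?\<gamma> l = ?\<gamma> l'"
      hence "int l = int l'" by (metis atMost_iff level_corner_vertex)
      thus "l = l'" by simp
    qed
    have mA: "Measurable.pred Q A"
    proof -
      have "(\<lambda>w l. w (?\<gamma> l)) \<in> Q \<rightarrow>\<^sub>M Q" by (rule measurable_into_Q) simp
      from measurable_compose[OF this pred_good_line] show ?thesis by (simp add: A_def[abs_def])
    qed
    have mB: "Measurable.pred Q B" unfolding B_def by measurable
    have "Pr A = Pr (good_line \<rho> ?d n)"
      unfolding A_def by (rule Pr_reindex[OF inj good_line_depends_on pred_good_line])
    hence PA: "p0 * X \<le> Pr A" using elim(1) by (simp add: X_def)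
    have PB: "exp (- (\<epsilon> / 2) * real n) \<le> Pr B" using elim(2) by (simp add: B_def[abs_def])
    have dA: "depends_on (?\<gamma> ` {..?N}) A"
    proof (rule depends_onI)
      fix v w :: "'d::{finite,linorder} weights" assume *: "\<And>x. x \<in> ?\<gamma> ` {..?N} \<Longrightarrow> v x = w x"
      show "A v = A w" unfolding A_def by (rule depends_onD[OF good_line_depends_on]) (use * in auto)
    qed
    have dB: "depends_on (off_vertices n) B"
    proof (rule depends_onI)
      fix v w :: "'d::{finite,linorder} weights" assume *: "\<And>x. x \<in> off_vertices n \<Longrightarrow> v x = w x"
      have "off_good \<rho> n (i * n) a b v = off_good \<rho> n (i * n) a b w"
        if "i \<in> {1..<?d}" "a \<in> {1..i * n}" "b \<in> {1..?N - i * n}" for i a b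
      proof (rule depends_onD[OF off_good_depends_on *])
        have "i * n \<le> ?N" using that by (intro mult_right_mono) auto
        thus "i * n + b \<le> ?N" using that by auto
      qed (use that in auto)
      thus "B v = B w" by (simp add: B_def)
    qed
    have disj: "?\<gamma> ` {..?N} \<inter> off_vertices n = {}" by (auto simp: off_vertices_def)
    have "exp (- \<epsilon> * real n) * X \<le> (p0 * X) * exp (- (\<epsilon> / 2) * real n)"
    proof -
      have "- ln p0 \<le> \<epsilon> / 2 * real n" using elim(3) e2 by (simp add: field_simps)
      hence "exp (- (\<epsilon> / 2 * real n)) \<le> exp (ln p0)" by simp
      hence "exp (- (\<epsilon> / 2 * real n)) \<le> p0" using p0 by simp
      hence "exp (- (\<epsilon> / 2 * real n)) * (X * exp (- (\<epsilon> / 2) * real n)) \<le> p0 * (X * exp (- (\<epsilon> / 2) * real n))"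
        using X by (intro mult_right_mono) auto
      moreover have "exp (- (\<epsilon> / 2 * real n)) * exp (- (\<epsilon> / 2) * real n) = exp (- \<epsilon> * real n)"
        by (simp add: exp_add[symmetric])
      ultimately show ?thesis by (simp add: mult_ac)
    qed
    also have "\<dots> \<le> Pr A * Pr B" using PA PB X p0 by (intro mult_mono) auto
    also have "\<dots> = Pr (\<lambda>w. A w \<and> B w)" by (rule Pr_conj_indep[symmetric, OF disj dA dB mA mB])
    also have "\<dots> \<le> Pr (maximal_steps n (corner_steps n :: 'd list))"
    proof (rule Pr_mono[OF _ pred_maximal_steps])
      fix w assume "A w \<and> B w"
      thus "maximal_steps n (corner_steps n) w"
        unfolding maximal_steps_def A_def B_def by (blast intro: corner_geodesic)
    qed
    finally show ?case by (simp add: X_def)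
  qed
qed

text \<open>Either all passage sums stay below \<open>c\<close>, or the geodesic has weight at least
  \<open>c\<close> and also wins against each of its flips.\<close>

lemma Pr_maximal_steps_le:
  fixes js :: "'d::finite list"
  assumes t: "mgf_fin t" "0 \<le> t" and \<kappa>: "0 \<le> \<kappa>" "\<kappa> \<le> 1" and js: "pos js = diag n"
    and flip: "\<And>x y :: int ^ 'd. x \<noteq> y \<Longrightarrow>
      (\<integral>w. exp (t * w x) * of_bool (w y \<le> w x) \<partial>Q) \<le> (1 - \<kappa>) * mgf t"
  shows "Pr (maximal_steps n js) \<le>
    Pr (\<lambda>w :: int ^ 'd \<Rightarrow> real. \<forall>js. pos js = diag n \<longrightarrow> walk_sum w 0 js < c)
    + exp (- t * c) * mgf t ^ (CARD('d) * n) * (1 - \<kappa>) ^ card (turns js)"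
proof -
  let ?A = "\<lambda>w :: int ^ 'd \<Rightarrow> real. \<forall>js. pos js = diag n \<longrightarrow> walk_sum w 0 js < c"
  let ?B = "\<lambda>w. c \<le> walk_sum w 0 js \<and> (\<forall>k\<in>turns js. w (flipped_vertex js k) \<le> w (vertex js k))"
  have len: "length js = CARD('d) * n" using level_pos[of js] unfolding js level_diag of_nat_eq_iff by simp
  have mA: "Measurable.pred Q ?A" by measurable
  have "Measurable.pred Q (\<lambda>w. \<forall>k\<in>turns js. w (flipped_vertex js k) \<le> w (vertex js k))"
    by (intro pred_intros_finite) auto
  hence mB: "Measurable.pred Q ?B" by measurable
  have "Pr (maximal_steps n js) \<le> Pr (\<lambda>w. ?A w \<or> ?B w)"
  proof (rule Pr_mono)
    fix w assume w: "maximal_steps n js w"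
    have "w (flipped_vertex js k) \<le> w (vertex js k)" if "k \<in> turns js" for k
      by (rule geodesic_imp_flip_le[OF _ that]) (use w js in \<open>auto simp: maximal_steps_def\<close>)
    moreover have "c \<le> walk_sum w 0 js" if "\<not> ?A w"
      using that w unfolding maximal_steps_def by (meson not_less order_trans)
    ultimately show "?A w \<or> ?B w" by blast
  qed (use mA mB in measurable)
  also have "\<dots> = measure Q (Collect ?A \<union> Collect ?B)" by (rule arg_cong[where f = "measure Q"]) auto
  also have "\<dots> \<le> Pr ?A + Pr ?B" by (rule measure_Un_le[OF sets_Q_Collect[OF mA] sets_Q_Collect[OF mB]])
  also have "Pr ?B \<le> exp (- t * c) * mgf t ^ length js * (1 - \<kappa>) ^ card (turns js)"
    by (rule Pr_turn_le[OF t \<kappa> flip])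
  finally show ?thesis by (simp add: len)
qed

text \<open>Both probabilities are compared at the same tilt \<open>t\<close>. The rates differ by
  at most \<open>5 * \<delta> * t\<close> per vertex, coming from the slopes
  \<open>\<mu> + 4 * \<delta>\<close> for the corner path and \<open>\<mu> - \<delta>\<close> for
  the other one, and \<open>\<delta>\<close> is so small that more than \<open>\<eta> n\<close>
  factors \<open>1 - \<kappa>\<close> outweigh this.\<close>

lemma likely_steps_few_turns:
  assumes d2: "CARD('d::{finite,linorder}) \<ge> 2"
    and tail: "\<And>t. 0 < t \<Longrightarrow> measure D {x. x < - t} \<le> exp (- c * t powr \<nu>)" and "c > 0" "\<nu> > 1"
    and fin: "\<And>s. s \<in> {- x0..t1 + x0} \<Longrightarrow> mgf_fin s" "x0 > 0" "0 \<le> t1"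
    and m1: "((\<lambda>s. ln (mgf s)) has_real_derivative m1) (at t1)" "\<mu> < m1"
    and up: "\<And>c1. \<mu> < c1 \<Longrightarrow> (\<lambda>n. hit (\<chi> i::'d::{finite,linorder}. int n) (c1 * (real CARD('d) * real n))) \<longlonglongrightarrow> 0"
    and lo: "\<And>c1. c1 < \<mu> \<Longrightarrow> (\<lambda>n. Pr (\<lambda>w :: 'd::{finite,linorder} weights. \<forall>js. pos js = diag n \<longrightarrow>
      walk_sum w 0 js < c1 * (real CARD('d) * real n))) \<longlonglongrightarrow> 0"
    and "\<eta> > 0"
  shows "\<forall>\<^sub>F n in sequentially. \<forall>js :: 'd list. pos js = diag n \<longrightarrow>
    Pr (maximal_steps n (corner_steps n :: 'd list)) \<le> Pr (maximal_steps n js) \<longrightarrow>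
    real (card (turns js)) \<le> \<eta> * real n"
proof -
  let ?d = "CARD('d)"
  \<comment> \<open>Two slopes strictly between \<open>\<mu>\<close> and \<open>m1\<close>: there is
    mass below the first because it exceeds the time constant, and mass above the second because the
    law tilted by \<open>t1\<close> has the larger mean \<open>m1\<close>.\<close>
  define \<rho>1 where "\<rho>1 = (2 * \<mu> + m1) / 3"
  define \<rho>2 where "\<rho>2 = (\<mu> + 2 * m1) / 3"
  have \<rho>12: "\<mu> < \<rho>1" "\<rho>1 \<le> \<rho>2" "\<rho>2 < m1" using m1(2) by (auto simp: \<rho>1_def \<rho>2_def)
  have fint1: "mgf_fin t1" using fin by auto
  have mass1: "0 < measure D {x. x \<le> \<rho>1}" by (rule lower_mass_pos[OF up[OF \<rho>12(1)]])
  obtain s0 where "s0 > 0" "mgf_fin (t1 - s0)" "exp (s0 * \<rho>2) * mgf (t1 - s0) < mgf t1"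
    using tilt_params(1)[OF fin(1,2,3) order_refl m1(1) \<rho>12(3), of "m1 + 1"] by auto
  hence mass2: "0 < measure D {x. \<rho>2 < x}" by (intro upper_mass_pos[OF _ fint1]) auto
  obtain \<kappa>0 where \<kappa>0: "\<kappa>0 > 0" "\<kappa>0 \<le> 1" and flip0: "\<And>t (x :: int ^ 'd::{finite,linorder}) y.
      0 \<le> t \<Longrightarrow> t \<le> t1 \<Longrightarrow> mgf_fin t \<Longrightarrow> x \<noteq> y \<Longrightarrow>
      (\<integral>w. exp (t * w x) * of_bool (w y \<le> w x) \<partial>Q) \<le> (1 - \<kappa>0) * mgf t"
    using flip_constant[OF fint1 \<rho>12(2) mass1 mass2, where 'i = "int ^ 'd::{finite,linorder}"] by auto
  define \<kappa> where "\<kappa> = min \<kappa>0 (1 / 2)"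
  have \<kappa>: "0 < \<kappa>" "\<kappa> < 1" "\<kappa> \<le> \<kappa>0" using \<kappa>0 by (auto simp: \<kappa>_def)
  define \<beta> where "\<beta> = - ln (1 - \<kappa>)"
  have \<beta>: "\<beta> > 0" using \<kappa> by (simp add: \<beta>_def)
  have el: "exp (- \<beta>) = 1 - \<kappa>" using \<kappa> by (simp add: \<beta>_def)
  \<comment> \<open>The first bound leaves the slope \<open>\<mu> + 3 * \<delta>\<close> below
    \<open>m1\<close>; the second makes the discrepancy \<open>5 * \<delta> * t\<close> per vertex
    cost at most a quarter of the gain \<open>\<beta> * \<eta> * n\<close> from the turns.\<close>
  define \<delta> where "\<delta> = min ((m1 - \<mu>) / 6) (\<beta> * \<eta> / (20 * (t1 + 1) * real ?d))"
  have \<delta>: "\<delta> > 0" using m1(2) \<beta> \<open>\<eta> > 0\<close> fin(3) by (simp add: \<delta>_def)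
  have \<delta>1: "\<mu> + 3 * \<delta> < m1"
  proof -
    have "\<delta> \<le> (m1 - \<mu>) / 6" unfolding \<delta>_def by (rule min.cobounded1)
    also have "\<dots> < (m1 - \<mu>) / 3" using m1(2) by simp
    finally show ?thesis by simp
  qed
  have \<delta>2: "(t1 + 1) * (5 * \<delta>) * real ?d \<le> \<beta> * \<eta> / 4"
  proof -
    have "\<delta> \<le> \<beta> * \<eta> / (20 * (t1 + 1) * real ?d)" unfolding \<delta>_def by (rule min.cobounded2)
    moreover have "0 < 20 * (t1 + 1) * real ?d" using fin(3) by simp
    ultimately have "\<delta> * (20 * (t1 + 1) * real ?d) \<le> \<beta> * \<eta>" by (simp only: pos_le_divide_eq)
    moreover have "(t1 + 1) * (5 * \<delta>) * real ?d = \<delta> * (20 * (t1 + 1) * real ?d) / 4" by simp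
    ultimately show ?thesis by linarith
  qed
  obtain t m where t: "0 \<le> t" "t \<le> t1" and der: "((\<lambda>s. ln (mgf s)) has_real_derivative m) (at t)"
    and m: "\<mu> + 3 * \<delta> \<le> m" "t = 0 \<or> m = \<mu> + 3 * \<delta>"
    using choose_tilt[OF fin m1(1) \<delta>1] by blast
  have fint: "mgf_fin t" using t fin by auto
  define \<rho> where "\<rho> = \<mu> + 2 * \<delta>"
  define M where "M = m + \<delta>"
  have "\<rho> < m" "m < M" using m(1) \<delta> by (auto simp: \<rho>_def M_def)
  note params = tilt_params[OF fin(1,2) t der this]
  obtain s where s: "s > 0" "mgf_fin (t - s)" "exp (s * \<rho>) * mgf (t - s) < mgf t" using params(1) by auto
  obtain s' where s': "s' > 0" "mgf_fin (t + s')" "exp (- s' * M) * mgf (t + s') < mgf t" using params(2) by auto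
  \<comment> \<open>For \<open>t = 0\<close> both sides vanish, whatever \<open>m\<close>
    is.\<close>
  have tM: "t * M = t * (\<mu> + 4 * \<delta>)" using m(2) by (auto simp: M_def)
  have finx0: "mgf_fin (- x0)" using fin by auto
  have "\<mu> < \<rho>" "\<mu> < \<rho> - \<delta>" using \<delta> by (auto simp: \<rho>_def)
  have e4: "\<beta> * \<eta> / 4 > 0" using \<beta> \<open>\<eta> > 0\<close> by simp
  note low = corner_prob_ge[OF fint t(1) s s' \<delta> integrable_negative_part[OF finx0 fin(2)]
      lower_mass_pos[OF up[OF \<open>\<mu> < \<rho>\<close>]] up[OF \<open>\<mu> < \<rho> - \<delta>\<close>] e4]
  define c0 where "c0 = ln (mgf t) - t * (\<mu> + 4 * \<delta>)"
  have mgfe: "mgf t = exp (c0 + t * (\<mu> + 4 * \<delta>))" using mgf_pos[OF fint] by (simp add: c0_def)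
  \<comment> \<open>Large enough for the lower tail to stay below \<open>exp (E - 1)\<close>, where
    \<open>E\<close> is the exponent of the lower bound for the corner path.\<close>
  define K where "K = \<beta> * \<eta> / 4 + \<bar>c0\<bar> * (real ?d + 1) + 1"
  have lowtail: "\<forall>\<^sub>F n in sequentially. Pr (\<lambda>w :: 'd::{finite,linorder} weights. \<forall>js. pos js = diag n \<longrightarrow>
      walk_sum w 0 js < (\<mu> - \<delta>) * (real ?d * real n)) \<le> exp (- K * real n)"
    by (rule lower_tail_superexp[OF d2 tail \<open>c > 0\<close> \<open>\<nu> > 1\<close> finx0 fin(2) \<delta> lo])
  define n0 where "n0 = (\<bar>c0\<bar> + 1) / (\<beta> * \<eta> / 2)"
  have big: "\<forall>\<^sub>F n in sequentially. n0 \<le> real n"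
    using filterlim_real_sequentially by (simp add: filterlim_at_top)
  show ?thesis using low lowtail big eventually_ge_at_top[of 1]
  proof eventually_elim
    case (elim n)
    show ?case
    proof (intro allI impI, rule ccontr)
      fix js :: "'d list"
      assume js: "pos js = diag n" and likely: "Pr (maximal_steps n (corner_steps n :: 'd list)) \<le> Pr (maximal_steps n js)"
        and many: "\<not> real (card (turns js)) \<le> \<eta> * real n"
      let ?N = "real ?d * real n"
      have flip: "(\<integral>w. exp (t * w x) * of_bool (w y \<le> w x) \<partial>Q) \<le> (1 - \<kappa>) * mgf t" if "x \<noteq> y" for x y :: "int ^ 'd::{finite,linorder}"
        by (rule order_trans[OF flip0[OF t fint that]]) (use \<kappa> mgf_pos[OF fint] in \<open>simp add: mult_right_mono\<close>)
      define E where "E = - (\<beta> * \<eta> / 4) * real n + c0 * (?N + 1)"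
      have "exp E = exp (- (\<beta> * \<eta> / 4) * real n) * (mgf t ^ (?d * n + 1) * exp (- (t * (M * real (?d * n + 1)))))"
      proof -
        have "mgf t ^ (?d * n + 1) = exp ((?N + 1) * (c0 + t * (\<mu> + 4 * \<delta>)))"
          unfolding mgfe exp_of_nat_mult[symmetric] by simp
        moreover have "t * (M * real (?d * n + 1)) = t * (\<mu> + 4 * \<delta>) * (?N + 1)"
          unfolding tM[symmetric] by (simp add: mult_ac)
        ultimately show ?thesis by (simp add: E_def exp_add[symmetric] algebra_simps)
      qed
      also have "\<dots> \<le> Pr (maximal_steps n js)" using elim(1) likely by linarith
      also have "\<dots> \<le> Pr (\<lambda>w :: 'd::{finite,linorder} weights. \<forall>js. pos js = diag n \<longrightarrow> walk_sum w 0 js < (\<mu> - \<delta>) * ?N)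
          + exp (- t * ((\<mu> - \<delta>) * ?N)) * mgf t ^ (?d * n) * (1 - \<kappa>) ^ card (turns js)"
        by (rule Pr_maximal_steps_le[OF fint t(1) _ _ js flip]) (use \<kappa> in auto)
      also have "\<dots> \<le> exp (- K * real n) + exp (E - 1)"
      proof (rule add_mono[OF elim(2)])
        have "(1 - \<kappa>) ^ card (turns js) = exp (- (\<beta> * real (card (turns js))))"
          by (simp add: el[symmetric] exp_of_nat_mult[symmetric] mult.commute)
        moreover have "mgf t ^ (?d * n) = exp (?N * (c0 + t * (\<mu> + 4 * \<delta>)))"
          unfolding mgfe exp_of_nat_mult[symmetric] by simp
        ultimately have "exp (- t * ((\<mu> - \<delta>) * ?N)) * mgf t ^ (?d * n) * (1 - \<kappa>) ^ card (turns js)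
            = exp (t * (5 * \<delta>) * ?N + c0 * ?N - \<beta> * real (card (turns js)))"
          by (simp add: exp_add[symmetric] algebra_simps)
        also have "\<dots> \<le> exp (E - 1)"
        proof -
          have 1: "\<beta> * (\<eta> * real n) \<le> \<beta> * real (card (turns js))" using many \<beta> by (intro mult_left_mono) auto
          have "t * (5 * \<delta>) * real ?d \<le> (t1 + 1) * (5 * \<delta>) * real ?d"
            using t \<delta> by (intro mult_right_mono) auto
          hence "t * (5 * \<delta>) * real ?d \<le> \<beta> * \<eta> / 4" using \<delta>2 by linarith
          hence "t * (5 * \<delta>) * real ?d * real n \<le> \<beta> * \<eta> / 4 * real n" by (rule mult_right_mono) simp
          hence 2: "t * (5 * \<delta>) * ?N \<le> \<beta> * \<eta> / 4 * real n" by (simp only: mult.assoc)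
          have "\<bar>c0\<bar> + 1 \<le> \<beta> * \<eta> / 2 * real n"
            using elim(3) e4 unfolding n0_def by (simp add: pos_divide_le_eq mult.commute)
          hence 3: "\<bar>c0\<bar> + 1 \<le> \<beta> * (\<eta> * real n) / 2" by simp
          have 4: "\<beta> * \<eta> / 4 * real n = \<beta> * (\<eta> * real n) / 4" by simp
          have "t * (5 * \<delta>) * ?N + c0 * ?N - \<beta> * real (card (turns js)) \<le> E - 1"
            using 1 2 3 unfolding E_def 4 by (simp add: distrib_left 4)
          thus ?thesis by simp
        qed
        finally show "exp (- t * ((\<mu> - \<delta>) * ?N)) * mgf t ^ (?d * n) * (1 - \<kappa>) ^ card (turns js) \<le> exp (E - 1)" .
      qed
      also have "exp (- K * real n) \<le> exp (E - 1)"
      proof -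
        have n1: "1 \<le> real n" using elim(4) by simp
        have "\<bar>c0\<bar> * (?N + 1) \<le> \<bar>c0\<bar> * ((real ?d + 1) * real n)"
          using n1 by (intro mult_left_mono) (auto simp: algebra_simps)
        moreover have "- \<bar>c0\<bar> * (?N + 1) \<le> c0 * (?N + 1)" by (intro mult_right_mono) auto
        ultimately have "- K * real n \<le> E - 1" using n1 by (simp add: K_def E_def algebra_simps)
        thus ?thesis by simp
      qed
      \<comment> \<open>Each of the two terms is at most \<open>exp (E - 1)\<close>; since
        \<open>e > 2\<close>, their sum cannot reach \<open>exp E\<close>.\<close>
      finally have "exp E \<le> 2 * exp (E - 1)" by simp
      hence "exp E * exp 1 \<le> 2 * exp E" by (simp add: exp_diff field_simps)
      hence "exp (1 :: real) \<le> 2" by simp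
      moreover have "2 < exp (1 :: real)" using exp_lower_Taylor_quadratic[of 1] by simp
      ultimately show False by simp
    qed
  qed
qed

end

section \<open>Entropy of paths with few turns, and the two stated bounds\<close>

lemma card_few_turns_subexponential:
  assumes "\<epsilon> > 0"
  shows "\<exists>\<eta>>0. \<forall>\<^sub>F n in sequentially.
    real (card {js :: 'd::finite list. length js = CARD('d) * n \<and> real (card (turns js)) \<le> \<eta> * real n})
      \<le> exp (\<epsilon> * real n)"
proof -
  let ?d = "real CARD('d)"
  \<comment> \<open>With this \<open>x\<close>, the factor \<open>(1 + d x) ^ (d n)\<close> costs an
    exponent of at most \<open>\<epsilon> n / 4\<close>; the choice of \<open>\<eta>\<close> lets
    \<open>x ^ (- \<eta> n)\<close> cost another \<open>\<epsilon> n / 4\<close>, and the remaining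
    half absorbs one extra factor \<open>1 / x\<close>.\<close>
  define x where "x = min (1 / 2) (\<epsilon> / (4 * ?d\<^sup>2))"
  have x: "0 < x" "x \<le> 1" "x < 1" using assms by (auto simp: x_def min_less_iff_disj min_le_iff_disj)
  have dx: "?d\<^sup>2 * x \<le> \<epsilon> / 4"
  proof -
    have "x \<le> \<epsilon> / (4 * ?d\<^sup>2)" unfolding x_def by (rule min.cobounded2)
    hence "?d\<^sup>2 * x \<le> ?d\<^sup>2 * (\<epsilon> / (4 * ?d\<^sup>2))" by (rule mult_left_mono) simp
    thus ?thesis by simp
  qed
  define l where "l = - ln x"
  have l: "l > 0" using x by (simp add: l_def)
  have xl: "exp (- l) = x" using x by (simp add: l_def)
  define \<eta> where "\<eta> = \<epsilon> / (4 * l)"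
  have \<eta>: "\<eta> > 0" using assms l by (simp add: \<eta>_def)
  have big: "\<forall>\<^sub>F n in sequentially. 2 * l / \<epsilon> \<le> real n"
    using filterlim_real_sequentially by (simp add: filterlim_at_top)
  have "\<forall>\<^sub>F n in sequentially.
    real (card {js :: 'd list. length js = CARD('d) * n \<and> real (card (turns js)) \<le> \<eta> * real n}) \<le> exp (\<epsilon> * real n)"
    using big
  proof eventually_elim
    case (elim n)
    define k where "k = nat \<lfloor>\<eta> * real n\<rfloor>"
    have k: "real k \<le> \<eta> * real n" unfolding k_def using \<eta> by simp
    have "{js :: 'd list. length js = CARD('d) * n \<and> real (card (turns js)) \<le> \<eta> * real n}
        \<subseteq> {js. length js = CARD('d) * n \<and> card (turns js) \<le> k}"
      by (auto simp: k_def le_nat_floor)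
    hence "card {js :: 'd list. length js = CARD('d) * n \<and> real (card (turns js)) \<le> \<eta> * real n}
        \<le> card {js :: 'd list. length js = CARD('d) * n \<and> card (turns js) \<le> k}" (is "?C \<le> ?C'")
      by (intro card_mono finite_subset[OF _ finite_lists_length_eq[of "UNIV :: 'd set" "CARD('d) * n"]]) auto
    hence "real ?C \<le> real ?C'" by simp
    also have "real ?C' = (real ?C' * x ^ Suc k) * exp (l * real (Suc k))"
    proof -
      have "x ^ Suc k * exp (l * real (Suc k)) = 1"
        unfolding xl[symmetric] exp_of_nat_mult[symmetric] by (simp add: exp_add[symmetric] algebra_simps)
      thus ?thesis by (simp only: mult.assoc mult_1_right)
    qed
    also have "\<dots> \<le> (1 + ?d * x) ^ (CARD('d) * n) * exp (l * real (Suc k))"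
      by (rule mult_right_mono[OF card_few_turns[OF x(1,2)]]) simp
    also have "\<dots> \<le> exp (?d * x) ^ (CARD('d) * n) * exp (l * real (Suc k))"
      using x by (intro mult_right_mono power_mono exp_ge_add_one_self) auto
    also have "\<dots> = exp (?d\<^sup>2 * x * real n + l * real k + l)"
      by (simp add: exp_of_nat_mult[symmetric] exp_add[symmetric] algebra_simps power2_eq_square)
    also have "\<dots> \<le> exp (\<epsilon> * real n)"
    proof -
      have "?d\<^sup>2 * x * real n \<le> \<epsilon> / 4 * real n" using dx by (rule mult_right_mono) simp
      moreover have "l * real k \<le> l * (\<eta> * real n)" using k l by (intro mult_left_mono) auto
      moreover have "l * (\<eta> * real n) = \<epsilon> / 4 * real n" using l by (simp add: \<eta>_def)
      moreover have "l \<le> \<epsilon> / 2 * real n" using elim assms by (simp add: field_simps)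
      ultimately have "?d\<^sup>2 * x * real n + l * real k + l \<le> \<epsilon> * real n" by simp
      thus ?thesis by simp
    qed
    finally show ?case .
  qed
  thus ?thesis using \<eta> by blast
qed

lemma eventually_poly_le_exp:
  fixes c :: real and d :: nat
  assumes "c > 0" "d > 0"
  shows "\<forall>\<^sub>F n in sequentially. (real n * real d) ^ d \<le> exp (c * real n)"
proof -
  \<comment> \<open>Taking \<open>d\<close>-th roots reduces the claim to
    \<open>n d \<le> exp (a n)\<close>, which the quadratic term of the exponential series
    gives.\<close>
  define a where "a = c / real d"
  have a: "a > 0" using assms by (simp add: a_def)
  have "\<forall>\<^sub>F n in sequentially. 2 * real d / a\<^sup>2 \<le> real n"
    using filterlim_real_sequentially by (simp add: filterlim_at_top)
  thus ?thesis
  proof eventually_elim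
    case (elim n)
    have "2 * real d \<le> real n * a\<^sup>2" using elim a by (simp add: pos_divide_le_eq)
    hence "real n * (2 * real d) \<le> real n * (real n * a\<^sup>2)" by (rule mult_left_mono) simp
    hence "real n * real d \<le> (a * real n)\<^sup>2 / 2" by (simp add: power2_eq_square algebra_simps)
    also have "\<dots> \<le> 1 + a * real n + (a * real n)\<^sup>2 / 2" using a by simp
    also have "\<dots> \<le> exp (a * real n)" using a by (intro exp_lower_Taylor_quadratic) simp
    finally have "(real n * real d) ^ d \<le> exp (a * real n) ^ d" by (intro power_mono) auto
    also have "\<dots> = exp (c * real n)"
      using assms(2) by (simp add: exp_of_nat_mult[symmetric] a_def)
    finally show ?case .
  qed
qed

text \<open>The number of paths is at least \<open>d ^ (d n)\<close> up to a polynomial factor. The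
  numerator and this factor may each use half of the allowance
  \<open>exp (\<epsilon> d n ln d)\<close>.\<close>

lemma ratio_bound:
  fixes d n :: nat and L G \<epsilon> \<epsilon>1 :: real
  assumes "d \<ge> 2" "L \<le> exp (\<epsilon>1 * real n)" "\<epsilon>1 \<le> \<epsilon> * real d * ln (real d) / 2" "0 < G"
    and G: "real d ^ (d * n) \<le> G * (real n * real d) ^ d"
    and poly: "(real n * real d) ^ d \<le> exp (\<epsilon> * real d * ln (real d) / 2 * real n)"
  shows "L / G \<le> real d powr (- (real d * real n * (1 - \<epsilon>)))"
proof -
  define c where "c = \<epsilon> * real d * ln (real d) / 2"
  have d: "real d > 0" using assms(1) by simp
  have "L * real d ^ (d * n) \<le> exp (\<epsilon>1 * real n) * (G * (real n * real d) ^ d)"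
    using assms(2) G by (intro mult_mono) auto
  also have "\<dots> \<le> exp (c * real n) * (G * exp (c * real n))"
    using assms(3,4) poly unfolding c_def[symmetric]
    by (intro mult_mono) (auto intro: mult_right_mono)
  also have "\<dots> = G * exp (2 * c * real n)" by (simp add: exp_add[symmetric] algebra_simps)
  finally have "L * real d ^ (d * n) \<le> G * exp (2 * c * real n)" .
  moreover have dp: "real d ^ (d * n) = exp (real d * real n * ln (real d))"
    using d by (simp add: powr_realpow[symmetric] powr_def)
  ultimately have "L * exp (real d * real n * ln (real d)) * exp (- (real d * real n * ln (real d)))
      \<le> G * exp (2 * c * real n) * exp (- (real d * real n * ln (real d)))"
    by (intro mult_right_mono) simp_all
  hence "L \<le> G * exp (2 * c * real n - real d * real n * ln (real d))"
    by (simp add: mult.assoc exp_add[symmetric])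
  also have "exp (2 * c * real n - real d * real n * ln (real d)) = real d powr (- (real d * real n * (1 - \<epsilon>)))"
    using d by (simp add: powr_def c_def algebra_simps)
  finally show ?thesis using \<open>0 < G\<close> by (simp add: pos_divide_le_eq mult.commute)
qed

theorem corollary1:
  fixes M :: "'a measure"
    and \<omega> :: "int ^ 'd::{finite,linorder} \<Rightarrow> 'a \<Rightarrow> real"
    and \<nu> c \<mu> \<epsilon> :: real
  assumes "CARD('d) \<ge> 2"
    and "prob_space M"
    and "prob_space.indep_vars M (\<lambda>_. borel) \<omega> UNIV"
    and "\<forall>x. distr M borel (\<omega> x) = distr M borel (\<omega> 0)"
    and "\<nu> > 1" and "c > 0"
    and "\<forall>t>0. \<P>(s in M. \<omega> 0 s < - t) < exp (- c * t powr \<nu>)"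
    and "\<exists>\<delta>>0. {-\<delta><..<\<delta>} \<subseteq> log_mgf_finite M (\<omega> 0)"
    and "is_time_constant M \<omega> \<mu>"
    and "ereal \<mu> < sup_log_mgf_deriv M (\<omega> 0)"
    and "\<epsilon> > 0"
  shows "\<forall>\<^sub>F n in sequentially.
     real (card (likely_paths M \<omega> n)) \<le> exp (\<epsilon> * real n) \<and>
     real (card (likely_paths M \<omega> n)) / real (card (diag_paths n :: (int ^ 'd::{finite,linorder}) list set))
       \<le> real CARD('d) powr (- (real CARD('d) * real n * (1 - \<epsilon>)))"
proof -
  interpret canonical_model M \<omega> by (rule canonical_model.intro[OF assms(2-4)])
  let ?d = "real CARD('d)"
  have fin_iff: "mgf_fin t \<longleftrightarrow> t \<in> log_mgf_finite M (\<omega> 0)" for t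
    unfolding mgf_fin_def log_mgf_finite_def mem_Collect_eq
    by (rule integrable_distr_eq) (simp_all add: \<omega>_measurable)
  have mgf_eq: "log_mgf M (\<omega> 0) = (\<lambda>t. ln (mgf t))"
  proof
    fix t
    have "mgf t = (\<integral>s. exp (t * \<omega> 0 s) \<partial>M)"
      unfolding mgf_def by (rule integral_distr) (simp_all add: \<omega>_measurable)
    thus "log_mgf M (\<omega> 0) t = ln (mgf t)" by (simp add: log_mgf_def)
  qed
  obtain t1 where t1: "t1 \<ge> 0" "t1 \<in> interior (log_mgf_finite M (\<omega> 0))"
    "log_mgf M (\<omega> 0) differentiable at t1" "\<mu> < deriv (log_mgf M (\<omega> 0)) t1"
    using assms(10) unfolding sup_log_mgf_deriv_def less_SUP_iff by auto
  define m1 where "m1 = deriv (log_mgf M (\<omega> 0)) t1"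
  have m1: "((\<lambda>s. ln (mgf s)) has_real_derivative m1) (at t1)"
    using t1(3) unfolding m1_def mgf_eq by (simp add: DERIV_deriv_iff_real_differentiable)
  obtain e where e: "e > 0" "ball t1 e \<subseteq> log_mgf_finite M (\<omega> 0)" using t1(2) by (auto simp: mem_interior)
  obtain \<delta> where \<delta>: "\<delta> > 0" "{-\<delta><..<\<delta>} \<subseteq> log_mgf_finite M (\<omega> 0)" using assms(8) by auto
  \<comment> \<open>Small enough for \<open>- x0\<close> and \<open>t1 + x0\<close> to stay in the
    open intervals of finiteness around 0 and \<open>t1\<close>; finiteness passes to everything in
    between.\<close>
  define x0 where "x0 = min e \<delta> / 2"
  have x0: "x0 > 0" "x0 < e" "x0 < \<delta>" using e \<delta> by (auto simp: x0_def)
  have fin: "mgf_fin s" if "s \<in> {- x0..t1 + x0}" for s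
  proof (rule mgf_fin_between)
    show "mgf_fin (- x0)" unfolding fin_iff using \<delta>(2) x0 by auto
    show "mgf_fin (t1 + x0)" unfolding fin_iff using e(2) x0 by (auto simp: dist_real_def)
  qed (use that in auto)
  have tail: "measure D {x. x < - t} \<le> exp (- c * t powr \<nu>)" if "0 < t" for t
  proof -
    have "measure D {x. x < - t} = \<P>(s in M. \<omega> 0 s < - t)"
      by (subst measure_distr) (auto simp: vimage_def Int_def conj_commute)
    thus ?thesis using assms(7) that by (simp add: less_imp_le)
  qed
  \<comment> \<open>One rate for both claims: at most \<open>\<epsilon>\<close> for the first bound,
    at most half of \<open>\<epsilon> d ln d\<close> for the second.\<close>
  obtain \<epsilon>1 where \<epsilon>1: "\<epsilon>1 > 0" "\<epsilon>1 \<le> \<epsilon>" "\<epsilon>1 \<le> \<epsilon> * ?d * ln ?d / 2"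
  proof
    have "0 < \<epsilon> * ?d * ln ?d / 2" using assms(1,11) by simp
    thus "min \<epsilon> (\<epsilon> * ?d * ln ?d / 2) > 0" using assms(11) by simp
  qed auto
  obtain \<eta> where \<eta>: "\<eta> > 0" and count: "\<forall>\<^sub>F n in sequentially.
      real (card {js :: 'd list. length js = CARD('d) * n \<and> real (card (turns js)) \<le> \<eta> * real n}) \<le> exp (\<epsilon>1 * real n)"
    using card_few_turns_subexponential[OF \<epsilon>1(1), where 'd = 'd] by blast
  have few: "\<forall>\<^sub>F n in sequentially. \<forall>js :: 'd list. pos js = diag n \<longrightarrow>
      Pr (maximal_steps n (corner_steps n :: 'd list)) \<le> Pr (maximal_steps n js) \<longrightarrow>
      real (card (turns js)) \<le> \<eta> * real n"
  proof (rule likely_steps_few_turns[OF assms(1) tail assms(6,5) fin x0(1) t1(1) m1])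
    show "\<mu> < m1" using t1(4) by (simp add: m1_def)
  qed (use time_constant_prob[OF assms(9)] \<eta> in \<open>simp_all add: diag_def\<close>)
  have poly: "\<forall>\<^sub>F n in sequentially. (real n * ?d) ^ CARD('d) \<le> exp (\<epsilon> * ?d * ln ?d / 2 * real n)"
    by (rule eventually_poly_le_exp) (use assms(1,11) in auto)
  show ?thesis using few count poly eventually_ge_at_top[of 1]
  proof eventually_elim
    case (elim n)
    let ?S = "{js :: 'd list. length js = CARD('d) * n \<and> real (card (turns js)) \<le> \<eta> * real n}"
    have prob: "geodesic_prob M \<omega> n (path_of_steps js) = Pr (maximal_steps n js)" if "pos js = diag n" for js
      using geodesic_prob_eq[of js n] that by (simp add: diag_def maximal_steps_def[abs_def])
    have "likely_paths M \<omega> n \<subseteq> path_of_steps ` ?S"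
    proof
      fix \<gamma> assume \<gamma>: "\<gamma> \<in> likely_paths M \<omega> n"
      then obtain js where js: "\<gamma> = path_of_steps js" "pos js = diag n"
        by (auto simp: likely_paths_def diag_paths_eq steps_to_def diag_def)
      have "Pr (maximal_steps n (corner_steps n :: 'd list)) \<le> Pr (maximal_steps n js)"
        using \<gamma> prob[OF js(2)] prob[OF pos_corner_steps] by (simp add: likely_paths_def js(1) corner_path_eq)
      hence "real (card (turns js)) \<le> \<eta> * real n" using elim(1) js(2) by blast
      moreover have "length js = CARD('d) * n"
        using level_pos[of js] unfolding js(2) level_diag of_nat_eq_iff by simp
      ultimately show "\<gamma> \<in> path_of_steps ` ?S" using js(1) by blast
    qed
    moreover have "finite ?S"
      by (rule finite_subset[OF _ finite_lists_length_eq[of "UNIV :: 'd set" "CARD('d) * n"]]) auto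
    ultimately have "card (likely_paths M \<omega> n) \<le> card ?S" by (meson surj_card_le)
    hence L: "real (card (likely_paths M \<omega> n)) \<le> exp (\<epsilon>1 * real n)" using elim(2) by linarith
    have "diag_paths n \<noteq> ({} :: (int ^ 'd::{finite,linorder}) list set)"
      using diag_steps_nonempty[of n] unfolding diag_paths_eq by (auto simp: steps_to_def)
    moreover have "finite (diag_paths n :: (int ^ 'd::{finite,linorder}) list set)" unfolding diag_paths_eq by simp
    ultimately have G: "0 < real (card (diag_paths n :: (int ^ 'd::{finite,linorder}) list set))" by (simp add: card_gt_0_iff)
    have "exp (\<epsilon>1 * real n) \<le> exp (\<epsilon> * real n)" using \<epsilon>1 by (simp add: mult_right_mono)
    with L ratio_bound[OF assms(1) L \<epsilon>1(3) G card_diag_paths_ge[OF elim(4)] elim(3)]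
    show ?case by linarith
  qed
qed

end
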